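(* Let $n \geq 2$ and $q \geq 2$ be integers, let $l=n(2q-1)$, and let $G_{n}=\langle x,y: x^{2n}=1,\ y^{2}=x^{n},\ yxy^{-1}=x^{-1}\rangle$ be the dicyclic group of order $4n$. Then there are pseudo-real Riemann surfaces $S$ of genus $g=(l-1)(2n-1)$ such that ${\rm Aut}(S)=G_{n}$ and ${\rm Aut}^{+}(S)=\langle x \rangle$.
   Context: For a closed Riemann surface $S$, ${\rm Aut}(S)$ denotes the full group of conformal and anticonformal automorphisms of $S$, and ${\rm Aut}^{+}(S)$ its subgroup of conformal automorphisms. $S$ is called pseudo-real if it admits anticonformal automorphisms but no anticonformal involution. The equalities mean that there is an isomorphism ${\rm Aut}(S)\cong G_n$ carrying ${\rm Aut}^{+}(S)$ onto $\langle x\rangle$. *)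

theory Defs
  imports "HOL-Complex_Analysis.Complex_Analysis" "HOL-Homology.Homology"
    "HOL-Algebra.Free_Abelian_Groups" "HOL-Algebra.Bij" "HOL-Algebra.Generated_Groups"
begin

section \<open>Closed Riemann surfaces and their automorphisms\<close>

text \<open>
  A Riemann surface is given by a topology \<open>X\<close> on its points together with a (not necessarily
  maximal) holomorphic atlas \<open>A\<close>. A chart is a pair of its domain \<open>U\<close> and its coordinate map
  \<open>\<phi>\<close>; only the values of \<open>\<phi>\<close> on \<open>U\<close> matter.

  A closed Riemann surface has exactly continuum many points, so up to isomorphism its points may
  be taken in any fixed type of that cardinality, such as \<^typ>\<open>complex \<times> complex\<close>; the topology
  \<open>X\<close> need not be related to the usual one of that type.
\<close>

type_synonym 'a chart = "'a set \<times> ('a \<Rightarrow> complex)"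

definition complex_chart :: "'a topology \<Rightarrow> 'a chart \<Rightarrow> bool" where
  "complex_chart X c \<longleftrightarrow> (case c of (U, \<phi>) \<Rightarrow>
     openin X U \<and> open (\<phi> ` U) \<and>
     homeomorphic_map (subtopology X U) (top_of_set (\<phi> ` U)) \<phi>)"

definition holomorphic_atlas :: "'a topology \<Rightarrow> 'a chart set \<Rightarrow> bool" where
  "holomorphic_atlas X A \<longleftrightarrow>
     (\<forall>c\<in>A. complex_chart X c) \<and>
     (\<Union>(U, \<phi>)\<in>A. U) = topspace X \<and>
     (\<forall>(U, \<phi>)\<in>A. \<forall>(V, \<psi>)\<in>A. (\<psi> \<circ> inv_into U \<phi>) holomorphic_on \<phi> ` (U \<inter> V))"

definition closed_riemann_surface :: "'a topology \<Rightarrow> 'a chart set \<Rightarrow> bool" where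
  "closed_riemann_surface X A \<longleftrightarrow>
     topspace X \<noteq> {} \<and> connected_space X \<and> Hausdorff_space X \<and> compact_space X \<and>
     holomorphic_atlas X A"

text \<open>The topological genus: \<open>H\<^sub>1(X; \<int>)\<close> is free abelian of rank \<open>2g\<close>.\<close>

definition has_genus :: "'a topology \<Rightarrow> nat \<Rightarrow> bool" where
  "has_genus X g \<longleftrightarrow> homology_group 1 X \<cong> free_Abelian_group {..<2 * g}"

text \<open>
  Automorphisms are taken to be undefined outside the surface, as elements of \<^term>\<open>Bij\<close>, so that
  equal maps of the surface are equal as functions. The inverse of a conformal (anticonformal)
  homeomorphism is again conformal (anticonformal), so it need not be mentioned.
\<close>

definition conformal_automorphism :: "'a topology \<Rightarrow> 'a chart set \<Rightarrow> ('a \<Rightarrow> 'a) \<Rightarrow> bool" where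
  "conformal_automorphism X A f \<longleftrightarrow>
     f \<in> Bij (topspace X) \<and> homeomorphic_map X X f \<and>
     (\<forall>(U, \<phi>)\<in>A. \<forall>(V, \<psi>)\<in>A.
        (\<psi> \<circ> f \<circ> inv_into U \<phi>) holomorphic_on \<phi> ` {p \<in> U. f p \<in> V})"

definition anticonformal_automorphism :: "'a topology \<Rightarrow> 'a chart set \<Rightarrow> ('a \<Rightarrow> 'a) \<Rightarrow> bool" where
  "anticonformal_automorphism X A f \<longleftrightarrow>
     f \<in> Bij (topspace X) \<and> homeomorphic_map X X f \<and>
     (\<forall>(U, \<phi>)\<in>A. \<forall>(V, \<psi>)\<in>A.
        (cnj \<circ> \<psi> \<circ> f \<circ> inv_into U \<phi>) holomorphic_on \<phi> ` {p \<in> U. f p \<in> V})"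

definition Aut :: "'a topology \<Rightarrow> 'a chart set \<Rightarrow> ('a \<Rightarrow> 'a) monoid" where
  "Aut X A = (BijGroup (topspace X))
     \<lparr>carrier := {f. conformal_automorphism X A f \<or> anticonformal_automorphism X A f}\<rparr>"

definition Aut_plus :: "'a topology \<Rightarrow> 'a chart set \<Rightarrow> ('a \<Rightarrow> 'a) set" where
  "Aut_plus X A = {f. conformal_automorphism X A f}"

text \<open>An anticonformal map is never the identity, so an involution is one with square the identity.\<close>

definition pseudo_real :: "'a topology \<Rightarrow> 'a chart set \<Rightarrow> bool" where
  "pseudo_real X A \<longleftrightarrow> closed_riemann_surface X A \<and>
     (\<exists>f. anticonformal_automorphism X A f) \<and>
     \<not> (\<exists>f. anticonformal_automorphism X A f \<and> f \<otimes>\<^bsub>Aut X A\<^esub> f = \<one>\<^bsub>Aut X A\<^esub>)"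

section \<open>Groups given by generators and relations\<close>

text \<open>
  A letter \<open>(g, False)\<close> stands for the generator \<open>g\<close> and \<open>(g, True)\<close> for its inverse; a relation
  \<open>(u, v)\<close> stands for the equation \<open>u = v\<close>.
\<close>

type_synonym 'g word = "('g \<times> bool) list"

inductive word_equiv :: "('g word \<times> 'g word) set \<Rightarrow> 'g word \<Rightarrow> 'g word \<Rightarrow> bool" for R where
  relation: "(u, v) \<in> R \<Longrightarrow> word_equiv R u v"
| cancel: "word_equiv R [(g, b), (g, \<not> b)] []"
| embed: "word_equiv R u v \<Longrightarrow> word_equiv R (a @ u @ c) (a @ v @ c)"
| refl: "word_equiv R u u"
| sym: "word_equiv R u v \<Longrightarrow> word_equiv R v u"
| trans: "word_equiv R u v \<Longrightarrow> word_equiv R v w \<Longrightarrow> word_equiv R u w"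

definition word_class :: "('g word \<times> 'g word) set \<Rightarrow> 'g word \<Rightarrow> 'g word set" where
  "word_class R u = {v. word_equiv R u v}"

definition presented_group :: "('g word \<times> 'g word) set \<Rightarrow> 'g word set monoid" where
  "presented_group R =
     \<lparr>carrier = range (word_class R),
      mult = (\<lambda>P Q. {w. \<exists>u\<in>P. \<exists>v\<in>Q. word_equiv R (u @ v) w}),
      one = word_class R []\<rparr>"

lemma word_class_eq_iff: "word_class R u = word_class R v \<longleftrightarrow> word_equiv R u v"
  unfolding word_class_def
  by (auto intro: word_equiv.refl word_equiv.sym word_equiv.trans)

lemma word_equiv_append:
  assumes "word_equiv R u u'" "word_equiv R v v'"
  shows "word_equiv R (u @ v) (u' @ v')"
  using word_equiv.embed[OF assms(1), of "[]" v] word_equiv.embed[OF assms(2), of u' "[]"]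
  by (auto intro: word_equiv.trans)

lemma presented_group_mult:
  "word_class R u \<otimes>\<^bsub>presented_group R\<^esub> word_class R v = word_class R (u @ v)"
  unfolding presented_group_def word_class_def
  by (auto intro: word_equiv.refl word_equiv.trans[OF word_equiv_append])

lemma word_equiv_inverse: "word_equiv R (rev (map (\<lambda>(g, b). (g, \<not> b)) u) @ u) []"
proof (induction u)
  case (Cons a u)
  obtain g b where a: "a = (g, b)" by (cases a)
  have "word_equiv R [(g, \<not> b), (g, b)] []"
    using word_equiv.cancel[of R g "\<not> b"] by simp
  from word_equiv.embed[OF this, of "rev (map (\<lambda>(g, b). (g, \<not> b)) u)" u] Cons.IH
  show ?case by (auto simp: a intro: word_equiv.trans)
qed (auto intro: word_equiv.refl)

lemma group_presented_group: "group (presented_group R)"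
proof (rule groupI)
  show "\<exists>y\<in>carrier (presented_group R). y \<otimes>\<^bsub>presented_group R\<^esub> x = \<one>\<^bsub>presented_group R\<^esub>"
    if x: "x \<in> carrier (presented_group R)" for x
  proof -
    obtain u where u: "x = word_class R u"
      using x by (auto simp: presented_group_def)
    let ?y = "word_class R (rev (map (\<lambda>(g, b). (g, \<not> b)) u))"
    have "?y \<otimes>\<^bsub>presented_group R\<^esub> x = word_class R []"
      by (simp only: u presented_group_mult word_class_eq_iff word_equiv_inverse)
    then show ?thesis
      by (intro bexI[of _ ?y]) (auto simp: presented_group_def)
  qed
next
  have car: "carrier (presented_group R) = range (word_class R)"
    by (simp add: presented_group_def)
  have one: "\<one>\<^bsub>presented_group R\<^esub> = word_class R []"
    by (simp add: presented_group_def)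
  show "\<one>\<^bsub>presented_group R\<^esub> \<in> carrier (presented_group R)"
    by (simp add: car one)
  show "x \<otimes>\<^bsub>presented_group R\<^esub> y \<in> carrier (presented_group R)"
    if "x \<in> carrier (presented_group R)" "y \<in> carrier (presented_group R)" for x y
    using that by (auto simp: car presented_group_mult)
  show "x \<otimes>\<^bsub>presented_group R\<^esub> y \<otimes>\<^bsub>presented_group R\<^esub> z
      = x \<otimes>\<^bsub>presented_group R\<^esub> (y \<otimes>\<^bsub>presented_group R\<^esub> z)"
    if "x \<in> carrier (presented_group R)" "y \<in> carrier (presented_group R)"
      "z \<in> carrier (presented_group R)" for x y z
    using that by (auto simp: car presented_group_mult)
  show "\<one>\<^bsub>presented_group R\<^esub> \<otimes>\<^bsub>presented_group R\<^esub> x = x"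
    if "x \<in> carrier (presented_group R)" for x
    using that by (auto simp: car one presented_group_mult)
qed

section \<open>The dicyclic group\<close>

datatype dicyclic_gen = Gen_x | Gen_y

definition dicyclic_relations :: "nat \<Rightarrow> (dicyclic_gen word \<times> dicyclic_gen word) set" where
  "dicyclic_relations n =
     {(replicate (2 * n) (Gen_x, False), []),
      ([(Gen_y, False), (Gen_y, False)], replicate n (Gen_x, False)),
      ([(Gen_y, False), (Gen_x, False), (Gen_y, True)], [(Gen_x, True)])}"

definition dicyclic_group :: "nat \<Rightarrow> dicyclic_gen word set monoid" where
  "dicyclic_group n = presented_group (dicyclic_relations n)"

definition dicyclic_x :: "nat \<Rightarrow> dicyclic_gen word set" where
  "dicyclic_x n = word_class (dicyclic_relations n) [(Gen_x, False)]"

end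

theory Submission
  imports Defs
begin

text \<open>
  The surface \<open>X\<close> is the curve \<open>w\<^sup>m = Q z\<close> with \<open>m = 2n\<close>, completed by one point \<open>om\<close> over \<open>z = \<infinity>\<close>,
  where the roots of \<open>Q\<close> are \<open>0\<close>, \<open>2\<i>\<close>, \<open>- \<i>/2\<close> and \<open>j\<close>, \<open>- 1/j\<close> for \<open>2 \<le> j < l\<close>. Together with \<open>\<infinity>\<close>
  they are invariant under the antipodal map \<open>z \<mapsto> - 1 / cnj z\<close>, which lifts to an anticonformal
  map \<open>y\<close>. As \<open>2q - 1\<close> is odd, \<open>y\<^sup>2\<close> is \<open>(z, w) \<mapsto> (z, - w)\<close>, which is the \<open>n\<close>-th power of the rotation \<open>x\<close>
  multiplying \<open>w\<close> by a primitive \<open>m\<close>-th root of unity.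

  Genus: over a convex open set the curve is contractible if the set contains one root, and consists of
  \<open>m\<close> contractible sheets permuted cyclically if it contains none. Adding one root at a time, Mayer-Vietoris gives
  rank \<open>m - 1\<close> more in \<open>H\<^sub>1\<close>. The rotation fixes no nonzero class of \<open>H\<^sub>1\<close>, but near infinity it is homotopic to
  the identity, so the loop around \<open>om\<close> is null-homologous and adding \<open>om\<close> does not change \<open>H\<^sub>1\<close>.

  Automorphisms: let \<open>\<phi>\<close> be conformal. The component of \<open>z \<circ> \<phi>\<close> in an eigenspace of the rotation other than that
  of \<open>1\<close> is divisible by a power of \<open>w\<close>, hence has too many zeros for its few poles (all
  over the \<open>z\<close>-coordinate of \<open>\<phi>\<^sup>-\<^sup>1 om\<close>). So it vanishes, \<open>z \<circ> \<phi>\<close> is a Moebius transformation of \<open>z\<close>, and it preserves the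
  branch points. Only the identity does, so \<open>\<phi>\<close> is a power of \<open>x\<close>. Hence anticonformal maps have the
  form \<open>x\<^sup>i y\<close>, with square \<open>x\<^sup>n \<noteq> 1\<close>.
\<close>

section \<open>Homology of a space covered by two open sets\<close>

text \<open>With \<open>e = 2 * q - 1\<close> the degree \<open>m * e - 1\<close> of
  \<open>Q\<close> is -1 modulo \<open>m\<close>. Hence infinity is totally ramified, just like the
  roots; there are \<open>2 * l\<close> branch points, and Riemann-Hurwitz predicts the genus. The
  real roots together with infinity are also invariant under z -> -1/z and under complex
  conjugation, and conjugation would lift to an anticonformal involution. The antipodal pair 2i,
  -i/2 is there to break both symmetries. The homology argument avoids orientations and intersection
  numbers: that no class is fixed by the rotation is carried along the induction on the roots, only
  in order to decide at the end what attaching \<open>om\<close> does. Nothing is presupposed about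
  the rotation group being normal. That a conformal map descends to the sphere comes from comparing
  zeros with poles. The comparison is written as Liouville estimates for m-th powers of norms: the
  quotient of an eigencomponent by a power of \<open>w\<close> is a function of \<open>z\<close>
  alone, and \<open>norm w ^ m = norm (Q z)\<close> removes all fractional exponents.\<close>

lemma free_Abelian_group_sum_iso:
  assumes "S \<inter> T = {}"
  shows "(\<lambda>(x, y). x + y) \<in> iso (free_Abelian_group S \<times>\<times> free_Abelian_group T) (free_Abelian_group (S \<union> T))"
proof (rule isoI)
  let ?f = "\<lambda>(x, y). x + y :: 'a \<Rightarrow>\<^sub>0 int"
  have in_keys: "Poly_Mapping.keys (x + y) \<subseteq> S \<union> T" if "Poly_Mapping.keys x \<subseteq> S" "Poly_Mapping.keys y \<subseteq> T"
    for x y :: "'a \<Rightarrow>\<^sub>0 int"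
    using that keys_add[of x y] by blast
  show "?f \<in> hom (free_Abelian_group S \<times>\<times> free_Abelian_group T) (free_Abelian_group (S \<union> T))"
    by (rule homI) (use in_keys in \<open>fastforce simp: DirProd_def\<close>)+
  have "inj_on ?f (carrier (free_Abelian_group S \<times>\<times> free_Abelian_group T))"
  proof (rule inj_onI, clarsimp simp: DirProd_def)
    fix x y x' y' :: "'a \<Rightarrow>\<^sub>0 int"
    assume k: "Poly_Mapping.keys x \<subseteq> S" "Poly_Mapping.keys y \<subseteq> T"
      "Poly_Mapping.keys x' \<subseteq> S" "Poly_Mapping.keys y' \<subseteq> T" and eq: "x + y = x' + y'"
    have d: "x - x' = y' - y" using eq by (simp add: algebra_simps)
    have "Poly_Mapping.keys (x - x') \<subseteq> S" "Poly_Mapping.keys (y' - y) \<subseteq> T"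
      using k keys_diff[of x x'] keys_diff[of y' y] by blast+
    then have "Poly_Mapping.keys (x - x') \<subseteq> S \<inter> T" using d by auto
    then have "Poly_Mapping.keys (x - x') = {}" using assms by blast
    then have "x - x' = 0" by simp
    then show "x = x' \<and> y = y'" using d by simp
  qed
  moreover have "\<exists>u v. Poly_Mapping.keys u \<subseteq> S \<and> Poly_Mapping.keys v \<subseteq> T \<and> z = u + v"
    if "Poly_Mapping.keys z \<subseteq> S \<union> T" for z :: "'a \<Rightarrow>\<^sub>0 int"
  proof (rule free_Abelian_group_induct[OF that], goal_cases)
    case 1 show ?case by (rule exI[of _ 0], rule exI[of _ 0]) auto
  next
    case (2 x y)
    obtain u v u' v' where k: "Poly_Mapping.keys u \<subseteq> S" "Poly_Mapping.keys v \<subseteq> T" "x = u + v"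
      "Poly_Mapping.keys u' \<subseteq> S" "Poly_Mapping.keys v' \<subseteq> T" "y = u' + v'"
      using 2(3,4) by metis
    have "Poly_Mapping.keys (u - u') \<subseteq> S" "Poly_Mapping.keys (v - v') \<subseteq> T"
      using k keys_diff[of u u'] keys_diff[of v v'] by blast+
    then show ?case using k by (intro exI[of _ "u - u'"] exI[of _ "v - v'"]) (auto simp: algebra_simps)
  next
    case (3 a)
    then show ?case
    proof
      assume "a \<in> S" then show ?case by (intro exI[of _ "frag_of a"] exI[of _ 0]) auto
    next
      assume "a \<in> T" then show ?case by (intro exI[of _ 0] exI[of _ "frag_of a"]) auto
    qed
  qed
  ultimately show "bij_betw ?f (carrier (free_Abelian_group S \<times>\<times> free_Abelian_group T)) (carrier (free_Abelian_group (S \<union> T)))"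
    unfolding bij_betw_def
    by (auto simp: DirProd_def image_iff Bex_def dest!: subsetD[OF in_keys])
qed

lemma DirProd_free_Abelian_group_lessThan:
  assumes "A \<cong> free_Abelian_group {..<a::nat}" "B \<cong> free_Abelian_group {..<b::nat}" "group A" "group B"
  shows "A \<times>\<times> B \<cong> free_Abelian_group {..<a + b}"
proof -
  have "{..<b} \<approx> {a..<a + b}"
    by (metis add.commute add_diff_cancel_left' card_atLeastLessThan card_lessThan eqpoll_iff_card finite_atLeastLessThan finite_lessThan)
  then have "free_Abelian_group {..<b} \<cong> free_Abelian_group {a..<a + b}"
    by (simp add: isomorphic_free_Abelian_groups)
  then have B: "B \<cong> free_Abelian_group {a..<a + b}"
    using assms(2) iso_trans by blast
  have "A \<times>\<times> B \<cong> free_Abelian_group {..<a} \<times>\<times> free_Abelian_group {a..<a + b}"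
    using group.DirProd_iso_trans[OF assms(3) assms(1) B] by simp
  moreover have "free_Abelian_group {..<a} \<times>\<times> free_Abelian_group {a..<a + b} \<cong> free_Abelian_group ({..<a} \<union> {a..<a+b})"
    by (rule is_isoI, rule free_Abelian_group_sum_iso) auto
  moreover have "{..<a} \<union> {a..<a+b} = {..<a+b}" by auto
  ultimately show ?thesis using iso_trans by metis
qed

text \<open>A short exact sequence whose quotient is free abelian splits.\<close>

lemma extension_by_free_Abelian_group:
  assumes B: "comm_group B" and A: "comm_group A" and C: "comm_group C"
    and f: "f \<in> hom A B" "inj_on f (carrier A)"
    and g: "g \<in> hom B C" "g ` carrier B = carrier C"
    and ex: "f ` carrier A = kernel B C g"
    and Afree: "A \<cong> free_Abelian_group {..<a::nat}" and Cfree: "C \<cong> free_Abelian_group {..<b::nat}"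
  shows "B \<cong> free_Abelian_group {..<a + b}"
proof -
  interpret A: comm_group A by fact
  interpret B: comm_group B by fact
  interpret C: comm_group C by fact
  interpret f: group_hom A B f using f by unfold_locales auto
  interpret g: group_hom B C g using g by unfold_locales auto
  obtain h where h: "h \<in> iso (free_Abelian_group {..<b}) C"
    using Cfree by (meson C.iso_set_sym is_iso_def ex_in_conv)
  interpret h: group_hom "free_Abelian_group {..<b}" C h
    using h by (simp add: group_hom_def group_hom_axioms_def iso_def)
  have hin: "h (frag_of j) \<in> g ` carrier B" if "j < b" for j
    using that g(2) h.hom_closed by auto
  \<comment> \<open>Lifts of the images of the basis; freeness extends them to a homomorphism
    \<open>s\<close> that is a section of \<open>g\<close> up to the isomorphism
    \<open>h\<close>.\<close>
  obtain l where l: "\<And>j. j < b \<Longrightarrow> l j \<in> carrier B \<and> g (l j) = h (frag_of j)"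
  proof -
    have "\<forall>j. \<exists>c. j < b \<longrightarrow> c \<in> carrier B \<and> g c = h (frag_of j)" using hin by fastforce
    then show ?thesis using that by metis
  qed
  have "l ` {..<b} \<subseteq> carrier B" using l by auto
  then obtain s where s: "s \<in> hom (free_Abelian_group {..<b}) B" "\<And>j. j \<in> {..<b} \<Longrightarrow> s (frag_of j) = l j"
    using B.free_Abelian_group_universal by metis
  interpret s: group_hom "free_Abelian_group {..<b}" B s
    using s by (simp add: group_hom_def group_hom_axioms_def)
  have gs: "g (s z) = h z" if "Poly_Mapping.keys z \<subseteq> {..<b}" for z
  proof (rule free_Abelian_group_induct[OF that], goal_cases)
    case 1
    have "s 0 = \<one>\<^bsub>B\<^esub>" "h 0 = \<one>\<^bsub>C\<^esub>" using s.hom_one h.hom_one by auto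
    then show ?case by simp
  next
    case (2 x y)
    have "x - y = x \<otimes>\<^bsub>free_Abelian_group {..<b}\<^esub> inv\<^bsub>free_Abelian_group {..<b}\<^esub> y" using 2 by simp
    moreover have c: "x \<in> carrier (free_Abelian_group {..<b})" "y \<in> carrier (free_Abelian_group {..<b})"
      using 2 by auto
    moreover have "inv\<^bsub>free_Abelian_group {..<b}\<^esub> y \<in> carrier (free_Abelian_group {..<b})"
      using c by (rule_tac group.inv_closed) auto
    ultimately show ?case using 2
      by (simp only: s.hom_mult h.hom_mult s.hom_inv h.hom_inv g.hom_mult g.hom_inv s.hom_closed B.inv_closed)
  next
    case (3 a) then show ?case using s l by auto
  qed
  let ?k = "\<lambda>(x, y). f x \<otimes>\<^bsub>B\<^esub> s y"
  have "?k \<in> iso (A \<times>\<times> free_Abelian_group {..<b}) B"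
  proof (rule isoI)
    show hom: "?k \<in> hom (A \<times>\<times> free_Abelian_group {..<b}) B"
    proof (rule homI, clarsimp simp: DirProd_def)
      fix x y assume "x \<in> carrier (A \<times>\<times> free_Abelian_group {..<b})" "y \<in> carrier (A \<times>\<times> free_Abelian_group {..<b})"
      then obtain x1 x2 y1 y2 where xy: "x = (x1, x2)" "y = (y1, y2)" "x1 \<in> carrier A" "y1 \<in> carrier A"
         "x2 \<in> carrier (free_Abelian_group {..<b})" "y2 \<in> carrier (free_Abelian_group {..<b})"
        by (auto simp: DirProd_def)
      have "s (x2 + y2) = s x2 \<otimes>\<^bsub>B\<^esub> s y2" using s.hom_mult xy by simp
      then show "?k (x \<otimes>\<^bsub>A \<times>\<times> free_Abelian_group {..<b}\<^esub> y) = ?k x \<otimes>\<^bsub>B\<^esub> ?k y"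
        using xy by (simp add: B.m_ac s.hom_closed del: carrier_free_Abelian_group_iff)
    qed
    interpret k: group_hom "A \<times>\<times> free_Abelian_group {..<b}" B ?k
      using hom DirProd_group[OF A.is_group, of "free_Abelian_group {..<b}"]
      by (simp add: group_hom_def group_hom_axioms_def)
    have gf: "g (f x) = \<one>\<^bsub>C\<^esub>" if "x \<in> carrier A" for x
      using ex that by (auto simp: kernel_def)
    have "inj_on ?k (carrier (A \<times>\<times> free_Abelian_group {..<b}))"
    proof (subst k.inj_on_one_iff, clarsimp simp: DirProd_def)
      fix x y assume xy: "x \<in> carrier A" "Poly_Mapping.keys y \<subseteq> {..<b}" "f x \<otimes>\<^bsub>B\<^esub> s y = \<one>\<^bsub>B\<^esub>"
      have sy: "s y \<in> carrier B" using xy by simp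
      have "g (f x \<otimes>\<^bsub>B\<^esub> s y) = h y" using xy(1,2) gf gs sy by (simp add: g.hom_mult h.hom_closed)
      then have "h y = \<one>\<^bsub>C\<^esub>" using xy by simp
      then have y: "y = 0" using h h.inj_on_one_iff xy(2) by (auto simp: iso_def bij_betw_def)
      then have "f x = \<one>\<^bsub>B\<^esub>" using xy s.hom_one by simp
      then show "x = \<one>\<^bsub>A\<^esub> \<and> y = 0" using f.inj_on_one_iff f xy y by blast
    qed
    moreover have "\<exists>x\<in>carrier A. \<exists>y. Poly_Mapping.keys y \<subseteq> {..<b} \<and> z = f x \<otimes>\<^bsub>B\<^esub> s y" if z: "z \<in> carrier B" for z
    proof -
      obtain y where y: "Poly_Mapping.keys y \<subseteq> {..<b}" "h y = g z"
        using h z by (auto simp: iso_def bij_betw_def image_iff Ball_def) (metis (no_types, lifting) carrier_free_Abelian_group_iff g.hom_closed imageE)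
      have sy: "s y \<in> carrier B" using y by simp
      have "g (z \<otimes>\<^bsub>B\<^esub> inv\<^bsub>B\<^esub> s y) = \<one>\<^bsub>C\<^esub>" using y z gs sy by (simp add: g.hom_mult)
      then have "z \<otimes>\<^bsub>B\<^esub> inv\<^bsub>B\<^esub> s y \<in> kernel B C g" using z sy by (auto simp: kernel_def)
      then obtain x where x: "x \<in> carrier A" "f x = z \<otimes>\<^bsub>B\<^esub> inv\<^bsub>B\<^esub> s y" using ex by (metis imageE)
      then have "z = f x \<otimes>\<^bsub>B\<^esub> s y" using z sy by (simp add: B.m_assoc)
      then show ?thesis using x y by blast
    qed
    ultimately show "bij_betw ?k (carrier (A \<times>\<times> free_Abelian_group {..<b})) (carrier B)"
      unfolding bij_betw_def by (auto simp: DirProd_def image_iff Bex_def)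
  qed
  then have "A \<times>\<times> free_Abelian_group {..<b} \<cong> B" by (auto simp: is_iso_def)
  moreover have "A \<times>\<times> free_Abelian_group {..<b} \<cong> free_Abelian_group {..<a + b}"
    by (rule DirProd_free_Abelian_group_lessThan) (use Afree iso_refl in auto)
  moreover have "group (A \<times>\<times> free_Abelian_group {..<b})"
    by (rule DirProd_group[OF A.is_group]) simp
  ultimately show ?thesis by (meson group.iso_sym iso_trans)
qed

section \<open>Excision and the exact sequence for a cover by two open sets, one
  contractible\<close>

lemma excision_of_open_cover:
  assumes "openin X S" "openin X T" "S \<union> T = topspace X"
  shows "hom_induced p (subtopology X T) (S \<inter> T) X S id
    \<in> iso (relative_homology_group p (subtopology X T) (S \<inter> T)) (relative_homology_group p X S)"
proof -
  have sub: "S \<subseteq> topspace X" "T \<subseteq> topspace X" using assms openin_subset by auto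
  \<comment> \<open>What is excised is the complement of \<open>T\<close>: it is closed and lies in
    the open set \<open>S\<close>.\<close>
  have cl: "closedin X (topspace X - T)" using assms by blast
  have "X closure_of (topspace X - T) \<subseteq> X interior_of S"
    using assms by (simp add: closure_of_closedin[OF cl] interior_of_openin) auto
  moreover have "topspace X - (topspace X - T) = T" "S - (topspace X - T) = S \<inter> T" using sub by auto
  ultimately show ?thesis
    using homology_excision_axiom[of X "topspace X - T" S "topspace X" p] sub by simp
qed

text \<open>The class of any point generates the infinite cyclic zeroth homology, and the map to a
  one-point space sends it to a generator. That map is therefore injective, and the reduced group is
  its kernel.\<close>

lemma trivial_reduced_homology_group_path_connected:
  assumes pc: "path_connected_space X" and ne: "topspace X \<noteq> {}"
  shows "trivial_group (reduced_homology_group 0 X)"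
proof -
  let ?P = "discrete_topology {()}"
  let ?e = "hom_induced 0 X {} ?P {} (\<lambda>x. ())"
  obtain a where a: "a \<in> topspace X" using ne by blast
  define s where "s = restrict (\<lambda>x::nat \<Rightarrow> real. a) (standard_simplex 0)"
  have s: "singular_simplex 0 X s"
    using a by (auto simp: s_def singular_simplex_def)
  define q where "q = homologous_rel_set 0 X {} (frag_of s)"
  have cm: "continuous_map X ?P (\<lambda>x. ())" by auto
  have s': "singular_simplex 0 ?P (simplex_map 0 (\<lambda>x. ()) s)"
    using singular_simplex_simplex_map[OF s cm] by simp
  have cyc: "singular_relcycle 0 X {} (frag_of s)"
    by (simp add: chain_boundary_def s singular_chain_of singular_cycle)
  have eq: "?e q = homologous_rel_set 0 ?P {} (frag_of (simplex_map 0 (\<lambda>x. ()) s))"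
    using hom_induced_chain_map[of X ?P "\<lambda>x. ()" "{}" "{}" 0 "frag_of s"] cm cyc
    by (simp add: q_def chain_map_of)
  have i1: "pow (homology_group 0 X) q \<in> iso integer_group (homology_group 0 X)"
    unfolding q_def by (rule iso_integer_zeroth_homology_group[OF pc s])
  have "path_connected_space ?P" 
    unfolding path_connected_space_def by (auto simp: pathin_def intro!: exI[of _ "\<lambda>_. ()"])
  then have i2: "pow (homology_group 0 ?P) (?e q) \<in> iso integer_group (homology_group 0 ?P)"
    unfolding eq using iso_integer_zeroth_homology_group s' by blast
  interpret e: group_hom "homology_group 0 X" "homology_group 0 ?P" ?e
    by (simp add: group_hom_def group_hom_axioms_def hom_induced_empty_hom)
  have q: "q \<in> carrier (homology_group 0 X)"
    using cyc by (simp add: q_def carrier_relative_homology_group_0)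
  have "c = \<one>\<^bsub>homology_group 0 X\<^esub>" if c: "c \<in> carrier (homology_group 0 X)" "?e c = \<one>\<^bsub>homology_group 0 ?P\<^esub>" for c
  proof -
    obtain n :: int where n: "c = q [^]\<^bsub>homology_group 0 X\<^esub> n"
      using i1 c(1) by (auto simp: iso_def bij_betw_def integer_group_def)
    have "?e q [^]\<^bsub>homology_group 0 ?P\<^esub> n = ?e q [^]\<^bsub>homology_group 0 ?P\<^esub> (0::int)"
      using c(2) q n by (simp add: e.hom_int_pow)
    then have "n = 0"
      using i2 by (auto simp: iso_def bij_betw_def inj_on_def integer_group_def)
    then show ?thesis using n by simp
  qed
  then show ?thesis
    unfolding trivial_group_def carrier_reduced_homology_group kernel_def one_reduced_homology_group
    by auto
qed

text \<open>This is Mayer-Vietoris with one contractible piece: since \<open>T\<close> is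
  contractible, excision identifies the homology of \<open>X\<close> relative to \<open>S\<close>
  with the reduced homology of the overlap, one degree lower.\<close>

locale open_cover_pair =
  fixes X :: "'a topology" and S T :: "'a set"
  assumes openS: "openin X S" and openT: "openin X T" and cover: "S \<union> T = topspace X"
    and contrT: "contractible_space (subtopology X T)" and meet: "S \<inter> T \<noteq> {}"
begin

abbreviation "exc p \<equiv> hom_induced p (subtopology X T) (S \<inter> T) X S id"
abbreviation "bdT p \<equiv> hom_boundary p (subtopology X T) (S \<inter> T)"

lemma subsets: "S \<subseteq> topspace X" "T \<subseteq> topspace X"
  using openS openT openin_subset by auto

lemma exc_iso: "exc p \<in> iso (relative_homology_group p (subtopology X T) (S \<inter> T)) (relative_homology_group p X S)"
  by (rule excision_of_open_cover[OF openS openT cover])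

lemma sub_sub: "subtopology (subtopology X T) (S \<inter> T) = subtopology X (S \<inter> T)"
  by (simp add: subtopology_subtopology Int_absorb1)

lemma bdT_iso: "bdT p \<in> iso (relative_homology_group p (subtopology X T) (S \<inter> T))
    (reduced_homology_group (p - 1) (subtopology X (S \<inter> T)))"
  using iso_relative_homology_of_contractible[OF contrT, of "S \<inter> T" p] meet subsets
  by (simp add: sub_sub Int_absorb1 Int_absorb2 inf.coboundedI1)

lemma excE:
  assumes "c \<in> carrier (relative_homology_group p X S)"
  obtains d where "d \<in> carrier (relative_homology_group p (subtopology X T) (S \<inter> T))" "c = exc p d"
  using assms exc_iso[of p] by (auto simp: iso_def bij_betw_def)

lemma boundary_exc:
  "hom_boundary p X S (exc p d) =
     hom_induced (p - 1) (subtopology X (S \<inter> T)) {} (subtopology X S) {} id (bdT p d)"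
  using naturality_hom_induced[of "subtopology X T" X id "S \<inter> T" S p]
  by (simp add: sub_sub fun_eq_iff continuous_map_from_subtopology)

lemma relative_iso_reduced:
  "relative_homology_group p X S \<cong> reduced_homology_group (p - 1) (subtopology X (S \<inter> T))"
proof -
  have "relative_homology_group p (subtopology X T) (S \<inter> T) \<cong> relative_homology_group p X S"
    using exc_iso is_isoI by blast
  then show ?thesis
    using bdT_iso is_isoI group.iso_sym group_relative_homology_group iso_trans by metis
qed

text \<open>A class of \<open>S\<close> that dies in \<open>X\<close> is the boundary of a relative
  class. By excision this class lives on \<open>T\<close> relative to the overlap, so its boundary
  comes from the overlap.\<close>

lemma kernel_inclusion:
  assumes "c \<in> carrier (homology_group p (subtopology X S))"
    and "hom_induced p (subtopology X S) {} X {} id c = \<one>\<^bsub>homology_group p X\<^esub>"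
  obtains d where "d \<in> carrier (homology_group p (subtopology X (S \<inter> T)))"
    "c = hom_induced p (subtopology X (S \<inter> T)) {} (subtopology X S) {} id d"
proof -
  have "c \<in> kernel (homology_group p (subtopology X S)) (homology_group p X)
        (hom_induced p (subtopology X S) {} X {} id)"
    using assms by (simp add: kernel_def)
  then obtain e where e: "e \<in> carrier (relative_homology_group (p + 1) X S)" "c = hom_boundary (p + 1) X S e"
    using homology_exactness_axiom_2[of "p + 1" X S] by auto
  then obtain d where d: "d \<in> carrier (relative_homology_group (p + 1) (subtopology X T) (S \<inter> T))" "e = exc (p + 1) d"
    using excE by blast
  have "c = hom_induced p (subtopology X (S \<inter> T)) {} (subtopology X S) {} id (bdT (p + 1) d)"
    using boundary_exc[of "p + 1" d] d e by simp
  moreover have "bdT (p + 1) d \<in> carrier (homology_group p (subtopology X (S \<inter> T)))"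
    using hom_boundary_carrier[of "p + 1" "subtopology X T" "S \<inter> T" d] by (simp add: sub_sub)
  ultimately show ?thesis using that by blast
qed

text \<open>The obstruction to lifting a relative class is its boundary, which lies in the reduced
  zeroth homology of \<open>S\<close>; this group is trivial.\<close>

lemma surj_relative:
  assumes "path_connected_space (subtopology X S)"
  shows "hom_induced 1 X {} X S id ` carrier (homology_group 1 X) = carrier (relative_homology_group 1 X S)"
proof -
  have ne: "S \<noteq> {}" using meet by auto
  have "trivial_group (reduced_homology_group 0 (subtopology X S))"
    using assms ne subsets by (intro trivial_reduced_homology_group_path_connected) auto
  then have "hom_boundary 1 X S c = \<one>\<^bsub>reduced_homology_group 0 (subtopology X S)\<^esub>"
    if "c \<in> carrier (relative_homology_group 1 X S)" for c
    using hom_boundary_reduced_hom[of 1 X S] that by (auto simp: trivial_group_def hom_def)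
  then have "carrier (relative_homology_group 1 X S) \<subseteq>
      kernel (relative_homology_group 1 X S) (homology_group 0 (subtopology X S)) (hom_boundary 1 X S)"
    by (auto simp: kernel_def one_reduced_homology_group)
  then show ?thesis
    using homology_exactness_axiom_1[of 1 X S] by (auto simp: kernel_def)
qed

lemma kernel_inclusion_first:
  assumes H1: "trivial_group (homology_group 1 (subtopology X (S \<inter> T)))"
    and c: "c \<in> carrier (homology_group 1 (subtopology X S))"
      "hom_induced 1 (subtopology X S) {} X {} id c = \<one>\<^bsub>homology_group 1 X\<^esub>"
  shows "c = \<one>\<^bsub>homology_group 1 (subtopology X S)\<^esub>"
proof -
  obtain d where d: "d \<in> carrier (homology_group 1 (subtopology X (S \<inter> T)))"
    "c = hom_induced 1 (subtopology X (S \<inter> T)) {} (subtopology X S) {} id d"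
    using kernel_inclusion[OF c] by metis
  have "d = \<one>\<^bsub>homology_group 1 (subtopology X (S \<inter> T))\<^esub>"
    using d(1) H1 by (auto simp: trivial_group_def)
  then show ?thesis
    using d(2) hom_one[OF hom_induced_empty_hom group_relative_homology_group group_relative_homology_group] by metis
qed

text \<open>Triviality of the first homology of the overlap makes the sequence exact on the left,
  path-connectedness of \<open>S\<close> on the right. As the quotient is free, the ranks
  add.\<close>

lemma homology_group_1_free:
  assumes H1: "trivial_group (homology_group 1 (subtopology X (S \<inter> T)))"
    and pc: "path_connected_space (subtopology X S)"
    and a: "homology_group 1 (subtopology X S) \<cong> free_Abelian_group {..<a::nat}"
    and b: "reduced_homology_group 0 (subtopology X (S \<inter> T)) \<cong> free_Abelian_group {..<b::nat}"
  shows "homology_group 1 X \<cong> free_Abelian_group {..<a + b}"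
proof (rule extension_by_free_Abelian_group)
  let ?f = "hom_induced 1 (subtopology X S) {} X {} id"
  let ?g = "hom_induced 1 X {} X S id"
  show "?f \<in> hom (homology_group 1 (subtopology X S)) (homology_group 1 X)"
    by (rule hom_induced_empty_hom)
  interpret f: group_hom "homology_group 1 (subtopology X S)" "homology_group 1 X" ?f
    by (simp add: group_hom_def group_hom_axioms_def hom_induced_empty_hom)
  show "inj_on ?f (carrier (homology_group 1 (subtopology X S)))"
    using kernel_inclusion_first[OF H1] by (simp add: f.inj_on_one_iff)
  show "?g \<in> hom (homology_group 1 X) (relative_homology_group 1 X S)"
    by (rule hom_induced_hom)
  show "?g ` carrier (homology_group 1 X) = carrier (relative_homology_group 1 X S)"
    by (rule surj_relative[OF pc])
  show "?f ` carrier (homology_group 1 (subtopology X S)) = kernel (homology_group 1 X) (relative_homology_group 1 X S) ?g"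
    using homology_exactness_axiom_3[of 1 X S] by simp
  show "relative_homology_group 1 X S \<cong> free_Abelian_group {..<b}"
    using relative_iso_reduced[of 1] b iso_trans by simp blast
qed (use a in auto)

context
  fixes \<phi> :: "'a \<Rightarrow> 'a"
  assumes cont: "continuous_map X X \<phi>" and \<phi>S: "\<phi> \<in> S \<rightarrow> S" and \<phi>T: "\<phi> \<in> T \<rightarrow> T"
begin

lemma cont_sub:
  "continuous_map (subtopology X S) (subtopology X S) \<phi>"
  "continuous_map (subtopology X T) (subtopology X T) \<phi>"
  using cont \<phi>S \<phi>T subsets
  by (auto simp: continuous_map_in_subtopology continuous_map_from_subtopology)

lemma exc_equivariant:
  "hom_induced p X S X S \<phi> (exc p d) =
     exc p (hom_induced p (subtopology X T) (S \<inter> T) (subtopology X T) (S \<inter> T) \<phi> d)"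
proof -
  have "\<phi> \<in> S \<inter> T \<rightarrow> S \<inter> T" using \<phi>S \<phi>T by auto
  then show ?thesis
    using cont cont_sub \<phi>S
    by (simp add: hom_induced_compose' continuous_map_from_subtopology)
qed

lemma bdT_equivariant:
  "bdT p (hom_induced p (subtopology X T) (S \<inter> T) (subtopology X T) (S \<inter> T) \<phi> d) =
     hom_induced (p - 1) (subtopology X (S \<inter> T)) {} (subtopology X (S \<inter> T)) {} \<phi> (bdT p d)"
proof -
  have "\<phi> \<in> S \<inter> T \<rightarrow> S \<inter> T" using \<phi>S \<phi>T by auto
  then show ?thesis
    using naturality_hom_induced[OF cont_sub(2), of "S \<inter> T" "S \<inter> T" p]
    by (simp add: sub_sub fun_eq_iff)
qed

text \<open>The exact sequence is equivariant. A fixed class of \<open>X\<close> has a fixed image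
  in the reduced homology of the overlap, so the image is trivial and the class comes from
  \<open>S\<close>. It comes from a unique class there, which must therefore be fixed as
  well.\<close>

lemma no_fixed_homology_class:
  assumes H1: "trivial_group (homology_group 1 (subtopology X (S \<inter> T)))"
    and nS: "\<And>c. \<lbrakk>c \<in> carrier (homology_group 1 (subtopology X S));
        hom_induced 1 (subtopology X S) {} (subtopology X S) {} \<phi> c = c\<rbrakk>
        \<Longrightarrow> c = \<one>\<^bsub>homology_group 1 (subtopology X S)\<^esub>"
    and nC: "\<And>c. \<lbrakk>c \<in> carrier (reduced_homology_group 0 (subtopology X (S \<inter> T)));
        hom_induced 0 (subtopology X (S \<inter> T)) {} (subtopology X (S \<inter> T)) {} \<phi> c = c\<rbrakk>
        \<Longrightarrow> c = \<one>\<^bsub>reduced_homology_group 0 (subtopology X (S \<inter> T))\<^esub>"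
    and c: "c \<in> carrier (homology_group 1 X)" "hom_induced 1 X {} X {} \<phi> c = c"
  shows "c = \<one>\<^bsub>homology_group 1 X\<^esub>"
proof -
  let ?f = "hom_induced 1 (subtopology X S) {} X {} id"
  let ?g = "hom_induced 1 X {} X S id"
  let ?B = "relative_homology_group 1 (subtopology X T) (S \<inter> T)"
  let ?C = "reduced_homology_group 0 (subtopology X (S \<inter> T))"
  interpret f: group_hom "homology_group 1 (subtopology X S)" "homology_group 1 X" ?f
    by (simp add: group_hom_def group_hom_axioms_def hom_induced_empty_hom)
  interpret bd: group_hom ?B ?C "bdT 1"
    using bdT_iso[of 1] by (simp add: group_hom_def group_hom_axioms_def iso_def)
  interpret ex: group_hom ?B "relative_homology_group 1 X S" "exc 1"
    using exc_iso[of 1] by (simp add: group_hom_def group_hom_axioms_def iso_def)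
  have "?g c \<in> carrier (relative_homology_group 1 X S)"
    by (rule hom_induced_carrier)
  then obtain d where d: "d \<in> carrier ?B" "?g c = exc 1 d" using excE by blast
  let ?d = "hom_induced 1 (subtopology X T) (S \<inter> T) (subtopology X T) (S \<inter> T) \<phi> d"
  have "exc 1 ?d = hom_induced 1 X S X S \<phi> (?g c)"
    using d exc_equivariant by simp
  also have "\<dots> = ?g (hom_induced 1 X {} X {} \<phi> c)"
    using cont \<phi>S by (simp add: hom_induced_compose')
  also have "\<dots> = exc 1 d" using c d by simp
  finally have "?d = d"
    using exc_iso[of 1] d(1) hom_induced_carrier[of 1 "subtopology X T" "S \<inter> T" "subtopology X T" "S \<inter> T" \<phi> d]
    by (auto simp: iso_def bij_betw_def inj_on_def)
  then have "bdT 1 d = \<one>\<^bsub>?C\<^esub>"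
    using bdT_equivariant[of 1 d] nC[of "bdT 1 d"] d(1) bd.hom_closed by simp
  then have "d = \<one>\<^bsub>?B\<^esub>"
    using bdT_iso[of 1] d(1) bd.inj_on_one_iff by (auto simp: iso_def bij_betw_def)
  then have "?g c = \<one>\<^bsub>relative_homology_group 1 X S\<^esub>" using d ex.hom_one by simp
  then have "c \<in> kernel (homology_group 1 X) (relative_homology_group 1 X S) ?g"
    using c by (simp add: kernel_def)
  then obtain e where e: "e \<in> carrier (homology_group 1 (subtopology X S))" "c = ?f e"
    using homology_exactness_axiom_3[of 1 X S] by auto
  let ?e = "hom_induced 1 (subtopology X S) {} (subtopology X S) {} \<phi> e"
  have "?f ?e = hom_induced 1 X {} X {} \<phi> (?f e)"
    using cont cont_sub by (simp add: hom_induced_compose' continuous_map_from_subtopology)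
  then have "?f ?e = ?f e" using c e by simp
  moreover have "inj_on ?f (carrier (homology_group 1 (subtopology X S)))"
    using kernel_inclusion_first[OF H1] by (simp add: f.inj_on_one_iff)
  ultimately have "?e = e"
    using e(1) hom_induced_carrier[of 1 "subtopology X S" "{}" "subtopology X S" "{}" \<phi> e]
    by (auto simp: inj_on_def)
  then have "e = \<one>\<^bsub>homology_group 1 (subtopology X S)\<^esub>" using nS e by blast
  then show ?thesis using e f.hom_one by simp
qed

text \<open>If the homology of the overlap is pointwise fixed, it dies in \<open>S\<close>, so that attaching \<open>T\<close> changes nothing.\<close>

lemma homology_group_1_unchanged:
  assumes pc: "path_connected_space (subtopology X (S \<inter> T))"
    and nS: "\<And>c. \<lbrakk>c \<in> carrier (homology_group 1 (subtopology X S));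
        hom_induced 1 (subtopology X S) {} (subtopology X S) {} \<phi> c = c\<rbrakk>
        \<Longrightarrow> c = \<one>\<^bsub>homology_group 1 (subtopology X S)\<^esub>"
    and fixd: "\<And>c. c \<in> carrier (homology_group 1 (subtopology X (S \<inter> T))) \<Longrightarrow>
        hom_induced 1 (subtopology X (S \<inter> T)) {} (subtopology X (S \<inter> T)) {} \<phi> c = c"
  shows "homology_group 1 (subtopology X S) \<cong> homology_group 1 X"
proof -
  let ?f = "hom_induced 1 (subtopology X S) {} X {} id"
  let ?g = "hom_induced 1 X {} X S id"
  interpret f: group_hom "homology_group 1 (subtopology X S)" "homology_group 1 X" ?f
    by (simp add: group_hom_def group_hom_axioms_def hom_induced_empty_hom)
  have cC: "continuous_map (subtopology X (S \<inter> T)) (subtopology X (S \<inter> T)) \<phi>"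
    using cont \<phi>S \<phi>T subsets by (auto simp: continuous_map_in_subtopology continuous_map_from_subtopology)
  have cI: "continuous_map (subtopology X (S \<inter> T)) (subtopology X S) id"
    by (auto simp: continuous_map_in_subtopology)
  have "c = \<one>\<^bsub>homology_group 1 (subtopology X S)\<^esub>"
    if c: "c \<in> carrier (homology_group 1 (subtopology X S))" "?f c = \<one>\<^bsub>homology_group 1 X\<^esub>" for c
  \<comment> \<open>A class of \<open>S\<close> dying in \<open>X\<close> comes from the overlap,
    where every class is fixed. So it is fixed by \<phi> itself, and \<open>nS\<close> kills
    it.\<close>
  proof (rule nS[OF c(1)])
    obtain d where d: "d \<in> carrier (homology_group 1 (subtopology X (S \<inter> T)))"
      "c = hom_induced 1 (subtopology X (S \<inter> T)) {} (subtopology X S) {} id d"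
      using kernel_inclusion[OF c] by metis
    have "hom_induced 1 (subtopology X S) {} (subtopology X S) {} \<phi> c =
       hom_induced 1 (subtopology X (S \<inter> T)) {} (subtopology X S) {} id
         (hom_induced 1 (subtopology X (S \<inter> T)) {} (subtopology X (S \<inter> T)) {} \<phi> d)"
      using d(2) cC cI cont_sub by (simp add: hom_induced_compose')
    then show "hom_induced 1 (subtopology X S) {} (subtopology X S) {} \<phi> c = c"
      using fixd d by simp
  qed
  then have inj: "inj_on ?f (carrier (homology_group 1 (subtopology X S)))"
    by (simp add: f.inj_on_one_iff)
  have "trivial_group (reduced_homology_group 0 (subtopology X (S \<inter> T)))"
    using pc meet subsets by (intro trivial_reduced_homology_group_path_connected) auto
  then have tr: "trivial_group (relative_homology_group 1 X S)"
    using relative_iso_reduced[of 1] isomorphic_group_triviality by fastforce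
  have "carrier (homology_group 1 X) \<subseteq> kernel (homology_group 1 X) (relative_homology_group 1 X S) ?g"
    using tr hom_induced_carrier[of 1 X "{}" X S id] by (auto simp: kernel_def trivial_group_def)
  then have "?f ` carrier (homology_group 1 (subtopology X S)) = carrier (homology_group 1 X)"
    using homology_exactness_axiom_3[of 1 X S] f.hom_closed by auto
  then have "?f \<in> iso (homology_group 1 (subtopology X S)) (homology_group 1 X)"
    using inj f.homh by (simp add: iso_def bij_betw_def)
  then show ?thesis by (rule is_isoI)
qed

end

end

section \<open>Homology of a disjoint union of contractible sheets\<close>

lemma (in group_hom) hom_finprod:
  assumes "comm_group G" "comm_group H" "finite A" "f \<in> A \<rightarrow> carrier G"
  shows "h (finprod G f A) = finprod H (\<lambda>x. h (f x)) A"
  using assms(3,4)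
proof (induction A rule: finite_induct)
  case empty
  interpret G: comm_group G by fact
  interpret H: comm_group H by fact
  show ?case by simp
next
  case (insert x A)
  interpret G: comm_group G by fact
  interpret H: comm_group H by fact
  have "f \<in> A \<rightarrow> carrier G" "f x \<in> carrier G" using insert by auto
  moreover have "(\<lambda>x. h (f x)) \<in> A \<rightarrow> carrier H" using calculation hom_closed by blast
  ultimately show ?case using insert by simp
qed

locale sheets =
  fixes C :: "'a topology" and L :: "nat \<Rightarrow> 'a set" and m :: nat
  assumes m: "m \<ge> 1"
    and openL: "\<And>j. j < m \<Longrightarrow> openin C (L j)"
    and neL: "\<And>j. j < m \<Longrightarrow> L j \<noteq> {}"
    and disjL: "\<And>i j. \<lbrakk>i < m; j < m; i \<noteq> j\<rbrakk> \<Longrightarrow> L i \<inter> L j = {}"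
    and coverL: "(\<Union>j<m. L j) = topspace C"
    and contrL: "\<And>j. j < m \<Longrightarrow> contractible_space (subtopology C (L j))"
begin

lemma subset: "j < m \<Longrightarrow> L j \<subseteq> topspace C"
  using openL openin_subset by blast

lemma inj: "inj_on L {..<m}"
  by (rule inj_onI) (metis disjL inf.idem lessThan_iff neL)

text \<open>Subfamilies are allowed because the reduced homology is computed by removing one
  sheet.\<close>

lemma additivity:
  assumes "I \<subseteq> {..<m}" "Y = subtopology C (\<Union>j\<in>I. L j)"
  shows "(\<lambda>x. gfinprod (homology_group p Y) (\<lambda>v. hom_induced p (subtopology C v) {} Y {} id (x v)) (L ` I))
     \<in> iso (sum_group (L ` I) (\<lambda>S. homology_group p (subtopology C S))) (homology_group p Y)"
proof -
  have sub: "subtopology Y v = subtopology C v" if "v \<in> L ` I" for v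
  proof -
    have "(\<Union>j\<in>I. L j) \<inter> v = v" using that by auto
    then show ?thesis using assms(2) by (simp add: subtopology_subtopology)
  qed
  have "(\<lambda>x. gfinprod (homology_group p Y) (\<lambda>v. hom_induced p (subtopology Y v) {} Y {} id (x v)) (L ` I))
     \<in> iso (sum_group (L ` I) (\<lambda>S. homology_group p (subtopology Y S))) (homology_group p Y)"
  proof (rule homology_additivity_axiom)
    show "pairwise disjnt (L ` I)"
      unfolding pairwise_def disjnt_def
    proof (intro ballI impI)
      fix S T assume "S \<in> L ` I" "T \<in> L ` I" "S \<noteq> T"
      then obtain i j where "i \<in> I" "j \<in> I" "S = L i" "T = L j" "i \<noteq> j" by auto
      then show "S \<inter> T = {}" using assms(1) disjL[of i j] by auto
    qed
    show "\<Union> (L ` I) = topspace Y" using assms subset by auto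
    show "openin Y v" if "v \<in> L ` I" for v
      using that assms openL by (auto simp: openin_subtopology_alt)
  qed
  moreover have "sum_group (L ` I) (\<lambda>S. homology_group p (subtopology Y S)) = sum_group (L ` I) (\<lambda>S. homology_group p (subtopology C S))"
    unfolding sum_group_def product_group_def using sub by (simp cong: restrict_cong PiE_cong conj_cong)
  moreover have "(\<lambda>x. gfinprod (homology_group p Y) (\<lambda>v. hom_induced p (subtopology Y v) {} Y {} id (x v)) (L ` I)) =
      (\<lambda>x. gfinprod (homology_group p Y) (\<lambda>v. hom_induced p (subtopology C v) {} Y {} id (x v)) (L ` I))"
  proof
    fix x
    interpret comm_group "homology_group p Y" by simp
    show "gfinprod (homology_group p Y) (\<lambda>v. hom_induced p (subtopology Y v) {} Y {} id (x v)) (L ` I) =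
      gfinprod (homology_group p Y) (\<lambda>v. hom_induced p (subtopology C v) {} Y {} id (x v)) (L ` I)"
      by (rule gfinprod_cong) (auto simp: sub hom_induced_carrier)
  qed
  ultimately show ?thesis by simp
qed

lemma zeroth_homology:
  assumes "I \<subseteq> {..<m}"
  shows "homology_group 0 (subtopology C (\<Union>j\<in>I. L j)) \<cong> free_Abelian_group (L ` I)"
proof -
  have "sum_group (L ` I) (\<lambda>S. homology_group 0 (subtopology C S)) \<cong> sum_group (L ` I) (\<lambda>S. integer_group)"
  proof (rule iso_sum_groupI)
    fix i assume "i \<in> L ` I"
    then obtain j where j: "j < m" "i = L j" using assms by auto
    then show "homology_group 0 (subtopology C i) \<cong> integer_group"
      using neL[of j] subset[of j] contrL[of j] contractible_imp_path_connected_space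
      by (intro isomorphic_integer_zeroth_homology_group) (auto simp: Int_absorb1)
  qed auto
  moreover have "sum_group (L ` I) (\<lambda>S. homology_group 0 (subtopology C S)) \<cong> homology_group 0 (subtopology C (\<Union>j\<in>I. L j))"
    using additivity[OF assms HOL.refl] is_isoI by blast
  moreover have "group (sum_group (L ` I) (\<lambda>S. homology_group 0 (subtopology C S)))" by simp
  ultimately show ?thesis
    using isomorphic_sum_integer_group iso_trans group.iso_sym by metis
qed

lemma first_homology: "trivial_group (homology_group 1 C)"
proof -
  have "trivial_group (sum_group (L ` {..<m}) (\<lambda>S. homology_group 1 (subtopology C S)))"
  proof -
    have "trivial_group (homology_group 1 (subtopology C S))" if S: "S \<in> L ` {..<m}" for S
      using S contrL trivial_reduced_homology_group_contractible_space[of "subtopology C S" 1]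
      by (auto simp: un_reduced_homology_group)
    then have "carrier (homology_group 1 (subtopology C S)) = {\<one>\<^bsub>homology_group 1 (subtopology C S)\<^esub>}" if "S \<in> L ` {..<m}" for S
      using that by (auto simp: trivial_group_def)
    then have "carrier (sum_group (L ` {..<m}) (\<lambda>S. homology_group 1 (subtopology C S)))
        \<subseteq> {\<one>\<^bsub>sum_group (L ` {..<m}) (\<lambda>S. homology_group 1 (subtopology C S))\<^esub>}"
      by (auto simp: carrier_sum_group PiE_iff extensional_def fun_eq_iff)
    then show ?thesis
      by (metis group_relative_homology_group group.is_monoid monoid.one_closed subset_singletonD sum_group trivial_group_def empty_iff)
  qed
  moreover have "sum_group (L ` {..<m}) (\<lambda>S. homology_group 1 (subtopology C S)) \<cong> homology_group 1 C"
    using additivity[of "{..<m}" C 1] is_isoI coverL by (simp add: subtopology_superset)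
  ultimately show ?thesis
    using isomorphic_group_triviality by (metis group_relative_homology_group sum_group)
qed

text \<open>Reduced homology equals homology relative to the contractible sheet \<open>L 0\<close>.
  Excising that sheet leaves the absolute homology of the other \<open>m - 1\<close> sheets.\<close>

lemma reduced_homology: "reduced_homology_group 0 C \<cong> free_Abelian_group {..<m - 1}"
proof -
  have m0: "0 < m" using m by simp
  let ?T = "\<Union>j\<in>{1..<m}. L j"
  have T: "openin C ?T" using openL by auto
  have "L 0 \<union> ?T = (\<Union>j<m. L j)"
  proof -
    have "{..<m} = insert 0 {1..<m}" using m0 by auto
    then show ?thesis by simp
  qed
  then have un: "L 0 \<union> ?T = topspace C" using coverL by simp
  have "L 0 \<inter> ?T = {}" using disjL m0 by fastforce
  then have "relative_homology_group 0 (subtopology C ?T) {} \<cong> relative_homology_group 0 C (L 0)"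
    using excision_of_open_cover[OF openL[OF m0] T un, of 0] is_isoI by metis
  moreover have "reduced_homology_group 0 C \<cong> relative_homology_group 0 C (L 0)"
    using neL[OF m0] subset[OF m0] by (intro isomorphic_reduced_homology_by_contractible contrL m0) auto
  moreover have "homology_group 0 (subtopology C ?T) \<cong> free_Abelian_group (L ` {1..<m})"
    by (rule zeroth_homology) auto
  moreover have "free_Abelian_group (L ` {1..<m}) \<cong> free_Abelian_group {..<m - 1}"
  proof -
    have "card (L ` {1..<m}) = m - 1" using inj by (subst card_image) (auto intro: inj_on_subset)
    then show ?thesis by (simp add: isomorphic_free_Abelian_groups eqpoll_iff_card)
  qed
  ultimately show ?thesis
    by (meson group.iso_sym group_relative_homology_group iso_trans)
qed

text \<open>A fixed class has the same degree on every sheet, because \<phi> carries each sheet to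
  the next. In a reduced class the \<open>m\<close> equal degrees add up to 0, and the integers are
  torsion-free, so each degree vanishes.\<close>

lemma no_fixed_reduced:
  assumes cont: "continuous_map C C \<phi>" and shift: "\<And>j. j < m \<Longrightarrow> \<phi> \<in> L j \<rightarrow> L (Suc j mod m)"
    and c: "c \<in> carrier (reduced_homology_group 0 C)" "hom_induced 0 C {} C {} \<phi> c = c"
  shows "c = \<one>\<^bsub>reduced_homology_group 0 C\<^esub>"
proof -
  let ?H = "homology_group 0 C" and ?s = "\<lambda>j. Suc j mod m" and ?U = "L ` {..<m}"
  let ?P = "discrete_topology {()}"
  let ?i = "\<lambda>j. hom_induced 0 (subtopology C (L j)) {} C {} id"
  let ?e = "\<lambda>X. hom_induced 0 X {} ?P {} (\<lambda>x. ())"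
  let ?H' = "homology_group 0 ?P"
  let ?f = "\<lambda>j. hom_induced 0 (subtopology C (L j)) {} (subtopology C (L (?s j))) {} \<phi>"
  have m0: "0 < m" using m by simp
  have s: "?s j < m" for j using m0 by simp
  interpret H: comm_group ?H by simp
  interpret H': comm_group ?H' by simp
  interpret \<phi>: group_hom ?H ?H "hom_induced 0 C {} C {} \<phi>"
    by (simp add: group_hom_def group_hom_axioms_def hom_induced_empty_hom)
  interpret e: group_hom ?H ?H' "?e C"
    by (simp add: group_hom_def group_hom_axioms_def hom_induced_empty_hom)
  have "bij_betw ?s {..<m} {..<m}"
  proof -
    have "inj_on ?s {..<m}"
    proof (rule inj_onI)
      fix x y assume "x \<in> {..<m}" "y \<in> {..<m}" "?s x = ?s y"
      then show "x = y" by (auto simp: mod_Suc split: if_splits)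
    qed
    then show ?thesis
      by (metis (no_types, lifting) bij_betw_def card_image endo_inj_surj finite_lessThan image_subset_iff lessThan_iff s)
  qed
  then have binj: "inj_on ?s {..<m}" and bim: "?s ` {..<m} = {..<m}" by (auto simp: bij_betw_def)
  have cs: "continuous_map (subtopology C (L j)) (subtopology C (L (?s j))) \<phi>" if "j < m" for j
    using cont shift[OF that] by (auto simp: continuous_map_in_subtopology continuous_map_from_subtopology)
  let ?h = "\<lambda>x. gfinprod ?H (\<lambda>v. hom_induced 0 (subtopology C v) {} C {} id (x v)) ?U"
  let ?S = "sum_group ?U (\<lambda>S. homology_group 0 (subtopology C S))"
  have h: "?h \<in> iso ?S ?H"
    using additivity[of "{..<m}" C 0] coverL by (simp add: subtopology_superset)
  have hx: "?h x = finprod ?H (\<lambda>j. ?i j (x (L j))) {..<m}" for x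
  proof -
    have "?h x = finprod ?H (\<lambda>v. hom_induced 0 (subtopology C v) {} C {} id (x v)) ?U"
      by (rule H.gfinprod_eq_finprod) (auto simp: hom_induced_carrier)
    also have "\<dots> = finprod ?H (\<lambda>j. ?i j (x (L j))) {..<m}"
      using inj by (subst H.finprod_reindex) (auto simp: hom_induced_carrier)
    finally show ?thesis .
  qed
  have cH: "c \<in> carrier ?H" "?e C c = \<one>\<^bsub>?H'\<^esub>"
    using c(1) by (auto simp: carrier_reduced_homology_group kernel_def)
  obtain a where a: "a \<in> carrier ?S" "?h a = c"
  proof -
    have "c \<in> ?h ` carrier ?S" using h cH by (simp add: iso_def bij_betw_def)
    then show ?thesis using that by blast
  qed
  have aL: "a (L j) \<in> carrier (homology_group 0 (subtopology C (L j)))" if "j < m" for j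
    using a(1) that by (auto simp: carrier_sum_group)
  \<comment> \<open>\<open>b\<close> collects the components of the image of \<open>c\<close>: the
    sheet \<open>?s j\<close> receives the transported component of the sheet
    \<open>j\<close>.\<close>
  define g where "g k = ?f (inv_into {..<m} ?s k) (a (L (inv_into {..<m} ?s k)))" for k
  define b where "b = (\<lambda>V\<in>?U. g (inv_into {..<m} L V))"
  have bs: "b (L (?s j)) = ?f j (a (L j))" if j: "j < m" for j
  proof -
    have "inv_into {..<m} L (L (?s j)) = ?s j" using inj s by simp
    moreover have "inv_into {..<m} ?s (?s j) = j" using binj j inv_into_f_f[of ?s "{..<m}" j] by simp
    ultimately show ?thesis using s by (simp add: b_def g_def)
  qed
  have "b (L j) \<in> carrier (homology_group 0 (subtopology C (L j)))" if j: "j < m" for j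
  proof -
    have "j \<in> ?s ` {..<m}" using bim j by simp
    then obtain k where "k < m" "j = ?s k" by blast
    then show ?thesis using bs[of k] by (simp add: hom_induced_carrier)
  qed
  then have b: "b \<in> carrier ?S"
    by (auto simp: carrier_sum_group b_def)
  have "?h b = finprod ?H (\<lambda>j. ?i j (b (L j))) (?s ` {..<m})" by (simp only: hx bim)
  also have "\<dots> = finprod ?H (\<lambda>j. ?i (?s j) (b (L (?s j)))) {..<m}"
    using binj by (subst H.finprod_reindex) (auto simp: hom_induced_carrier)
  also have "\<dots> = finprod ?H (\<lambda>j. hom_induced 0 C {} C {} \<phi> (?i j (a (L j)))) {..<m}"
  proof (rule H.finprod_cong')
    fix j assume "j \<in> {..<m}"
    then show "?i (?s j) (b (L (?s j))) = hom_induced 0 C {} C {} \<phi> (?i j (a (L j)))"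
      using bs[of j] cs[of j] cont by (simp add: hom_induced_compose' continuous_map_from_subtopology)
  qed (auto simp: hom_induced_carrier)
  also have "\<dots> = hom_induced 0 C {} C {} \<phi> (finprod ?H (\<lambda>j. ?i j (a (L j))) {..<m})"
    by (subst \<phi>.hom_finprod) (auto simp: hom_induced_carrier)
  also have "\<dots> = ?h a" using hx a c by simp
  finally have "b = a"
    using h a(1) b by (auto simp: iso_def bij_betw_def inj_on_def)
  then have step: "a (L (?s j)) = ?f j (a (L j))" if "j < m" for j using bs that by simp
  \<comment> \<open>The degree of a component, as its image in the homology of a point.\<close>
  let ?q = "\<lambda>j. ?e (subtopology C (L j)) (a (L j))"
  have const: "?q j = ?q 0" if "j < m" for j
    using that
  proof (induction j)
    case (Suc j)
    then have "?s j = Suc j" "j < m" by auto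
    then have "?q (Suc j) = ?e (subtopology C (L (?s j))) (?f j (a (L j)))" using step[of j] by simp
    also have "\<dots> = ?q j" using cs[of j] \<open>j < m\<close>
      by (simp add: hom_induced_compose' o_def)
    finally show ?case using Suc by simp
  qed simp
  have q0: "?q 0 \<in> carrier ?H'" by (rule hom_induced_carrier)
  have "\<one>\<^bsub>?H'\<^esub> = ?e C (finprod ?H (\<lambda>j. ?i j (a (L j))) {..<m})" using hx a cH by simp
  also have "\<dots> = finprod ?H' (\<lambda>j. ?e C (?i j (a (L j)))) {..<m}"
    by (subst e.hom_finprod) (auto simp: hom_induced_carrier)
  also have "\<dots> = finprod ?H' (\<lambda>j. ?q 0) {..<m}"
  proof (rule H'.finprod_cong')
    fix j assume "j \<in> {..<m}"
    then show "?e C (?i j (a (L j))) = ?q 0"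
      using const[of j] by (simp add: hom_induced_compose' continuous_map_from_subtopology o_def)
  qed (use q0 in auto)
  also have "\<dots> = ?q 0 [^]\<^bsub>?H'\<^esub> m" using q0 by (simp add: H'.finprod_const)
  finally have pow: "?q 0 [^]\<^bsub>?H'\<^esub> m = \<one>\<^bsub>?H'\<^esub>" by simp
  have q1: "?q 0 = \<one>\<^bsub>?H'\<^esub>"
  proof -
    have "?H' \<cong> integer_group" by (rule homology_coefficients[of _ "()"]) simp
    then obtain k where k: "k \<in> iso ?H' integer_group" by (auto simp: is_iso_def)
    interpret k: group_hom ?H' integer_group k
      using k by (simp add: group_hom_def group_hom_axioms_def iso_def)
    have "int m * k (?q 0) = 0" using pow q0 k.hom_nat_pow[OF q0, of m] k.hom_one by simp
    then have "k (?q 0) = 0" using m0 by simp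
    then show ?thesis using k q0 k.inj_on_one_iff by (auto simp: iso_def bij_betw_def)
  qed
  have a1: "a (L j) = \<one>\<^bsub>homology_group 0 (subtopology C (L j))\<^esub>" if j: "j < m" for j
  proof -
    have "a (L j) \<in> carrier (reduced_homology_group 0 (subtopology C (L j)))"
      using aL[OF j] const[OF j] q1 by (simp add: carrier_reduced_homology_group kernel_def)
    then show ?thesis
      using trivial_reduced_homology_group_contractible_space[OF contrL[OF j], of 0]
      by (auto simp: trivial_group_def one_reduced_homology_group)
  qed
  have i1: "?i j (a (L j)) = \<one>\<^bsub>?H\<^esub>" if "j < m" for j
    using a1[OF that] hom_one[OF hom_induced_empty_hom group_relative_homology_group group_relative_homology_group] by metis
  have "finprod ?H (\<lambda>j. ?i j (a (L j))) {..<m} = \<one>\<^bsub>?H\<^esub>"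
    by (rule H.finprod_one_eqI) (simp add: i1)
  then have "c = \<one>\<^bsub>?H\<^esub>" using a(2) hx[of a] by simp
  then show ?thesis by (simp add: one_reduced_homology_group)
qed

end

section \<open>The affine curve\<close>

lemma trivial_groups_isomorphic:
  assumes "trivial_group H" "trivial_group G" shows "G \<cong> H"
proof -
  interpret G: group G using assms(2) by (simp add: trivial_group_def)
  interpret H: group H using assms(1) by (simp add: trivial_group_def)
  have "(\<lambda>_. \<one>\<^bsub>H\<^esub>) \<in> iso G H"
    using assms by (intro isoI homI) (auto simp: trivial_group_def bij_betw_def)
  then show ?thesis by (rule is_isoI)
qed

text \<open>That the degree is -1 modulo \<open>m\<close> leaves a single point over infinity. The
  bound on \<open>e\<close> provides enough roots for the zero counts on eigencomponents.\<close>

locale cyclic_curve =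
  fixes R :: "complex set" and m e :: nat
  assumes finR: "finite R" and m2: "m \<ge> 2" and e3: "e \<ge> 3" and cardR: "card R + 1 = m * e"
begin

definition Q :: "complex \<Rightarrow> complex" where "Q z = (\<Prod>a\<in>R. z - a)"

definition over :: "complex set \<Rightarrow> (complex \<times> complex) set" where
  "over K = {(z, w). z \<in> K \<and> w ^ m = Q z}"

definition \<zeta> :: complex where "\<zeta> = cis (2 * pi / m)"

definition rot :: "complex \<times> complex \<Rightarrow> complex \<times> complex" where
  "rot p = (fst p, \<zeta> * snd p)"

lemma m_pos: "m > 0" using m2 by simp

lemma zeta_pow: "\<zeta> ^ j = cis (2 * pi * j / m)"
  by (simp add: \<zeta>_def Complex.DeMoivre mult_ac)

lemma zeta_m [simp]: "\<zeta> ^ m = 1"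
  using m_pos by (simp add: zeta_pow)

lemma zeta_nz [simp]: "\<zeta> \<noteq> 0" by (simp add: \<zeta>_def)

lemma norm_zeta [simp]: "norm \<zeta> = 1" by (simp add: \<zeta>_def)

lemma bij_zeta: "bij_betw (\<lambda>j. \<zeta> ^ j) {..<m} {u. u ^ m = 1}"
  using Complex.bij_betw_roots_unity[OF m_pos] by (simp add: zeta_pow)

lemma zeta_inj: "\<lbrakk>i < m; j < m; \<zeta> ^ i = \<zeta> ^ j\<rbrakk> \<Longrightarrow> i = j"
  using bij_zeta by (auto simp: bij_betw_def inj_on_def)

lemma zeta_exists:
  assumes "u ^ m = 1" obtains j where "j < m" "u = \<zeta> ^ j"
  using assms bij_zeta by (auto simp: bij_betw_def image_iff set_eq_iff)

lemma zeta_neq_1: "\<zeta> \<noteq> 1"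
  using zeta_inj[of 1 0] m2 by auto

lemma zeta_mod: "\<zeta> ^ (j mod m) = \<zeta> ^ j"
proof -
  have "\<zeta> ^ j = \<zeta> ^ (m * (j div m) + j mod m)" by simp
  also have "\<dots> = \<zeta> ^ (j mod m)" by (simp only: power_add power_mult zeta_m) simp
  finally show ?thesis by simp
qed

lemma Q_holo [holomorphic_intros]: "f holomorphic_on S \<Longrightarrow> (\<lambda>z. Q (f z)) holomorphic_on S"
  unfolding Q_def by (intro holomorphic_intros)

lemma Q_cont [continuous_intros]: "continuous_on S f \<Longrightarrow> continuous_on S (\<lambda>z. Q (f z))"
  unfolding Q_def by (intro continuous_intros)

lemma Q_eq_0_iff: "Q z = 0 \<longleftrightarrow> z \<in> R"
  using finR by (simp add: Q_def)

lemma mem_over [simp]: "p \<in> over K \<longleftrightarrow> fst p \<in> K \<and> snd p ^ m = Q (fst p)"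
  by (cases p) (auto simp: over_def)

lemma rot_fst [simp]: "fst (rot p) = fst p" and rot_snd [simp]: "snd (rot p) = \<zeta> * snd p"
  by (auto simp: rot_def)

lemma rot_over [simp]: "rot p \<in> over K \<longleftrightarrow> p \<in> over K"
  by (simp add: power_mult_distrib)

lemma rot_cont: "continuous_on S rot"
  unfolding rot_def by (intro continuous_intros)

lemma exp_div_pow: "exp (x / of_nat m) ^ m = exp x" for x :: complex
  using m_pos by (simp flip: exp_of_nat_mult)

lemma over_fiber_nonempty: "\<exists>w. w ^ m = Q z"
proof (cases "Q z = 0")
  case True then show ?thesis using m_pos by (intro exI[of _ 0]) simp
next
  case False
  then have "exp (Ln (Q z) / m) ^ m = Q z" by (simp add: exp_div_pow)
  then show ?thesis by blast
qed

lemma over_nonempty: "K \<noteq> {} \<Longrightarrow> over K \<noteq> {}"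
proof -
  assume "K \<noteq> {}"
  then obtain z where "z \<in> K" by blast
  moreover obtain w where "w ^ m = Q z" using over_fiber_nonempty by blast
  ultimately have "(z, w) \<in> over K" by simp
  then show ?thesis by blast
qed

lemma over_Int: "over (K \<inter> K') = over K \<inter> over K'" by auto
lemma over_Un: "over (K \<union> K') = over K \<union> over K'" by auto
lemma openin_over:
  assumes "open K" "K \<subseteq> K'" shows "openin (top_of_set (over K')) (over K)"
proof -
  have "over K = over K' \<inter> fst -` K" using assms by auto
  moreover have "open (fst -` K :: (complex \<times> complex) set)" using assms(1) by (simp add: open_vimage_fst)
  ultimately show ?thesis by (simp add: openin_open_Int)
qed

section \<open>The curve over a convex set containing at most one root\<close>

lemma Q_log:
  assumes "convex K" "open K" "R \<inter> K = {}"
  obtains h where "h holomorphic_on K" "\<And>z. z \<in> K \<Longrightarrow> Q z = exp (h z)"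
  by (rule contractible_imp_holomorphic_log[of Q K])
     (use assms in \<open>auto simp: Q_eq_0_iff convex_imp_contractible intro!: holomorphic_intros\<close>)

lemma Q_log_root:
  assumes "convex K" "open K" "R \<inter> K = {a}"
  obtains h where "h holomorphic_on K" "\<And>z. z \<in> K \<Longrightarrow> Q z = (z - a) * exp (h z)"
proof -
  define P where "P z = (\<Prod>b\<in>R - {a}. z - b)" for z
  have "P holomorphic_on K" unfolding P_def by (intro holomorphic_intros)
  moreover have "P z \<noteq> 0" if "z \<in> K" for z
    using that assms finR by (auto simp: P_def)
  ultimately obtain h where h: "h holomorphic_on K" "\<And>z. z \<in> K \<Longrightarrow> P z = exp (h z)"
    using contractible_imp_holomorphic_log[of P K] convex_imp_contractible[OF assms(1)] by metis
  have "a \<in> R" using assms by auto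
  then have "Q z = (z - a) * P z" for z
    using finR by (simp add: Q_def P_def prod.remove)
  then show ?thesis using h that by simp
qed

text \<open>This is \<open>w\<close> divided by an m-th root of \<open>exp (h z)\<close>. If
  \<open>Q = exp h\<close>, its values are m-th roots of unity and label the sheets. If
  \<open>Q z = (z - a) * exp (h z)\<close>, its m-th power is \<open>z - a\<close>, and it is a
  local coordinate at the ramification point.\<close>

definition coord :: "(complex \<Rightarrow> complex) \<Rightarrow> complex \<times> complex \<Rightarrow> complex" where
  "coord h p = snd p * exp (- h (fst p) / m)"

lemma coord_cont:
  assumes "h holomorphic_on K" shows "continuous_on (over K) (coord h)"
proof -
  have "continuous_on (over K) (\<lambda>p. h (fst p))"
    using holomorphic_on_imp_continuous_on[OF assms] by (rule continuous_on_compose2) (auto intro!: continuous_intros)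
  then show ?thesis unfolding coord_def using m_pos by (intro continuous_intros) auto
qed

lemma coord_pow: "coord h p ^ m = snd p ^ m * exp (- h (fst p))"
  unfolding coord_def power_mult_distrib exp_div_pow ..

lemma coord_rot [simp]: "coord h (rot p) = \<zeta> * coord h p"
  by (simp add: coord_def)

definition param :: "(complex \<Rightarrow> complex) \<Rightarrow> complex \<Rightarrow> complex \<Rightarrow> complex \<times> complex" where
  "param h a s = (a + s ^ m, s * exp (h (a + s ^ m) / m))"

text \<open>A total ramification point: \<open>s = w exp (- h / m)\<close> satisfies \<open>s\<^sup>m = z - a\<close> and is a coordinate on all of \<open>over K\<close>.\<close>

lemma coord_param:
  assumes h: "h holomorphic_on K" "\<And>z. z \<in> K \<Longrightarrow> Q z = (z - a) * exp (h z)"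
  shows "homeomorphism (over K) {s. a + s ^ m \<in> K} (coord h) (param h a)"
    "p \<in> over K \<Longrightarrow> a + coord h p ^ m = fst p"
proof -
  have fst: "a + coord h p ^ m = fst p" if "p \<in> over K" for p
    using that h(2)[of "fst p"] by (simp add: coord_pow exp_minus mult.assoc)
  then show "p \<in> over K \<Longrightarrow> a + coord h p ^ m = fst p" .
  have in_over: "param h a s \<in> over K" if "a + s ^ m \<in> K" for s
    using that h(2)[of "a + s ^ m"] by (simp add: param_def power_mult_distrib exp_div_pow)
  have pc: "param h a (coord h p) = p" if "p \<in> over K" for p
  proof -
    have "coord h p * exp (h (fst p) / m) = snd p"
      by (simp add: coord_def mult.assoc flip: exp_add)
    then show ?thesis using fst[OF that] by (simp add: param_def prod_eq_iff)
  qed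
  have cp: "coord h (param h a s) = s" for s
    by (simp add: coord_def param_def mult.assoc flip: exp_add)
  have "continuous_on {s. a + s ^ m \<in> K} (\<lambda>s. h (a + s ^ m))"
    using holomorphic_on_imp_continuous_on[OF h(1)] by (rule continuous_on_compose2) (auto intro!: continuous_intros)
  then have "continuous_on {s. a + s ^ m \<in> K} (param h a)"
    unfolding param_def using m_pos by (intro continuous_intros) auto
  then show "homeomorphism (over K) {s. a + s ^ m \<in> K} (coord h) (param h a)"
    unfolding homeomorphism_def using coord_cont[OF h(1)] fst in_over pc cp
    by (auto simp del: mem_over simp: image_iff intro!: bexI[where x="param h a _"] bexI[where x="coord h _"])
       (metis fst mem_over)+
qed

text \<open>While a point moves along the segment from 0 to \<open>s\<close>, the point
  \<open>a + t ^ m\<close> moves along the segment from \<open>a\<close> to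
  \<open>a + s ^ m\<close>.\<close>

lemma starlike_disc:
  assumes "convex K" "a \<in> K" shows "starlike {s::complex. a + s ^ m \<in> K}"
proof -
  have "closed_segment 0 s \<subseteq> {s. a + s ^ m \<in> K}" if s: "a + s ^ m \<in> K" for s :: complex
  proof
    fix t assume "t \<in> closed_segment 0 s"
    then obtain u where u: "0 \<le> u" "u \<le> 1" "t = u *\<^sub>R s" by (auto simp: in_segment)
    have "a + t ^ m = (1 - u ^ m) *\<^sub>R a + (u ^ m) *\<^sub>R (a + s ^ m)"
      by (simp add: u power_mult_distrib scaleR_conv_of_real algebra_simps)
    moreover have "u ^ m \<le> 1" "0 \<le> u ^ m" using u by (auto simp: power_le_one)
    ultimately have "a + t ^ m \<in> K"
      using convexD[OF assms(1) assms(2) s, of "1 - u ^ m" "u ^ m"] by simp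
    then show "t \<in> {s. a + s ^ m \<in> K}" by simp
  qed
  then show ?thesis unfolding starlike_def using assms m_pos by (intro bexI[of _ 0]) (auto simp: zero_power)
qed

lemma over_one_root:
  assumes "convex K" "open K" "R \<inter> K = {a}"
  shows "contractible (over K)" "path_connected (over K)"
proof -
  obtain h where h: "h holomorphic_on K" "\<And>z. z \<in> K \<Longrightarrow> Q z = (z - a) * exp (h z)"
    using Q_log_root[OF assms] by metis
  have "over K homeomorphic {s. a + s ^ m \<in> K}"
    using coord_param(1)[OF h] homeomorphic_def by blast
  moreover have st: "starlike {s. a + s ^ m \<in> K}" using starlike_disc assms by blast
  ultimately show "contractible (over K)" "path_connected (over K)"
    using homeomorphic_contractible_eq homeomorphic_path_connectedness starlike_imp_contractible starlike_imp_path_connected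
    by blast+
qed

definition sheet :: "(complex \<Rightarrow> complex) \<Rightarrow> complex set \<Rightarrow> nat \<Rightarrow> (complex \<times> complex) set" where
  "sheet h K j = {p \<in> over K. coord h p = \<zeta> ^ j}"

lemma sheets_over:
  assumes K: "convex K" "open K" "K \<noteq> {}" and h: "h holomorphic_on K" "\<And>z. z \<in> K \<Longrightarrow> Q z = exp (h z)"
  shows "sheets (top_of_set (over K)) (sheet h K) m"
proof
  show "1 \<le> m" using m2 by simp
  have one: "coord h p ^ m = 1" if "p \<in> over K" for p
    using that h(2)[of "fst p"] by (simp add: coord_pow flip: exp_add)
  show "sheet h K i \<inter> sheet h K j = {}" if "i < m" "j < m" "i \<noteq> j" for i j
    using that zeta_inj by (auto simp: sheet_def)
  show "(\<Union>j<m. sheet h K j) = topspace (top_of_set (over K))"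
    using zeta_exists[OF one] by (auto simp: sheet_def) (metis lessThan_iff mem_over fst_conv snd_conv)
  fix j assume j: "j < m"
  \<comment> \<open>The sheet is the graph of one branch of the m-th root of \<open>Q\<close> over
    \<open>K\<close>.\<close>
  define g where "g z = (z, \<zeta> ^ j * exp (h z / m))" for z
  have g: "sheet h K j = g ` K"
  proof
    show "sheet h K j \<subseteq> g ` K"
    proof
      fix p assume p: "p \<in> sheet h K j"
      then have "coord h p * exp (h (fst p) / m) = \<zeta> ^ j * exp (h (fst p) / m)" by (simp add: sheet_def)
      then have "snd p = \<zeta> ^ j * exp (h (fst p) / m)" by (simp add: coord_def mult.assoc flip: exp_add)
      then have "p = g (fst p)" by (simp add: g_def prod_eq_iff)
      then show "p \<in> g ` K" using p by (auto simp: sheet_def)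
    qed
    have "(\<zeta> ^ j) ^ m = 1" by (metis mult.commute power_mult power_one zeta_m)
    then show "g ` K \<subseteq> sheet h K j"
      using h(2) by (auto simp: g_def sheet_def power_mult_distrib exp_div_pow coord_def mult.assoc simp flip: exp_add)
  qed
  have gc: "continuous_on K g"
    unfolding g_def using holomorphic_on_imp_continuous_on[OF h(1)] m_pos by (intro continuous_intros) auto
  have "homeomorphism K (sheet h K j) g fst"
    unfolding homeomorphism_def g using gc by (auto simp: g_def image_image intro!: continuous_intros)
  then have "K homeomorphic sheet h K j" using homeomorphic_def by blast
  then have "contractible (sheet h K j)"
    using homeomorphic_contractible_eq convex_imp_contractible K(1) by blast
  moreover have "sheet h K j \<subseteq> over K" by (auto simp: sheet_def)
  ultimately show "contractible_space (subtopology (top_of_set (over K)) (sheet h K j))"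
    by (simp add: subtopology_subtopology Int_absorb1 Int_absorb2)
  show "sheet h K j \<noteq> {}" using g K by simp
  \<comment> \<open>The coordinate takes only finitely many values on the curve, so having the value
    \<open>\<zeta> ^ j\<close> is the same as avoiding a finite set, which is an open
    condition.\<close>
  let ?F = "(\<lambda>i. \<zeta> ^ i) ` ({..<m} - {j})"
  have "sheet h K j = over K \<inter> coord h -` (- ?F)"
  proof
    show "sheet h K j \<subseteq> over K \<inter> coord h -` (- ?F)"
      using zeta_inj j by (auto simp: sheet_def)
    show "over K \<inter> coord h -` (- ?F) \<subseteq> sheet h K j"
    proof
      fix p assume p: "p \<in> over K \<inter> coord h -` (- ?F)"
      then obtain i where "i < m" "coord h p = \<zeta> ^ i" using one zeta_exists by blast
      then show "p \<in> sheet h K j" using p by (auto simp: sheet_def)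
    qed
  qed
  moreover have "open (- ?F)" by (intro open_Compl finite_imp_closed) auto
  ultimately show "openin (top_of_set (over K)) (sheet h K j)"
    using continuous_openin_preimage_gen[OF coord_cont[OF h(1)]] by metis
qed

lemma rot_sheet: "rot \<in> sheet h K j \<rightarrow> sheet h K (Suc j mod m)"
  by (auto simp: sheet_def zeta_mod power_mult_distrib)

text \<open>The claims are proved together because the step uses all of them for the part already
  built: path-connectedness makes the exact sequence short, and absence of fixed classes passes
  through the equivariant sequence. \<open>r\<close> counts the roots beyond the first.\<close>

lemma over_homology:
  assumes "convex K" "open K" "card (R \<inter> K) = Suc r"
  shows "path_connected (over K) \<and>
    homology_group 1 (top_of_set (over K)) \<cong> free_Abelian_group {..<r * (m - 1)} \<and>
    (\<forall>c \<in> carrier (homology_group 1 (top_of_set (over K))).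
       hom_induced 1 (top_of_set (over K)) {} (top_of_set (over K)) {} rot c = c \<longrightarrow>
       c = \<one>\<^bsub>homology_group 1 (top_of_set (over K))\<^esub>)"
  using assms
proof (induction r arbitrary: K)
  case 0
  then obtain a where a: "R \<inter> K = {a}" by (auto simp: card_1_singleton_iff)
  have tr: "trivial_group (homology_group 1 (top_of_set (over K)))"
    using over_one_root(1)[OF 0(1,2) a] trivial_reduced_homology_group_contractible_space[of "top_of_set (over K)" 1]
    by (simp add: un_reduced_homology_group)
  have "trivial_group (free_Abelian_group ({}::nat set))" by (auto simp: trivial_group_def)
  then have "homology_group 1 (top_of_set (over K)) \<cong> free_Abelian_group ({}::nat set)"
    using tr by (intro trivial_groups_isomorphic)
  then show ?case using over_one_root(2)[OF 0(1,2) a] tr by (auto simp: trivial_group_def)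
next
  case (Suc r)
  have fin: "finite (R \<inter> K)" using finR by simp
  have ne: "R \<inter> K \<noteq> {}" using Suc.prems(3) by auto
  \<comment> \<open>A root of maximal norm is an extreme point of the root set, so the inner product
    with it, here \<open>l\<close>, separates it strictly from the other roots.\<close>
  obtain a where a: "a \<in> R \<inter> K" "\<And>b. b \<in> R \<inter> K \<Longrightarrow> norm b \<le> norm a"
  proof -
    have "Max (norm ` (R \<inter> K)) \<in> norm ` (R \<inter> K)" using fin ne by (intro Max_in) auto
    then obtain a where "a \<in> R \<inter> K" "norm a = Max (norm ` (R \<inter> K))" by auto
    then show ?thesis using fin that by simp
  qed
  define l where "l z = Re (cnj a * z)" for z
  define c where "c = l a"
  have nrm: "(norm x)^2 = Re x * Re x + Im x * Im x" for x
    by (simp only: cmod_power2 power2_eq_square[of "Re x"] power2_eq_square[of "Im x"])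
  have lt: "l b < c" if b: "b \<in> R \<inter> K - {a}" for b
  proof (rule ccontr)
    assume "\<not> l b < c"
    then have ge: "(norm a)^2 \<le> l b" unfolding nrm by (simp add: c_def l_def)
    have "(norm (b - a))^2 = (norm b)^2 + (norm a)^2 - 2 * l b"
      unfolding nrm by (simp add: l_def algebra_simps)
    also have "(norm b)^2 \<le> (norm a)^2" using a(2) b by (intro power_mono) auto
    finally have "(norm (b - a))^2 \<le> 0" using ge by linarith
    then show False using b by simp
  qed
  have fin': "finite (R \<inter> K - {a})" using fin by simp
  have card': "card (R \<inter> K - {a}) = Suc r" using Suc.prems(3) a(1) fin by simp
  then have ne': "R \<inter> K - {a} \<noteq> {}" by (metis card.empty nat.distinct(1))
  define d where "d = Max (l ` (R \<inter> K - {a}))"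
  have d: "l b \<le> d" if "b \<in> R \<inter> K - {a}" for b using that fin' by (simp add: d_def)
  have "d \<in> l ` (R \<inter> K - {a})" unfolding d_def using fin' ne' by (intro Max_in) auto
  then have dc: "d < c" using lt by auto
  \<comment> \<open>The two half-planes overlap in the strip between the levels \<open>d\<close> and
    \<open>c\<close>, which meets no root in \<open>K\<close>.\<close>
  define A where "A = K \<inter> {z. l z < c}"
  define B where "B = K \<inter> {z. l z > d}"
  have lin: "l z = a \<bullet> z" for z by (simp add: l_def inner_complex_def)
  have cv: "convex A" "convex B" unfolding A_def B_def lin
    using Suc.prems(1) convex_halfspace_lt[of a c] convex_halfspace_gt[of d a] by (auto intro: convex_Int)
  have op: "open A" "open B" unfolding A_def B_def lin
    using Suc.prems(2) open_halfspace_lt[of a c] open_halfspace_gt[of d a] by (auto intro: open_Int)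
  have RA: "R \<inter> A = R \<inter> K - {a}" using lt by (auto simp: A_def c_def)
  have RB: "R \<inter> B = {a}" using d a dc by (force simp: B_def c_def)
  have RAB: "R \<inter> (A \<inter> B) = {}" using RA RB by auto
  have AB: "A \<union> B = K" using dc by (auto simp: A_def B_def)
  have meet: "A \<inter> B \<noteq> {}"
  proof
    assume e: "A \<inter> B = {}"
    have "connected K" using Suc.prems(1) convex_connected by blast
    moreover have "a \<in> B" "A \<noteq> {}" using RB RA ne' by auto
    ultimately show False using e AB op connectedD[of K A B] by auto
  qed
  have IH: "path_connected (over A)" "homology_group 1 (top_of_set (over A)) \<cong> free_Abelian_group {..<r * (m - 1)}"
    "\<And>c. \<lbrakk>c \<in> carrier (homology_group 1 (top_of_set (over A)));
       hom_induced 1 (top_of_set (over A)) {} (top_of_set (over A)) {} rot c = c\<rbrakk> \<Longrightarrow>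
       c = \<one>\<^bsub>homology_group 1 (top_of_set (over A))\<^esub>"
    using Suc.IH[OF cv(1) op(1)] RA card' by auto
  have sub: "subtopology (top_of_set (over K)) (over A) = top_of_set (over A)"
    "subtopology (top_of_set (over K)) (over B) = top_of_set (over B)"
    "subtopology (top_of_set (over K)) (over A \<inter> over B) = top_of_set (over (A \<inter> B))"
    by (auto simp: subtopology_subtopology A_def B_def over_Int intro!: arg_cong2[where f=subtopology])
  have op': "open (A \<inter> B)" "convex (A \<inter> B)" using op cv by (auto intro: convex_Int)
  obtain h where h: "h holomorphic_on A \<inter> B" "\<And>z. z \<in> A \<inter> B \<Longrightarrow> Q z = exp (h z)"
    using Q_log[OF op'(2,1) RAB] by metis
  interpret sh: sheets "top_of_set (over (A \<inter> B))" "sheet h (A \<inter> B)" m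
    by (rule sheets_over[OF op'(2,1) meet h])
  interpret pr: open_cover_pair "top_of_set (over K)" "over A" "over B"
  proof
    show "openin (top_of_set (over K)) (over A)" "openin (top_of_set (over K)) (over B)"
      using op AB by (auto intro!: openin_over)
    show "over A \<union> over B = topspace (top_of_set (over K))" using AB over_Un by auto
    show "contractible_space (subtopology (top_of_set (over K)) (over B))"
      using sub over_one_root(1)[OF cv(2) op(2) RB] by simp
    show "over A \<inter> over B \<noteq> {}" using over_nonempty[OF meet] over_Int by simp
  qed
  have H1: "trivial_group (homology_group 1 (subtopology (top_of_set (over K)) (over A \<inter> over B)))"
    unfolding sub by (rule sh.first_homology)
  have rK: "continuous_map (top_of_set (over K)) (top_of_set (over K)) rot"
    and rAB: "continuous_map (top_of_set (over (A \<inter> B))) (top_of_set (over (A \<inter> B))) rot"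
    using rot_cont by (auto simp: power_mult_distrib)
  have "homology_group 1 (top_of_set (over K)) \<cong> free_Abelian_group {..<r * (m - 1) + (m - 1)}"
    using IH(1,2) H1 sh.reduced_homology by (intro pr.homology_group_1_free) (simp_all add: sub)
  moreover have "c = \<one>\<^bsub>homology_group 1 (top_of_set (over K))\<^esub>"
    if "c \<in> carrier (homology_group 1 (top_of_set (over K)))"
      "hom_induced 1 (top_of_set (over K)) {} (top_of_set (over K)) {} rot c = c" for c
  proof (rule pr.no_fixed_homology_class[of rot, OF rK _ _ H1 _ _ that])
    show "rot \<in> over A \<rightarrow> over A" "rot \<in> over B \<rightarrow> over B" by (auto simp: power_mult_distrib)
  qed (use IH(3) sh.no_fixed_reduced[OF rAB rot_sheet] sub in auto)
  moreover have "path_connected (over K)"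
    using IH(1) over_one_root(2)[OF cv(2) op(2) RB] pr.meet path_connected_Un[of "over A" "over B"] over_Un AB by metis
  moreover have "r * (m - 1) + (m - 1) = Suc r * (m - 1)" by simp
  ultimately show ?case by metis
qed

end

section \<open>The point at infinity\<close>

context cyclic_curve begin

text \<open>A radius beyond all roots; the summand 1 makes it strict and allows division by
  it.\<close>

definition \<rho> :: real where "\<rho> = 1 + (\<Sum>a\<in>R. norm a)"

lemma norm_root_lt: "a \<in> R \<Longrightarrow> norm a < \<rho>"
  using member_le_sum[of a R norm] finR by (simp add: \<rho>_def)

lemma rho_ge_1: "\<rho> \<ge> 1"
  by (simp add: \<rho>_def sum_nonneg)

lemma R_nonempty: "R \<noteq> {}"
proof
  assume "R = {}" then have "m * e = 1" using cardR by simp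
  then show False using m2 by simp
qed

lemma me_pos: "m * e \<ge> 6"
  using mult_le_mono[OF m2 e3] by simp

text \<open>The reversed polynomial, the product of the factors \<open>1 - a * x\<close>, has no
  zero in this disc and hence a logarithm there. The extra factor \<open>z\<close> raises the
  exponent to \<open>m * e\<close>, whose m-th root is the integral power
  \<open>z ^ e\<close>.\<close>

lemma Q_at_infinity:
  obtains k where "k holomorphic_on ball 0 (1 / \<rho>)"
    "\<And>z. norm z > \<rho> \<Longrightarrow> Q z * z = z ^ (m * e) * exp (k (1 / z))"
proof -
  define P where "P x = (\<Prod>a\<in>R. 1 - a * x)" for x
  have "P x \<noteq> 0" if x: "x \<in> ball 0 (1 / \<rho>)" for x
  proof -
    have "a * x \<noteq> 1" if a: "a \<in> R" for a
    proof
      assume "a * x = 1"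
      then have "norm a * norm x = 1" by (metis norm_mult norm_one)
      moreover have "norm a * norm x \<le> \<rho> * norm x" using norm_root_lt[OF a] by (intro mult_right_mono) auto
      moreover have "\<rho> * norm x < 1" using x rho_ge_1 by (simp add: field_simps)
      ultimately show False by simp
    qed
    then show ?thesis using finR by (auto simp: P_def) 
  qed
  moreover have "P holomorphic_on ball 0 (1 / \<rho>)" unfolding P_def by (intro holomorphic_intros)
  ultimately obtain k where k: "k holomorphic_on ball 0 (1 / \<rho>)" "\<And>x. x \<in> ball 0 (1 / \<rho>) \<Longrightarrow> P x = exp (k x)"
    using contractible_imp_holomorphic_log[of P "ball 0 (1 / \<rho>)"] convex_imp_contractible[OF convex_ball] by metis
  have "Q z * z = z ^ (m * e) * exp (k (1 / z))" if z: "norm z > \<rho>" for z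
  proof -
    have z0: "z \<noteq> 0" using z rho_ge_1 by auto
    have "1 / z \<in> ball 0 (1 / \<rho>)" using z rho_ge_1 by (simp add: norm_divide divide_simps)
    then have "exp (k (1 / z)) = P (1 / z)" using k by simp
    moreover have "Q z = (\<Prod>a\<in>R. z * (1 - a * (1 / z)))" unfolding Q_def by (rule prod.cong) (use z0 in \<open>auto simp: field_simps\<close>)
    moreover have "\<dots> = z ^ card R * P (1 / z)" by (simp only: prod.distrib prod_constant P_def)
    moreover have "z ^ card R * z = z ^ (m * e)" by (simp flip: cardR)
    ultimately show ?thesis by (simp add: mult_ac)
  qed
  then show ?thesis using that k by blast
qed

definition kinf :: "complex \<Rightarrow> complex" where
  "kinf = (SOME k. k holomorphic_on ball 0 (1 / \<rho>) \<and>
     (\<forall>z. norm z > \<rho> \<longrightarrow> Q z * z = z ^ (m * e) * exp (k (1 / z))))"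

lemma kinf: "kinf holomorphic_on ball 0 (1 / \<rho>)"
  "norm z > \<rho> \<Longrightarrow> Q z * z = z ^ (m * e) * exp (kinf (1 / z))"
proof -
  have "\<exists>k. k holomorphic_on ball 0 (1 / \<rho>) \<and>
     (\<forall>z. norm z > \<rho> \<longrightarrow> Q z * z = z ^ (m * e) * exp (k (1 / z)))"
    using Q_at_infinity by metis
  from someI_ex[OF this] show "kinf holomorphic_on ball 0 (1 / \<rho>)"
    "norm z > \<rho> \<Longrightarrow> Q z * z = z ^ (m * e) * exp (kinf (1 / z))"
    unfolding kinf_def by auto
qed

section \<open>The one-point compactification of the affine curve\<close>

abbreviation curve :: "(complex \<times> complex) set" where "curve \<equiv> over UNIV"

text \<open>Any point off the curve would do.\<close>

definition om :: "complex \<times> complex" where "om = (SOME a. a \<in> R, 1)"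

lemma om_notin [simp]: "om \<notin> over K"
proof -
  have "(SOME a. a \<in> R) \<in> R" using R_nonempty by (simp add: some_in_eq)
  then have "Q (SOME a. a \<in> R) = 0" by (simp add: Q_eq_0_iff)
  then show ?thesis by (simp add: om_def)
qed

lemma om_off_curve [simp]: "snd om ^ m \<noteq> Q (fst om)"
  using om_notin[of UNIV] unfolding mem_over by simp

lemma over_neq_om: "p \<in> over K \<Longrightarrow> p \<noteq> om" using om_notin by metis

definition pts :: "(complex \<times> complex) set" where "pts = insert om curve"

text \<open>The points of the compactification are options, whereas the surface is to live in
  \<open>complex \<times> complex\<close>. So its topology is pulled back along the bijection that
  sends \<open>om\<close> to \<open>None\<close>.\<close>

definition X :: "(complex \<times> complex) topology" where
  "X = pullback_topology pts (\<lambda>p. if p = om then None else Some p)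
     (Alexandroff_compactification (top_of_set curve))"

lemma closed_over: "closed K \<Longrightarrow> closed (over K)"
proof -
  assume K: "closed K"
  have "over K = {p. fst p \<in> K} \<inter> {p. snd p ^ m = Q (fst p)}" by auto
  moreover have "closed {p :: complex \<times> complex. fst p \<in> K}"
    using closed_vimage_fst[OF K] by (simp add: vimage_def)
  moreover have "closed {p. snd p ^ m = Q (fst p)}"
    by (intro closed_Collect_eq continuous_intros)
  ultimately show ?thesis by auto
qed

text \<open>Properness of the projection to \<open>z\<close>: where \<open>Q z\<close> is bounded,
  so is \<open>w\<close>.\<close>

lemma compact_over: "compact K \<Longrightarrow> compact (over K)"
proof -
  assume K: "compact K"
  have "compact (Q ` K)" by (rule compact_continuous_image[OF _ K]) (intro continuous_intros)
  then obtain B where B: "\<And>z. z \<in> K \<Longrightarrow> norm (Q z) \<le> B"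
    using compact_imp_bounded bounded_iff by (metis imageI)
  have "snd ` over K \<subseteq> cball 0 (max 1 B)"
  proof
    fix w assume "w \<in> snd ` over K"
    then obtain z where z: "z \<in> K" "w ^ m = Q z" by auto
    have "norm w ^ m \<le> B" using B[OF z(1)] z(2) by (simp flip: norm_power)
    moreover have "norm w \<le> norm w ^ m" if "norm w \<ge> 1" using that m_pos by (simp add: self_le_power)
    ultimately show "w \<in> cball 0 (max 1 B)" by fastforce
  qed
  then have "bounded (snd ` over K)" using bounded_subset bounded_cball by blast
  moreover have "bounded (fst ` over K)"
    using compact_imp_bounded[OF K] by (rule bounded_subset) auto
  moreover have "over K \<subseteq> fst ` over K \<times> snd ` over K" by (rule subset_fst_snd)
  ultimately have "bounded (over K)" using bounded_Times bounded_subset by blast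
  then show ?thesis using closed_over K by (simp add: compact_eq_bounded_closed)
qed

lemma openin_curve: "openin (top_of_set curve) (over K)" if "open K"
  using openin_over[OF that] by simp

lemma locally_compact_curve: "locally_compact_space (top_of_set curve)"
  unfolding locally_compact_space_def
proof
  fix p assume "p \<in> topspace (top_of_set curve)"
  then have p: "p \<in> curve" by simp
  have "compactin (top_of_set curve) (over (cball (fst p) 1))"
    using compact_over[of "cball (fst p) 1"] by (auto simp: compactin_subtopology)
  moreover have "p \<in> over (ball (fst p) 1)" using p by auto
  moreover have "over (ball (fst p) 1) \<subseteq> over (cball (fst p) 1)" by auto
  ultimately show "\<exists>U K. openin (top_of_set curve) U \<and> compactin (top_of_set curve) K \<and> p \<in> U \<and> U \<subseteq> K"
    using openin_curve[of "ball (fst p) 1"] by blast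
qed

lemma topspace_X [simp]: "topspace X = pts"
  by (auto simp: X_def topspace_pullback_topology pts_def)

lemma openin_X:
  "openin X U \<longleftrightarrow> U \<subseteq> pts \<and> openin (top_of_set curve) (U - {om}) \<and> (om \<in> U \<longrightarrow> compact (curve - U))"
proof
  assume "openin X U"
  then obtain W where W: "openin (Alexandroff_compactification (top_of_set curve)) W"
    "U = (\<lambda>p. if p = om then None else Some p) -` W \<inter> pts"
    unfolding X_def openin_pullback_topology by auto
  from W(1) consider V where "openin (top_of_set curve) V" "W = Some ` V"
    | C where "compactin (top_of_set curve) C" "closedin (top_of_set curve) C" "W = insert None (Some ` (curve - C))"
    by (auto simp: openin_Alexandroff_compactification)
  then show "U \<subseteq> pts \<and> openin (top_of_set curve) (U - {om}) \<and> (om \<in> U \<longrightarrow> compact (curve - U))"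
  proof cases
    case 1
    then have "V \<subseteq> curve" using openin_subset by fastforce
    have omV: "om \<notin> V" using \<open>V \<subseteq> curve\<close> om_notin by blast
    have "U = V" unfolding W(2) 1(2) using \<open>V \<subseteq> curve\<close> omV
      by (auto simp: pts_def simp del: mem_over split: if_splits)
    moreover have "V - {om} = V" using omV by auto
    ultimately show ?thesis using 1 \<open>V \<subseteq> curve\<close> omV by (auto simp: pts_def)
  next
    case 2
    have C: "C \<subseteq> curve" using 2(2) closedin_subset by fastforce
    have U: "U = insert om (curve - C)" using W(2) 2 over_neq_om by (auto simp: pts_def)
    then have "U - {om} = curve - C" "curve - U = C" using C over_neq_om by auto
    moreover have "openin (top_of_set curve) (curve - C)"
      using 2(2) by (simp add: closedin_def)
    moreover have "compact C" using 2(1) by (simp add: compactin_subtopology)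
    ultimately show ?thesis using U by (auto simp: pts_def)
  qed
next
  assume U: "U \<subseteq> pts \<and> openin (top_of_set curve) (U - {om}) \<and> (om \<in> U \<longrightarrow> compact (curve - U))"
  define W where "W = (if om \<in> U then insert None (Some ` (U - {om})) else Some ` U)"
  have eq: "U = (\<lambda>p. if p = om then None else Some p) -` W \<inter> pts"
    using U by (auto simp: W_def split: if_splits)
  have "openin (Alexandroff_compactification (top_of_set curve)) W"
  proof (cases "om \<in> U")
    case False
    then have "U - {om} = U" by auto
    then show ?thesis using U False by (simp add: W_def)
  next
    case True
    have s: "U - {om} = curve - (curve - U)" using U over_neq_om by (auto simp: pts_def)
    have "closedin (top_of_set curve) (curve - U)"
    proof -
      have "curve - U = curve - (U - {om})" using over_neq_om by auto
      then show ?thesis using U by (simp add: closedin_diff)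
    qed
    moreover have "compactin (top_of_set curve) (curve - U)"
      using U True by (simp add: compactin_subtopology)
    ultimately show ?thesis using True s
      by (auto simp: W_def openin_Alexandroff_compactification)
  qed
  then show "openin X U" unfolding X_def openin_pullback_topology using eq by auto
qed

lemma homeomorphic_X: "X homeomorphic_space Alexandroff_compactification (top_of_set curve)"
proof -
  let ?f = "\<lambda>p. if p = om then None else Some p"
  let ?A = "Alexandroff_compactification (top_of_set curve)"
  have "homeomorphic_map X ?A ?f"
  proof (rule bijective_open_imp_homeomorphic_map)
    show "continuous_map X ?A ?f"
      unfolding X_def using continuous_map_pullback[of ?A ?A id pts ?f] by simp
    show surj: "?f ` topspace X = topspace ?A"
      using over_neq_om by (force simp: pts_def)
    show "inj_on ?f (topspace X)" by (auto simp: inj_on_def)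
    show "open_map X ?A ?f"
      unfolding open_map_def
    proof (intro allI impI)
      fix U assume "openin X U"
      then obtain W where W: "openin ?A W" "U = ?f -` W \<inter> pts"
        unfolding X_def openin_pullback_topology by auto
      then have "?f ` U = W \<inter> ?f ` pts" by auto
      also have "\<dots> = W"
        using openin_subset[OF W(1)] unfolding surj[symmetric] topspace_X by (rule Int_absorb2)
      finally show "openin ?A (?f ` U)" using W by simp
    qed
  qed
  then show ?thesis using homeomorphic_map_imp_homeomorphic_space by blast
qed

lemma compact_X: "compact_space X" and Hausdorff_X: "Hausdorff_space X"
  using homeomorphic_compact_space[OF homeomorphic_X] homeomorphic_Hausdorff_space[OF homeomorphic_X]
    locally_compact_curve Hausdorff_space_subtopology[OF Hausdorff_space_euclidean]
  by (auto simp: Hausdorff_space_Alexandroff_compactification)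

lemma openin_X_affine: "openin X U \<longleftrightarrow> openin (top_of_set curve) U" if "om \<notin> U"
proof -
  have "U - {om} = U" using that by auto
  moreover have "U \<subseteq> pts" if "openin (top_of_set curve) U" using openin_subset[OF that] by (auto simp: pts_def)
  ultimately show ?thesis using that by (auto simp: openin_X)
qed

lemma openin_X_over: "open K \<Longrightarrow> openin X (over K)"
  using openin_X_affine[OF om_notin] openin_curve by blast

lemma subtopology_X_over: "open K \<Longrightarrow> subtopology X (over K) = top_of_set (over K)"
proof -
  assume K: "open K"
  have "openin (subtopology X (over K)) U \<longleftrightarrow> openin (top_of_set (over K)) U" for U
  proof -
    have "openin (subtopology X (over K)) U \<longleftrightarrow> U \<subseteq> over K \<and> openin X U"
      unfolding openin_open_subtopology[OF openin_X_over[OF K]] by blast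
    also have "\<dots> \<longleftrightarrow> U \<subseteq> over K \<and> openin (top_of_set curve) U"
      using openin_X_affine[of U] om_notin by blast
    also have "\<dots> \<longleftrightarrow> openin (subtopology (top_of_set curve) (over K)) U"
      unfolding openin_open_subtopology[OF openin_curve[OF K]] by blast
    also have "subtopology (top_of_set curve) (over K) = top_of_set (over K)"
      by (auto simp: subtopology_subtopology intro!: arg_cong2[where f=subtopology])
    finally show ?thesis .
  qed
  then show ?thesis by (simp add: topology_eq)
qed

section \<open>The coordinate disc at infinity\<close>

definition Vinf :: "(complex \<times> complex) set" where "Vinf = insert om (over {z. norm z > \<rho>})"

definition Dinf :: "complex set" where "Dinf = {s. norm s ^ m < 1 / \<rho>}"

text \<open>Up to the exponential factor this is \<open>w / z ^ e\<close>. The factor is chosen so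
  that the m-th power is \<open>1 / z\<close>, which makes it a coordinate around \<open>om\<close>,
  with value 0 there.\<close>

definition cinf :: "complex \<times> complex \<Rightarrow> complex" where
  "cinf p = (if p = om then 0 else snd p * exp (- kinf (1 / fst p) / m) / fst p ^ e)"

definition pinf :: "complex \<Rightarrow> complex \<times> complex" where
  "pinf s = (if s = 0 then om else (1 / s ^ m, s * (1 / s ^ m) ^ e * exp (kinf (s ^ m) / m)))"

lemma open_outside: "open {z::complex. norm z > r}"
  using open_Collect_less[of "\<lambda>_. r" norm, OF continuous_on_const continuous_on_norm_id] by simp

lemma Dinf_pow: "s \<in> Dinf \<longleftrightarrow> s ^ m \<in> ball 0 (1 / \<rho>)"
  by (simp add: Dinf_def norm_power)

lemma openin_Vinf: "openin X Vinf"
proof -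
  have "curve - Vinf = over (cball 0 \<rho>)" using over_neq_om by (auto simp: Vinf_def not_less)
  moreover have "Vinf - {om} = over {z. norm z > \<rho>}" using over_neq_om by (auto simp: Vinf_def)
  ultimately show ?thesis
    using openin_curve[OF open_outside] compact_over[of "cball 0 \<rho>"] by (auto simp: openin_X Vinf_def pts_def)
qed

lemma cinf_pow:
  assumes "p \<in> over {z. norm z > \<rho>}" shows "cinf p ^ m = 1 / fst p" "fst p \<noteq> 0"
proof -
  have z: "norm (fst p) > \<rho>" and w: "snd p ^ m = Q (fst p)" using assms by auto
  show z0: "fst p \<noteq> 0" using z rho_ge_1 by auto
  have "cinf p = snd p * exp (- kinf (1 / fst p) / m) / fst p ^ e"
    using over_neq_om[OF assms] by (simp add: cinf_def)
  then have "cinf p ^ m = Q (fst p) * exp (- kinf (1 / fst p)) / fst p ^ (e * m)"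
    by (simp only: power_mult_distrib power_divide exp_div_pow w power_mult)
  also have "Q (fst p) = fst p ^ (m * e) * exp (kinf (1 / fst p)) / fst p"
    using kinf(2)[OF z] z0 by (simp add: field_simps)
  finally show "cinf p ^ m = 1 / fst p"
    using z0 by (simp add: field_simps flip: exp_add)
qed

lemma cinf_in: "p \<in> Vinf \<Longrightarrow> cinf p \<in> Dinf"
proof -
  assume p: "p \<in> Vinf"
  show ?thesis
  proof (cases "p = om")
    case True then show ?thesis using rho_ge_1 m_pos by (simp add: cinf_def Dinf_def zero_power)
  next
    case False
    then have p': "p \<in> over {z. norm z > \<rho>}" using p by (auto simp: Vinf_def)
    have "norm (cinf p) ^ m = 1 / norm (fst p)" using cinf_pow(1)[OF p'] by (metis norm_divide norm_one norm_power)
    also have "\<dots> < 1 / \<rho>" using p' rho_ge_1 by (intro frac_less2) auto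
    finally show ?thesis by (simp add: Dinf_def)
  qed
qed

lemma pinf_in:
  assumes "s \<in> Dinf" "s \<noteq> 0" shows "pinf s \<in> over {z. norm z > \<rho>}"
proof -
  have s: "norm s ^ m < 1 / \<rho>" "norm s ^ m > 0" using assms by (auto simp: Dinf_def)
  define z where "z = 1 / s ^ m"
  have zs: "s ^ m = 1 / z" "z \<noteq> 0" using assms by (auto simp: z_def)
  have nz: "norm z > \<rho>" using s rho_ge_1 by (simp add: z_def norm_divide norm_power field_simps)
  have "snd (pinf s) ^ m = (1 / z) * z ^ (e * m) * exp (kinf (1 / z))"
    using assms(2) zs by (simp add: pinf_def power_mult_distrib exp_div_pow power_mult)
  also have "\<dots> = Q z"
    using kinf(2)[OF nz] zs(2) by (simp add: field_simps)
  finally show ?thesis using nz assms(2) by (simp add: pinf_def z_def)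
qed

lemma pinf_cinf: "p \<in> Vinf \<Longrightarrow> pinf (cinf p) = p"
proof -
  assume p: "p \<in> Vinf"
  show ?thesis
  proof (cases "p = om")
    case True then show ?thesis by (simp add: cinf_def pinf_def)
  next
    case False
    then have p': "p \<in> over {z. norm z > \<rho>}" using p by (auto simp: Vinf_def)
    note c = cinf_pow[OF p']
    have nz: "cinf p \<noteq> 0" using c m_pos by (auto simp: zero_power)
    have "cinf p * fst p ^ e * exp (kinf (1 / fst p) / m) = snd p"
      using False c(2) by (simp add: cinf_def mult.assoc flip: exp_add)
    then show ?thesis using nz c by (simp add: pinf_def prod_eq_iff)
  qed
qed

lemma cinf_pinf: "s \<in> Dinf \<Longrightarrow> cinf (pinf s) = s"
proof -
  assume s: "s \<in> Dinf"
  show ?thesis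
  proof (cases "s = 0")
    case True then show ?thesis by (simp add: cinf_def pinf_def)
  next
    case False
    then have "pinf s \<noteq> om" using pinf_in[OF s] over_neq_om by blast
    then show ?thesis using False by (simp add: cinf_def pinf_def field_simps flip: exp_add)
  qed
qed

lemma cinf_cont: "continuous_on (over {z. norm z > \<rho>}) cinf"
proof -
  let ?S = "over {z. norm z > \<rho>}"
  have nz: "fst p \<noteq> 0" if "p \<in> ?S" for p using cinf_pow(2)[OF that] .
  have "continuous_on ?S (\<lambda>p. kinf (1 / fst p))"
  proof (rule continuous_on_compose2[OF holomorphic_on_imp_continuous_on[OF kinf(1)]])
    show "continuous_on ?S (\<lambda>p. 1 / fst p)" using nz by (intro continuous_intros) auto
    show "(\<lambda>p. 1 / fst p) ` ?S \<subseteq> ball 0 (1 / \<rho>)"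
      using rho_ge_1 by (auto simp: norm_divide divide_simps)
  qed
  then have "continuous_on ?S (\<lambda>p. snd p * exp (- kinf (1 / fst p) / m) / fst p ^ e)"
    using nz m_pos by (intro continuous_intros) auto
  then show ?thesis
    by (rule continuous_on_eq) (use over_neq_om in \<open>auto simp: cinf_def\<close>)
qed

lemma pinf_cont: "continuous_on (Dinf - {0}) pinf"
proof -
  have "continuous_on (Dinf - {0}) (\<lambda>s. kinf (s ^ m))"
  proof (rule continuous_on_compose2[OF holomorphic_on_imp_continuous_on[OF kinf(1)]])
    show "(\<lambda>s. s ^ m) ` (Dinf - {0}) \<subseteq> ball 0 (1 / \<rho>)" using Dinf_pow by auto
  qed (intro continuous_intros)
  then have "continuous_on (Dinf - {0}) (\<lambda>s. (1 / s ^ m, s * (1 / s ^ m) ^ e * exp (kinf (s ^ m) / m)))"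
    using m_pos by (intro continuous_intros) auto
  then show ?thesis
    by (rule continuous_on_eq) (auto simp: pinf_def)
qed

lemma open_Dinf: "open Dinf"
  unfolding Dinf_def by (intro open_Collect_less continuous_intros)

lemma homeomorphic_Vinf: "homeomorphic_maps (subtopology X Vinf) (top_of_set Dinf) cinf pinf"
  unfolding homeomorphic_maps_def
proof (intro conjI)
  have tV: "topspace (subtopology X Vinf) = Vinf" by (auto simp: Vinf_def pts_def)
  show "\<forall>x\<in>topspace (subtopology X Vinf). pinf (cinf x) = x" using pinf_cinf tV by simp
  show "\<forall>y\<in>topspace (top_of_set Dinf). cinf (pinf y) = y" using cinf_pinf by simp
  show "continuous_map (subtopology X Vinf) (top_of_set Dinf) cinf"
    unfolding continuous_map_in_subtopology
  proof (intro conjI)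
    show "cinf \<in> topspace (subtopology X Vinf) \<rightarrow> Dinf" using cinf_in tV by auto
    show "continuous_map (subtopology X Vinf) euclidean cinf"
      unfolding continuous_map tV
    proof (intro conjI allI impI)
      fix U :: "complex set" assume "openin euclidean U"
      then have U: "open U" by simp
      let ?P = "{x \<in> Vinf. cinf x \<in> U}"
      have "openin X ?P" unfolding openin_X
      proof (intro conjI impI)
        show "?P \<subseteq> pts" by (auto simp: Vinf_def pts_def)
        have "?P - {om} = over {z. norm z > \<rho>} \<inter> cinf -` U"
          using over_neq_om by (auto simp: Vinf_def)
        moreover have "openin (top_of_set (over {z. norm z > \<rho>})) (over {z. norm z > \<rho>} \<inter> cinf -` U)"
          by (rule continuous_openin_preimage_gen[OF cinf_cont U])
        ultimately show o: "openin (top_of_set curve) (?P - {om})"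
          using openin_trans openin_curve[OF open_outside] by metis
        assume "om \<in> ?P"
        then have "0 \<in> U" by (simp add: cinf_def)
        then obtain \<epsilon> where \<epsilon>: "\<epsilon> > 0" "ball 0 \<epsilon> \<subseteq> U" using U openE by blast
        \<comment> \<open>Since \<open>norm (cinf p) ^ m\<close> is the inverse of
          \<open>norm (fst p)\<close>, a point whose coordinate misses the disc of radius \<epsilon>
          lies over a bounded set. This is the compactness required of a neighbourhood of
          \<open>om\<close>.\<close>
        have "curve - ?P \<subseteq> over (cball 0 (max \<rho> (1 / \<epsilon> ^ m)))"
        proof
          fix p assume p: "p \<in> curve - ?P"
          show "p \<in> over (cball 0 (max \<rho> (1 / \<epsilon> ^ m)))"
          proof (cases "norm (fst p) > \<rho>")
            case True
            then have p': "p \<in> over {z. norm z > \<rho>}" using p by auto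
            then have "cinf p \<notin> U" using p by (auto simp: Vinf_def)
            then have "\<epsilon> \<le> norm (cinf p)" using \<epsilon> by (meson mem_ball_0 not_less subsetD)
            then have "\<epsilon> ^ m \<le> norm (cinf p) ^ m" using \<epsilon> by (intro power_mono) auto
            also have "\<dots> = 1 / norm (fst p)" using cinf_pow(1)[OF p'] by (metis norm_divide norm_one norm_power)
            finally have "\<epsilon> ^ m \<le> 1 / norm (fst p)" .
            moreover have "norm (fst p) > 0" using True rho_ge_1 by linarith
            ultimately have "norm (fst p) \<le> 1 / \<epsilon> ^ m" using \<epsilon>(1) by (simp add: field_simps)
            then show ?thesis using p by (simp add: le_max_iff_disj)
          next
            case False
            then show ?thesis using p by (simp add: le_max_iff_disj)
          qed
        qed
        then have eq: "curve - ?P = over (cball 0 (max \<rho> (1 / \<epsilon> ^ m))) \<inter> (curve - ?P)" by blast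
        have "closed (curve - ?P)"
        proof -
          have "curve - ?P = curve - (?P - {om})" using over_neq_om by auto
          moreover have "closedin (top_of_set curve) (curve - (?P - {om}))"
            using o by (simp add: closedin_diff)
          ultimately show ?thesis using closed_over[OF closed_UNIV] closedin_closed_trans by metis
        qed
        then show "compact (curve - ?P)"
          by (subst eq) (intro compact_Int_closed compact_over compact_cball)
      qed
      then show "openin (subtopology X Vinf) ?P"
        unfolding openin_open_subtopology[OF openin_Vinf] by auto
    qed auto
  qed
  show "continuous_map (top_of_set Dinf) (subtopology X Vinf) pinf"
    unfolding continuous_map_def
  proof (intro conjI allI impI)
    have im: "pinf s \<in> Vinf" if "s \<in> Dinf" for s
      using pinf_in[OF that] by (cases "s = 0") (auto simp: pinf_def Vinf_def)
    then show "pinf \<in> topspace (top_of_set Dinf) \<rightarrow> topspace (subtopology X Vinf)" using tV by auto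
    fix U assume "openin (subtopology X Vinf) U"
    then have U: "openin X U" "U \<subseteq> Vinf" by (simp_all add: openin_open_subtopology[OF openin_Vinf])
    then have Uo: "openin (top_of_set curve) (U - {om})" using openin_X by blast
    have D0: "open (Dinf - {0})" using open_Dinf by auto
    have 1: "open ((Dinf - {0}) \<inter> pinf -` (U - {om}))"
    proof -
      have "continuous_map (top_of_set (Dinf - {0})) (top_of_set curve) pinf"
        using pinf_cont pinf_in by auto
      then have "openin (top_of_set (Dinf - {0})) {s \<in> topspace (top_of_set (Dinf - {0})). pinf s \<in> U - {om}}"
        using Uo unfolding continuous_map by blast
      moreover have "{s \<in> topspace (top_of_set (Dinf - {0})). pinf s \<in> U - {om}} = (Dinf - {0}) \<inter> pinf -` (U - {om})"
        by auto
      ultimately show ?thesis using openin_open_trans D0 by metis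
    qed
    have "open {s \<in> Dinf. pinf s \<in> U}"
    proof (cases "om \<in> U")
      case False
      then have "{s \<in> Dinf. pinf s \<in> U} = (Dinf - {0}) \<inter> pinf -` (U - {om})"
        by (auto simp: pinf_def split: if_splits)
      then show ?thesis using 1 by simp
    next
      case True
      then have "compact (curve - U)" using U openin_X by blast
      then have "compact (fst ` (curve - U))" by (intro compact_continuous_image continuous_intros)
      then obtain B where B: "\<And>p. p \<in> curve - U \<Longrightarrow> norm (fst p) \<le> B" "B > 0"
        using compact_imp_bounded bounded_pos by (metis imageI)
      \<comment> \<open>For \<open>s\<close> in \<open>N\<close> other than 0, the point
        \<open>pinf s\<close> lies over the outside of the disc of radius \<open>B\<close>, beyond
        everything that \<open>U\<close> misses.\<close>
      define N where "N = {s \<in> Dinf. norm s ^ m < 1 / B}"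
      have Nop: "open N" unfolding N_def using open_Dinf
        by (auto intro!: open_Collect_conj open_Collect_less continuous_intros)
      have NU: "pinf s \<in> U" if s: "s \<in> N" for s
      proof (cases "s = 0")
        case False
        have "pinf s \<in> curve" using pinf_in[of s] False s by (auto simp: N_def)
        moreover have "norm (fst (pinf s)) > B"
          using s False B(2) by (simp add: N_def pinf_def norm_divide norm_power field_simps)
        ultimately show ?thesis using B(1) by force
      qed (use True in \<open>auto simp: pinf_def\<close>)
      have zN: "0 \<in> N" using rho_ge_1 B m_pos by (simp add: N_def Dinf_def zero_power)
      have om_N: "s \<in> N" if "s \<in> Dinf" "pinf s = om" for s
        using pinf_in[OF that(1)] that(2) over_neq_om zN by metis
      have "N \<subseteq> Dinf" by (auto simp: N_def)
      then have "N \<union> ((Dinf - {0}) \<inter> pinf -` (U - {om})) \<subseteq> {s \<in> Dinf. pinf s \<in> U}" using NU by blast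
      moreover have "s \<in> N \<union> ((Dinf - {0}) \<inter> pinf -` (U - {om}))" if "s \<in> Dinf" "pinf s \<in> U" for s
        using that om_N zN by (cases "pinf s = om"; cases "s = 0") simp_all
      ultimately have "{s \<in> Dinf. pinf s \<in> U} = N \<union> ((Dinf - {0}) \<inter> pinf -` (U - {om}))" by blast
      then show ?thesis using open_Un[OF Nop 1] by simp
    qed
    moreover have "{s \<in> topspace (top_of_set Dinf). pinf s \<in> U} = {s \<in> Dinf. pinf s \<in> U}" by simp
    ultimately show "openin (top_of_set Dinf) {s \<in> topspace (top_of_set Dinf). pinf s \<in> U}"
      by (simp add: open_subset)
  qed
qed

end

section \<open>The holomorphic atlas\<close>

context cyclic_curve begin

lemma zeta_mult_pow [simp]: "(\<zeta> * w) ^ m = w ^ m"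
  by (simp add: power_mult_distrib)

text \<open>Contains \<open>u\<close> whenever \<open>a\<close> is the root nearest to \<open>u\<close>.\<close>

definition Kset :: "complex \<Rightarrow> complex set" where
  "Kset a = (\<Inter>b\<in>R - {a}. {u. (b - a) \<bullet> u < (b - a) \<bullet> b})"

lemma Kset_convex: "convex (Kset a)"
  unfolding Kset_def by (intro convex_INT convex_halfspace_lt)

lemma Kset_open: "open (Kset a)"
  unfolding Kset_def using finR by (intro open_INT) (auto simp: open_halfspace_lt)

lemma Kset_root: "a \<in> R \<Longrightarrow> R \<inter> Kset a = {a}"
proof -
  assume a: "a \<in> R"
  have "(b - a) \<bullet> a < (b - a) \<bullet> b" if "b \<noteq> a" for b
  proof -
    have "0 < (b - a) \<bullet> (b - a)" using that by simp
    then show ?thesis by (simp add: inner_diff_right)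
  qed
  then show ?thesis using a by (auto simp: Kset_def)
qed

lemma Kset_cover: obtains a where "a \<in> R" "u \<in> Kset a"
proof -
  obtain a where a: "a \<in> R" "\<And>b. b \<in> R \<Longrightarrow> dist u a \<le> dist u b"
  proof -
    have "Min (dist u ` R) \<in> dist u ` R" using finR R_nonempty by (intro Min_in) auto
    then obtain a where "a \<in> R" "dist u a = Min (dist u ` R)" by auto
    then show ?thesis using finR that by simp
  qed
  have "(b - a) \<bullet> u < (b - a) \<bullet> b" if b: "b \<in> R - {a}" for b
  proof -
    have "(u - a) \<bullet> (u - a) \<le> (u - b) \<bullet> (u - b)"
      using a(2)[of b] b by (simp add: dist_norm norm_le)
    moreover have "(u - b) \<bullet> (u - b) = (u - a) \<bullet> (u - a) - 2 * ((b - a) \<bullet> u - (b - a) \<bullet> b) - (b - a) \<bullet> (b - a)"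
      by (simp add: inner_diff_left inner_diff_right inner_commute algebra_simps)
    moreover have "0 < (b - a) \<bullet> (b - a)" using b by simp
    moreover have "x < y" if "A \<le> B" "B = A - 2 * (x - y) - D" "0 < D" for A B x y D :: real
      using that by simp
    ultimately show ?thesis by blast
  qed
  then have "u \<in> Kset a" by (auto simp: Kset_def)
  then show ?thesis using a that by blast
qed

section \<open>Charts indexed by the branch points\<close>

definition hroot :: "complex \<Rightarrow> complex \<Rightarrow> complex" where
  "hroot a = (SOME h. h holomorphic_on Kset a \<and> (\<forall>z\<in>Kset a. Q z = (z - a) * exp (h z)))"

lemma hroot:
  assumes "a \<in> R"
  shows "hroot a holomorphic_on Kset a" "\<And>z. z \<in> Kset a \<Longrightarrow> Q z = (z - a) * exp (hroot a z)"
proof -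
  have "\<exists>h. h holomorphic_on Kset a \<and> (\<forall>z\<in>Kset a. Q z = (z - a) * exp (h z))"
    using Q_log_root[OF Kset_convex Kset_open Kset_root[OF assms]] by metis
  from someI_ex[OF this] show "hroot a holomorphic_on Kset a" "\<And>z. z \<in> Kset a \<Longrightarrow> Q z = (z - a) * exp (hroot a z)"
    unfolding hroot_def by auto
qed

text \<open>\<open>None\<close> stands for infinity and \<open>Some a\<close> for the root
  \<open>a\<close>. One chart for each branch point covers the surface, as the sets
  \<open>Kset a\<close> cover the plane.\<close>

definition I :: "complex option set" where "I = insert None (Some ` R)"

fun cU :: "complex option \<Rightarrow> (complex \<times> complex) set" where
  "cU None = Vinf" | "cU (Some a) = over (Kset a)"

fun cD :: "complex option \<Rightarrow> complex set" where
  "cD None = Dinf" | "cD (Some a) = {s. a + s ^ m \<in> Kset a}"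

fun cc :: "complex option \<Rightarrow> complex \<times> complex \<Rightarrow> complex" where
  "cc None = cinf" | "cc (Some a) = coord (hroot a)"

fun cp :: "complex option \<Rightarrow> complex \<Rightarrow> complex \<times> complex" where
  "cp None = pinf" | "cp (Some a) = param (hroot a) a"

definition atlas :: "(complex \<times> complex) chart set" where
  "atlas = (\<lambda>i. (cU i, cc i)) ` I"

lemma I_cases: assumes "i \<in> I" obtains "i = None" | a where "a \<in> R" "i = Some a"
  using assms by (auto simp: I_def)

lemma openin_cU: "i \<in> I \<Longrightarrow> openin X (cU i)"
  by (erule I_cases) (auto simp: openin_Vinf openin_X_over Kset_open)

lemma open_cD: "i \<in> I \<Longrightarrow> open (cD i)"
proof (erule I_cases)
  fix a assume "i = Some a"
  moreover have "open ((\<lambda>s. a + s ^ m) -` Kset a)"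
    by (intro open_vimage Kset_open continuous_intros)
  ultimately show "open (cD i)" by (simp add: vimage_def)
qed (simp add: open_Dinf)

lemma cU_subset: "i \<in> I \<Longrightarrow> cU i \<subseteq> pts"
  using openin_cU openin_subset by fastforce

lemma chart_maps:
  assumes "i \<in> I" shows "homeomorphic_maps (subtopology X (cU i)) (top_of_set (cD i)) (cc i) (cp i)"
  using assms
proof (cases rule: I_cases)
  case 1 then show ?thesis using homeomorphic_Vinf by simp
next
  case (2 a)
  have "homeomorphism (over (Kset a)) {s. a + s ^ m \<in> Kset a} (coord (hroot a)) (param (hroot a) a)"
    using coord_param(1)[OF hroot[OF 2(1)]] .
  then show ?thesis using 2 Kset_open by (auto simp: subtopology_X_over homeomorphic_maps_def homeomorphism_def)
qed

lemma cc_in: "\<lbrakk>i \<in> I; p \<in> cU i\<rbrakk> \<Longrightarrow> cc i p \<in> cD i"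
  and cp_in: "\<lbrakk>i \<in> I; s \<in> cD i\<rbrakk> \<Longrightarrow> cp i s \<in> cU i"
  and cp_cc: "\<lbrakk>i \<in> I; p \<in> cU i\<rbrakk> \<Longrightarrow> cp i (cc i p) = p"
  and cc_cp: "\<lbrakk>i \<in> I; s \<in> cD i\<rbrakk> \<Longrightarrow> cc i (cp i s) = s"
  using chart_maps[of i] cU_subset[of i]
  by (auto simp: homeomorphic_maps_def continuous_map_def Int_absorb1 Pi_iff)

lemma inv_into_cc: "\<lbrakk>i \<in> I; s \<in> cD i\<rbrakk> \<Longrightarrow> inv_into (cU i) (cc i) s = cp i s"
  by (metis cc_cp cp_cc cp_in inj_on_inverseI inv_into_f_eq)

lemma cc_image: "i \<in> I \<Longrightarrow> cc i ` cU i = cD i"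
proof
  assume i: "i \<in> I"
  show "cc i ` cU i \<subseteq> cD i" using cc_in[OF i] by blast
  show "cD i \<subseteq> cc i ` cU i"
  proof
    fix s assume "s \<in> cD i"
    then show "s \<in> cc i ` cU i" using cp_in[OF i] cc_cp[OF i] by (metis imageI)
  qed
qed

lemma cU_cover: assumes "p \<in> pts" obtains i where "i \<in> I" "p \<in> cU i"
proof (cases "p = om")
  case True then show ?thesis using that[of None] by (simp add: I_def Vinf_def)
next
  case False
  then have "p \<in> curve" using assms by (auto simp: pts_def)
  then show ?thesis using Kset_cover[of "fst p"] that[of "Some _"] by (auto simp: I_def)
qed

text \<open>Every chart is centred at its ramification point and contains no other.\<close>

lemma cp_nonzero:
  assumes "i \<in> I" "s \<in> cD i" "s \<noteq> 0" shows "cp i s \<in> over (- R)"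
  using assms(1)
proof (cases rule: I_cases)
  case 1
  then have "cp i s \<in> over {z. norm z > \<rho>}" using pinf_in assms by simp
  then show ?thesis using norm_root_lt by force
next
  case (2 a)
  have "cp i s \<in> over (Kset a)" using cp_in assms 2 by force
  moreover have "fst (cp i s) \<noteq> a" using assms 2 by (simp add: param_def)
  ultimately show ?thesis using Kset_root[OF 2(1)] by auto
qed

lemma cp_holo_fst: "i \<in> I \<Longrightarrow> (\<lambda>s. fst (cp i s)) holomorphic_on cD i - {0}"
proof (erule I_cases)
  assume i: "i = None"
  have "(\<lambda>s. 1 / s ^ m) holomorphic_on cD i - {0}" by (intro holomorphic_intros) auto
  then show ?thesis by (rule holomorphic_transform) (simp add: i pinf_def)
next
  fix a assume "a \<in> R" "i = Some a"
  then show ?thesis by (auto simp: param_def intro!: holomorphic_intros)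
qed

lemma cp_holo_snd: "i \<in> I \<Longrightarrow> (\<lambda>s. snd (cp i s)) holomorphic_on cD i - {0}"
proof (erule I_cases)
  assume i: "i = None"
  have "(\<lambda>s. s ^ m) holomorphic_on cD i - {0}" by (intro holomorphic_intros)
  moreover have "(\<lambda>s. s ^ m) ` (cD i - {0}) \<subseteq> ball 0 (1 / \<rho>)" using Dinf_pow i by auto
  ultimately have "(\<lambda>s. kinf (s ^ m)) holomorphic_on cD i - {0}"
    using holomorphic_on_compose_gen[OF _ kinf(1)] by (auto simp: o_def)
  then have "(\<lambda>s. s * (1 / s ^ m) ^ e * exp (kinf (s ^ m) / m)) holomorphic_on cD i - {0}"
    using m_pos by (intro holomorphic_intros) auto
  then show ?thesis by (rule holomorphic_transform) (simp add: i pinf_def)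
next
  fix a assume a: "a \<in> R" and i: "i = Some a"
  have "(\<lambda>s. a + s ^ m) holomorphic_on cD i - {0}" by (intro holomorphic_intros)
  moreover have "(\<lambda>s. a + s ^ m) ` (cD i - {0}) \<subseteq> Kset a" using i by auto
  ultimately have "(\<lambda>s. hroot a (a + s ^ m)) holomorphic_on cD i - {0}"
    using holomorphic_on_compose_gen[OF _ hroot(1)[OF a]] by (auto simp: o_def)
  then have "(\<lambda>s. s * exp (hroot a (a + s ^ m) / m)) holomorphic_on cD i - {0}"
    using m_pos by (intro holomorphic_intros) auto
  then show ?thesis by (rule holomorphic_transform) (simp add: i param_def)
qed

lemmas cp_holo = cp_holo_fst cp_holo_snd

lemma cc_holo:
  assumes "i \<in> I" and D: "open D" and u: "u holomorphic_on D" and v: "v holomorphic_on D"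
    and mem: "\<And>s. s \<in> D \<Longrightarrow> (u s, v s) \<in> cU i" "\<And>s. s \<in> D \<Longrightarrow> (u s, v s) \<in> curve"
  shows "(\<lambda>s. cc i (u s, v s)) holomorphic_on D"
  using assms(1)
proof (cases rule: I_cases)
  case 1
  have ne: "(u s, v s) \<noteq> om" if "s \<in> D" for s using over_neq_om[OF mem(2)[OF that]] .
  have uD: "norm (u s) > \<rho>" if "s \<in> D" for s
    using mem(1)[OF that] 1 ne[OF that] by (simp add: Vinf_def)
  have nz: "u s \<noteq> 0" if "s \<in> D" for s using uD[OF that] rho_ge_1 by auto
  have "(\<lambda>s. 1 / u s) holomorphic_on D" using nz u by (intro holomorphic_intros)
  moreover have "(\<lambda>s. 1 / u s) ` D \<subseteq> ball 0 (1 / \<rho>)"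
    using uD rho_ge_1 by (auto simp: norm_divide divide_simps)
  ultimately have "(\<lambda>s. kinf (1 / u s)) holomorphic_on D"
    using holomorphic_on_compose_gen[OF _ kinf(1)] by (auto simp: o_def)
  then have "(\<lambda>s. v s * exp (- kinf (1 / u s) / m) / u s ^ e) holomorphic_on D"
    using nz u v m_pos by (intro holomorphic_intros) auto
  then show ?thesis by (rule holomorphic_transform) (use 1 ne in \<open>simp add: cinf_def\<close>)
next
  case (2 a)
  have "u ` D \<subseteq> Kset a" using mem 2 by auto
  then have "(\<lambda>s. hroot a (u s)) holomorphic_on D"
    using holomorphic_on_compose_gen[OF u hroot(1)[OF 2(1)]] by (simp add: o_def)
  then show ?thesis unfolding 2 using v m_pos by (simp add: coord_def) (intro holomorphic_intros, auto)
qed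

lemma cc_holo_cnj:
  assumes "i \<in> I" and D: "open D" and u: "u holomorphic_on D" and v: "v holomorphic_on D"
    and mem: "\<And>s. s \<in> D \<Longrightarrow> (cnj (u s), cnj (v s)) \<in> cU i" "\<And>s. s \<in> D \<Longrightarrow> (cnj (u s), cnj (v s)) \<in> curve"
  shows "(\<lambda>s. cnj (cc i (cnj (u s), cnj (v s)))) holomorphic_on D"
proof -
  have oD: "open (cnj ` D)" 
  proof -
    have "cnj ` D = cnj -` D" by (auto simp: image_iff) (metis complex_cnj_cnj)
    then show ?thesis using open_vimage[OF D, of cnj] by (simp add: continuous_on_cnj continuous_on_id)
  qed
  have "(\<lambda>s. cnj (u (cnj s))) holomorphic_on cnj ` D" "(\<lambda>s. cnj (v (cnj s))) holomorphic_on cnj ` D"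
    using holomorphic_on_compose_cnj_cnj[of u "cnj ` D"] holomorphic_on_compose_cnj_cnj[of v "cnj ` D"] u v oD
    by (simp_all add: o_def image_image)
  then have "(\<lambda>s. cc i (cnj (u (cnj s)), cnj (v (cnj s)))) holomorphic_on cnj ` D"
    using mem by (intro cc_holo[OF assms(1) oD]) auto
  then show ?thesis
    using holomorphic_on_compose_cnj_cnj[of "\<lambda>s. cc i (cnj (u (cnj s)), cnj (v (cnj s)))" D] D
    by (simp add: o_def)
qed

section \<open>Maps of the surface read in charts\<close>

lemma finite_pow_eq: "finite {s::complex. s ^ m = c}"
proof (cases "c = 0")
  case True then show ?thesis using m_pos by simp
next
  case False then show ?thesis using finite_nth_roots[OF m_pos] by simp
qed

lemma finite_cp_fiber:
  assumes "i \<in> I" "finite E" shows "finite {s \<in> cD i. s = 0 \<or> fst (cp i s) \<in> E}"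
  using assms(1)
proof (cases rule: I_cases)
  case 1
  have "{s \<in> cD i. s = 0 \<or> fst (cp i s) \<in> E} \<subseteq> insert 0 (\<Union>z\<in>E. {s. s ^ m = 1 / z})"
    unfolding 1 by (auto simp: pinf_def)
  then show ?thesis by (rule finite_subset) (use assms(2) finite_pow_eq in simp)
next
  case (2 a)
  have "{s \<in> cD i. s = 0 \<or> fst (cp i s) \<in> E} \<subseteq> insert 0 (\<Union>z\<in>E. {s. s ^ m = z - a})"
    unfolding 2 by (auto simp: param_def)
  then show ?thesis by (rule finite_subset) (use assms(2) finite_pow_eq in simp)
qed

lemma chart_domain_open:
  assumes F: "continuous_map X X F" and i: "i \<in> I" and j: "j \<in> I"
  shows "open {s \<in> cD i. F (cp i s) \<in> cU j}" (is ?A)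
    "cc i ` {p \<in> cU i. F p \<in> cU j} = {s \<in> cD i. F (cp i s) \<in> cU j}" (is ?B)
    "continuous_on {s \<in> cD i. F (cp i s) \<in> cU j} (\<lambda>s. cc j (F (cp i s)))" (is ?C)
proof -
  let ?W = "{s \<in> cD i. F (cp i s) \<in> cU j}"
  have cpc: "continuous_map (top_of_set (cD i)) X (cp i)"
    using chart_maps[OF i] by (auto simp: homeomorphic_maps_def continuous_map_in_subtopology)
  have Fc: "continuous_map (top_of_set (cD i)) X (\<lambda>s. F (cp i s))"
    using continuous_map_compose[OF cpc F] by (simp add: o_def)
  then have "openin (top_of_set (cD i)) ?W"
    using openin_cU[OF j] unfolding continuous_map_def by simp
  then show A: ?A using openin_open_trans open_cD[OF i] by blast
  show ?B
  proof
    show "cc i ` {p \<in> cU i. F p \<in> cU j} \<subseteq> ?W" using cc_in[OF i] cp_cc[OF i] by auto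
    show "?W \<subseteq> cc i ` {p \<in> cU i. F p \<in> cU j}"
    proof
      fix s assume s: "s \<in> ?W"
      then have "cp i s \<in> {p \<in> cU i. F p \<in> cU j}" "cc i (cp i s) = s" using cp_in[OF i] cc_cp[OF i] by auto
      then show "s \<in> cc i ` {p \<in> cU i. F p \<in> cU j}" by (metis imageI)
    qed
  qed
  have "continuous_map (top_of_set ?W) (subtopology X (cU j)) (\<lambda>s. F (cp i s))"
  proof -
    have "continuous_map (subtopology (top_of_set (cD i)) ?W) X (\<lambda>s. F (cp i s))"
      using Fc by (rule continuous_map_from_subtopology)
    moreover have "subtopology (top_of_set (cD i)) ?W = top_of_set ?W"
      by (auto simp: subtopology_subtopology intro!: arg_cong2[where f=subtopology])
    ultimately show ?thesis by (auto simp: continuous_map_in_subtopology)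
  qed
  moreover have "continuous_map (subtopology X (cU j)) euclidean (cc j)"
    using chart_maps[OF j] by (auto simp: homeomorphic_maps_def continuous_map_in_subtopology)
  ultimately have "continuous_map (top_of_set ?W) euclidean (\<lambda>s. cc j (F (cp i s)))"
    using continuous_map_compose by (fastforce simp: o_def)
  then show ?C by simp
qed

text \<open>A continuous map that is holomorphic in generic affine coordinates is holomorphic in all charts,
  isolated singularities of continuous functions being removable; \<open>\<kappa>\<close> treats the conformal and the
  anticonformal case together.\<close>

lemma chart_map_holo:
  assumes F: "continuous_map X X F" and i: "i \<in> I" and j: "j \<in> I"
    and E: "finite E" and \<kappa>: "\<kappa> = id \<or> \<kappa> = cnj"
    and FE: "\<And>p. p \<in> over (- E) \<Longrightarrow> F p \<in> curve"
    and H: "\<And>u v D. \<lbrakk>open D; u holomorphic_on D; v holomorphic_on D; \<And>s. s \<in> D \<Longrightarrow> (u s, v s) \<in> over (- E)\<rbrakk>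
       \<Longrightarrow> (\<lambda>s. \<kappa> (fst (F (u s, v s)))) holomorphic_on D \<and> (\<lambda>s. \<kappa> (snd (F (u s, v s)))) holomorphic_on D"
  shows "(\<kappa> \<circ> cc j \<circ> F \<circ> inv_into (cU i) (cc i)) holomorphic_on cc i ` {p \<in> cU i. F p \<in> cU j}"
proof -
  let ?W = "{s \<in> cD i. F (cp i s) \<in> cU j}"
  let ?E = "{s \<in> cD i. s = 0 \<or> fst (cp i s) \<in> E}"
  note W = chart_domain_open[OF F i j]
  have fE: "finite ?E" using finite_cp_fiber[OF i E] .
  have oD: "open (?W - ?E)" using W(1) fE by (simp add: finite_imp_closed open_Diff)
  define u where "u s = fst (cp i s)" for s
  define v where "v s = snd (cp i s)" for s
  have uv: "u holomorphic_on ?W - ?E" "v holomorphic_on ?W - ?E"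
    unfolding u_def v_def using cp_holo[OF i] by (auto elim!: holomorphic_on_subset)
  have cpuv: "cp i s = (u s, v s)" for s by (simp add: u_def v_def)
  have mem: "(u s, v s) \<in> over (- E)" if "s \<in> ?W - ?E" for s
    using that cp_nonzero[OF i, of s] unfolding cpuv[symmetric] by auto
  have "(\<lambda>s. \<kappa> (fst (F (u s, v s)))) holomorphic_on ?W - ?E \<and> (\<lambda>s. \<kappa> (snd (F (u s, v s)))) holomorphic_on ?W - ?E"
    by (rule H[OF oD uv]) (rule mem)
  then have FF: "(\<lambda>s. \<kappa> (fst (F (cp i s)))) holomorphic_on ?W - ?E" "(\<lambda>s. \<kappa> (snd (F (cp i s)))) holomorphic_on ?W - ?E"
    by (simp_all only: cpuv[symmetric])
  have in_c: "F (cp i s) \<in> curve" "F (cp i s) \<in> cU j" if "s \<in> ?W - ?E" for s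
    using FE[OF mem[OF that]] that unfolding cpuv[symmetric] by auto
  have "(\<lambda>s. \<kappa> (cc j (F (cp i s)))) holomorphic_on ?W - ?E"
    using \<kappa>
  proof
    assume k: "\<kappa> = id"
    have "(\<lambda>s. cc j (fst (F (cp i s)), snd (F (cp i s)))) holomorphic_on ?W - ?E"
    proof (rule cc_holo[OF j oD])
      show "(\<lambda>s. fst (F (cp i s))) holomorphic_on ?W - ?E" "(\<lambda>s. snd (F (cp i s))) holomorphic_on ?W - ?E"
        using FF unfolding k id_apply by blast+
    qed (simp_all only: prod.collapse in_c)
    then show ?thesis by (simp only: prod.collapse k id_apply)
  next
    assume k: "\<kappa> = cnj"
    have "(\<lambda>s. cnj (cc j (cnj (cnj (fst (F (cp i s)))), cnj (cnj (snd (F (cp i s))))))) holomorphic_on ?W - ?E"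
    proof (rule cc_holo_cnj[OF j oD])
      show "(\<lambda>s. cnj (fst (F (cp i s)))) holomorphic_on ?W - ?E" "(\<lambda>s. cnj (snd (F (cp i s)))) holomorphic_on ?W - ?E"
        using FF unfolding k by blast+
    qed (simp_all only: complex_cnj_cnj prod.collapse in_c)
    then show ?thesis by (simp only: prod.collapse complex_cnj_cnj k)
  qed
  moreover have "continuous_on ?W (\<lambda>s. \<kappa> (cc j (F (cp i s))))"
    using \<kappa> W(3) by (auto intro: continuous_on_cnj)
  ultimately have "(\<lambda>s. \<kappa> (cc j (F (cp i s)))) holomorphic_on ?W"
    using no_isolated_singularity W(1) fE by blast
  then show ?thesis unfolding W(2)
    by (rule holomorphic_transform) (simp add: inv_into_cc[OF i])
qed

end

section \<open>The genus\<close>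

context cyclic_curve begin

lemma path_connected_curve: "path_connected curve"
  and homology_curve: "homology_group 1 (top_of_set curve) \<cong> free_Abelian_group {..<(m * e - 2) * (m - 1)}"
  and no_fixed_curve: "\<And>c. \<lbrakk>c \<in> carrier (homology_group 1 (top_of_set curve));
       hom_induced 1 (top_of_set curve) {} (top_of_set curve) {} rot c = c\<rbrakk>
       \<Longrightarrow> c = \<one>\<^bsub>homology_group 1 (top_of_set curve)\<^esub>"
proof -
  \<comment> \<open>The number of roots is \<open>m * e - 1\<close>, and the first of them
    contributes no homology; this explains the 2 in \<open>m * e - 2\<close>.\<close>
  have "card (R \<inter> UNIV) = Suc (m * e - 2)" using cardR me_pos by simp
  note * = over_homology[OF convex_UNIV open_UNIV this]
  show "path_connected curve" "homology_group 1 (top_of_set curve) \<cong> free_Abelian_group {..<(m * e - 2) * (m - 1)}"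
    using * by auto
  show "\<And>c. \<lbrakk>c \<in> carrier (homology_group 1 (top_of_set curve));
       hom_induced 1 (top_of_set curve) {} (top_of_set curve) {} rot c = c\<rbrakk>
       \<Longrightarrow> c = \<one>\<^bsub>homology_group 1 (top_of_set curve)\<^esub>" using * by blast
qed

section \<open>Attaching the point at infinity\<close>

lemma Dinf_ball: "starlike Dinf" "0 \<in> Dinf"
proof -
  show 0: "0 \<in> Dinf" using rho_ge_1 m_pos by (simp add: Dinf_def zero_power)
  have "{s. 0 + s ^ m \<in> ball 0 (1 / \<rho>)} = Dinf" using Dinf_pow by auto
  then show "starlike Dinf" using starlike_disc[of "ball 0 (1 / \<rho>)" 0] rho_ge_1 by auto
qed

lemma contractible_Vinf: "contractible_space (subtopology X Vinf)"
proof -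
  have "subtopology X Vinf homeomorphic_space top_of_set Dinf"
    using homeomorphic_Vinf homeomorphic_space_def by blast
  then show ?thesis
    using homeomorphic_space_contractibility starlike_imp_contractible[OF Dinf_ball(1)] by fastforce
qed

lemma Vinf_Int: "curve \<inter> Vinf = over {z. norm z > \<rho>}"
  using over_neq_om by (auto simp: Vinf_def)

lemma subtopology_curve [simp]: "subtopology X curve = top_of_set curve"
  by (rule subtopology_X_over) simp

lemma punctured_maps: "homeomorphism (over {z. norm z > \<rho>}) (Dinf - {0}) cinf pinf"
proof -
  have "cinf p \<in> Dinf - {0}" if p: "p \<in> over {z. norm z > \<rho>}" for p
    using cinf_in[of p] cinf_pow[OF p] p m_pos by (auto simp: Vinf_def zero_power)
  moreover have "pinf (cinf p) = p" if "p \<in> over {z. norm z > \<rho>}" for p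
    using pinf_cinf[of p] that by (auto simp: Vinf_def)
  ultimately show ?thesis
    unfolding homeomorphism_def using cinf_cont pinf_cont cinf_pinf pinf_in
    by (auto simp del: mem_over simp: image_iff) (metis DiffI pinf_in singletonD)+
qed

lemma open_cover_infinity: "open_cover_pair X curve Vinf"
proof
  show "openin X curve" by (rule openin_X_over) simp
  show "curve \<union> Vinf = topspace X" by (auto simp: Vinf_def pts_def)
  show "curve \<inter> Vinf \<noteq> {}"
  proof -
    have "of_real (\<rho> + 1) \<in> {z::complex. norm z > \<rho>}" using rho_ge_1 by (simp del: of_real_add)
    then have "{z::complex. norm z > \<rho>} \<noteq> {}" by blast
    then show ?thesis unfolding Vinf_Int by (rule over_nonempty)
  qed
qed (simp_all add: openin_Vinf contractible_Vinf)

definition rotX :: "complex \<times> complex \<Rightarrow> complex \<times> complex" where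
  "rotX p = (if p = om then om else rot p)"

lemma rotX_curve: "p \<in> curve \<Longrightarrow> rotX p = rot p"
  using over_neq_om by (auto simp: rotX_def)

text \<open>As \<open>F\<close> keeps \<open>z\<close>, the points sent into a compact part of the
  curve lie over a bounded set. This gives continuity at \<open>om\<close>.\<close>

lemma continuous_X_extend:
  assumes "continuous_on curve F" "F ` curve \<subseteq> curve" "F' om = om" "\<And>p. p \<in> curve \<Longrightarrow> F' p = F p"
    and "\<And>p. p \<in> curve \<Longrightarrow> fst (F p) = fst p"
  shows "continuous_map X X F'"
  unfolding continuous_map_def topspace_X
proof (intro conjI allI impI)
  show "F' \<in> pts \<rightarrow> pts" using assms by (auto simp: pts_def)
  fix U assume U: "openin X U"
  then have Uo: "openin (top_of_set curve) (U - {om})" using openin_X by blast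
  let ?P = "{p \<in> pts. F' p \<in> U}"
  have Pc: "?P - {om} = {p \<in> curve. F p \<in> U - {om}}"
  proof -
    have "F p \<noteq> om" if "p \<in> curve" for p using assms(2) that over_neq_om by blast
    then have "p \<in> ?P - {om} \<longleftrightarrow> p \<in> {p \<in> curve. F p \<in> U - {om}}" for p
      by (cases "p = om"; cases "p \<in> curve") (simp_all add: pts_def assms(4) del: mem_over)
    then show ?thesis by blast
  qed
  have "continuous_map (top_of_set curve) (top_of_set curve) F" using assms(1,2) by (auto simp del: mem_over)
  then have o: "openin (top_of_set curve) (?P - {om})"
    using Uo unfolding Pc continuous_map_def topspace_euclidean_subtopology by blast
  show "openin X ?P" unfolding openin_X
  proof (intro conjI impI)
    assume "om \<in> ?P"
    then have "compact (curve - U)" using U assms(3) openin_X by auto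
    then have "compact (fst ` (curve - U))" by (intro compact_continuous_image continuous_intros)
    then obtain B where B: "\<And>p. p \<in> curve - U \<Longrightarrow> norm (fst p) \<le> B"
      using compact_imp_bounded bounded_iff by (metis imageI)
    have "curve - ?P \<subseteq> over (cball 0 B)"
    proof
      fix p assume p: "p \<in> curve - ?P"
      then have "p \<in> curve" "F' p \<notin> U" by (auto simp: pts_def simp del: mem_over)
      then have "F p \<in> curve - U" using assms(2) assms(4)[of p] by (auto simp del: mem_over)
      then have "norm (fst (F p)) \<le> B" by (rule B)
      then show "p \<in> over (cball 0 B)" using p assms(5)[of p] by simp
    qed
    then have eq: "curve - ?P = over (cball 0 B) \<inter> (curve - ?P)" by blast
    have "closed (curve - ?P)"
    proof -
      have "curve - ?P = curve - (?P - {om})" using over_neq_om by blast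
      moreover have "closedin (top_of_set curve) (curve - (?P - {om}))"
        using o by (simp add: closedin_diff)
      ultimately show ?thesis using closed_over[OF closed_UNIV] closedin_closed_trans by metis
    qed
    then show "compact (curve - ?P)"
      by (subst eq) (intro compact_Int_closed compact_over compact_cball)
  qed (use o in auto)
qed

lemma rotX_cont: "continuous_map X X rotX"
  by (rule continuous_X_extend[of rot]) (auto simp: rot_cont rotX_curve rotX_def power_mult_distrib)

lemma cinf_rot: "p \<in> curve \<Longrightarrow> cinf (rot p) = \<zeta> * cinf p"
proof -
  assume p: "p \<in> curve"
  then have "rot p \<in> curve" by simp
  then show ?thesis using over_neq_om[OF p] over_neq_om[of "rot p" UNIV] by (simp add: cinf_def)
qed

text \<open>In the coordinate at infinity the rotation is multiplication by \<zeta>. The homotopy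
  turns the angle back to 0 within the punctured disc.\<close>

lemma rot_homotopic_id:
  "homotopic_with (\<lambda>h. True) (top_of_set (over {z. norm z > \<rho>})) (top_of_set (over {z. norm z > \<rho>})) rot id"
proof -
  let ?S = "over {z. norm z > \<rho>}"
  define h where "h t p = pinf (cis (2 * pi * (1 - t) / m) * cinf p)" for t p
  note hom = homeomorphism_image1[OF punctured_maps] homeomorphism_image2[OF punctured_maps]
    homeomorphism_apply1[OF punctured_maps]
  have c: "cis \<theta> * cinf p \<in> Dinf - {0}" if "p \<in> ?S" for p \<theta>
  proof -
    have "cinf p \<in> Dinf - {0}" using hom(1) that by blast
    then show ?thesis by (simp add: Dinf_def norm_mult)
  qed
  have "continuous_on ({0..1} \<times> ?S) (\<lambda>x. cis (2 * pi * (1 - fst x) / m) * cinf (snd x))"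
  proof (intro continuous_intros)
    show "continuous_on ({0..1::real} \<times> ?S) (\<lambda>x. cinf (snd x))"
      by (rule continuous_on_compose2[OF cinf_cont]) (auto intro!: continuous_intros)
  qed (use m_pos in auto)
  then have "continuous_on ({0..1} \<times> ?S) (\<lambda>x. h (fst x) (snd x))"
    unfolding h_def by (rule continuous_on_compose2[OF pinf_cont]) (use c in auto)
  moreover have "h t p \<in> ?S" if "p \<in> ?S" for t p
    unfolding h_def using c[OF that] hom(2) by blast
  moreover have "h 0 p = rot p" if p: "p \<in> ?S" for p
  proof -
    have "rot p \<in> ?S" using p by simp
    moreover have "p \<in> curve" using p by simp
    ultimately show ?thesis using cinf_rot[of p] hom(3)[of "rot p"] by (simp add: h_def \<zeta>_def del: mem_over)
  qed
  moreover have "h 1 p = p" if "p \<in> ?S" for p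
    using that hom(3)[of p] by (simp add: h_def del: mem_over)
  ultimately have "homotopic_with_canon (\<lambda>h. True) ?S ?S rot id"
    by (subst homotopic_with) (auto simp del: mem_over intro!: exI[of _ "\<lambda>x. h (fst x) (snd x)"])
  then show ?thesis .
qed

theorem has_genus_X: "2 * g = (m * e - 2) * (m - 1) \<Longrightarrow> has_genus X g"
proof -
  assume g: "2 * g = (m * e - 2) * (m - 1)"
  interpret open_cover_pair X curve Vinf by (rule open_cover_infinity)
  have sub: "subtopology X (curve \<inter> Vinf) = top_of_set (over {z. norm z > \<rho>})"
    unfolding Vinf_Int by (rule subtopology_X_over[OF open_outside])
  have "path_connected (Dinf - {0})"
    using path_connected_open_delete[OF open_Dinf starlike_imp_connected[OF Dinf_ball(1)]] by simp
  then have pc: "path_connected (over {z. norm z > \<rho>})"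
    using punctured_maps homeomorphic_path_connectedness homeomorphic_def by blast
  have fixd: "hom_induced 1 (top_of_set (over {z. norm z > \<rho>})) {} (top_of_set (over {z. norm z > \<rho>})) {} rotX c = c"
    if c: "c \<in> carrier (homology_group 1 (top_of_set (over {z. norm z > \<rho>})))" for c
  proof -
    have "hom_induced 1 (top_of_set (over {z. norm z > \<rho>})) {} (top_of_set (over {z. norm z > \<rho>})) {} rotX =
       hom_induced 1 (top_of_set (over {z. norm z > \<rho>})) {} (top_of_set (over {z. norm z > \<rho>})) {} rot"
      by (rule hom_induced_eq) (auto simp: rotX_curve)
    also have "\<dots> = hom_induced 1 (top_of_set (over {z. norm z > \<rho>})) {} (top_of_set (over {z. norm z > \<rho>})) {} id"
      by (rule homology_homotopy_empty[OF rot_homotopic_id])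
    finally show ?thesis using hom_induced_id[OF c] by simp
  qed
  have req: "hom_induced 1 (top_of_set curve) {} (top_of_set curve) {} rotX = hom_induced 1 (top_of_set curve) {} (top_of_set curve) {} rot"
    by (rule hom_induced_eq) (auto simp: rotX_curve)
  have "homology_group 1 (subtopology X curve) \<cong> homology_group 1 X"
  proof (rule homology_group_1_unchanged[of rotX])
    show "rotX \<in> curve \<rightarrow> curve" by (auto simp: rotX_curve power_mult_distrib)
    show "rotX \<in> Vinf \<rightarrow> Vinf" using over_neq_om by (auto simp: rotX_def Vinf_def power_mult_distrib)
    show "path_connected_space (subtopology X (curve \<inter> Vinf))" unfolding sub using pc by simp
  qed (use rotX_cont no_fixed_curve fixd req sub in auto)
  then have "homology_group 1 X \<cong> free_Abelian_group {..<2 * g}"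
    using homology_curve g by (metis group.iso_sym group_relative_homology_group iso_trans subtopology_curve)
  then show ?thesis by (simp add: has_genus_def)
qed

theorem closed_riemann_surface_X: "closed_riemann_surface X atlas"
  unfolding closed_riemann_surface_def
proof (intro conjI compact_X Hausdorff_X)
  show "topspace X \<noteq> {}" by (simp add: pts_def)
  interpret open_cover_pair X curve Vinf by (rule open_cover_infinity)
  have "connectedin X curve"
    using path_connected_curve path_connected_imp_connected_space[of "top_of_set curve"]
    by (auto simp: connectedin_def pts_def)
  moreover have "connectedin X Vinf"
    using contractible_Vinf contractible_imp_connected_space subsets by (simp add: connectedin_def)
  ultimately have "connectedin X (curve \<union> Vinf)" using connectedin_Un meet by blast
  then show "connected_space X" by (metis connectedin_topspace cover)
  show "holomorphic_atlas X atlas"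
    unfolding holomorphic_atlas_def
  proof (intro conjI)
    show "\<forall>c\<in>atlas. complex_chart X c"
    proof
      fix c assume "c \<in> atlas"
      then obtain i where i: "i \<in> I" "c = (cU i, cc i)" by (auto simp: atlas_def)
      have "homeomorphic_map (subtopology X (cU i)) (top_of_set (cD i)) (cc i)"
        using chart_maps[OF i(1)] homeomorphic_map_maps by blast
      then show "complex_chart X c"
        using i openin_cU open_cD cc_image by (simp add: complex_chart_def)
    qed
    have "(\<Union>(U, \<phi>)\<in>atlas. U) = (\<Union>i\<in>I. cU i)" by (auto simp: atlas_def)
    also have "\<dots> = topspace X" using cU_subset cU_cover by (auto simp del: cU.simps) (metis cU_cover)
    finally show "(\<Union>(U, \<phi>)\<in>atlas. U) = topspace X" .
    have "(cc j \<circ> inv_into (cU i) (cc i)) holomorphic_on cc i ` (cU i \<inter> cU j)" if ij: "i \<in> I" "j \<in> I" for i j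
    proof -
      \<comment> \<open>A transition map is the identity of the surface read in two charts.\<close>
      have "(id \<circ> cc j \<circ> id \<circ> inv_into (cU i) (cc i)) holomorphic_on cc i ` {p \<in> cU i. id p \<in> cU j}"
        by (rule chart_map_holo[OF _ ij, where E=R]) (use finR in auto)
      moreover have "{p \<in> cU i. id p \<in> cU j} = cU i \<inter> cU j" by auto
      ultimately show ?thesis by simp
    qed
    then show "\<forall>(U, \<phi>)\<in>atlas. \<forall>(V, \<psi>)\<in>atlas. (\<psi> \<circ> inv_into U \<phi>) holomorphic_on \<phi> ` (U \<inter> V)"
      by (auto simp: atlas_def)
  qed
qed

end

section \<open>Conformal automorphisms\<close>

lemma holomorphic_extend_finite:
  assumes "finite E" "H holomorphic_on - E" "\<And>c. c \<in> E \<Longrightarrow> ((\<lambda>z. (z - c) * H z) \<longlongrightarrow> 0) (at c)"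
  obtains g where "g holomorphic_on UNIV" "\<And>z. z \<notin> E \<Longrightarrow> g z = H z"
proof -
  have "\<exists>g. g holomorphic_on UNIV \<and> (\<forall>z. z \<notin> E \<longrightarrow> g z = H z)"
    using assms
  proof (induction E arbitrary: H rule: finite_induct)
    case empty then show ?case by auto
  next
    case (insert c E)
    have S: "- insert c E = - E - {c}" by auto
    have op: "open (- E)" using insert.hyps(1) by (simp add: finite_imp_closed open_Compl)
    then have "c \<in> interior (- E)" using insert.hyps by (simp add: interior_open)
    moreover have "H holomorphic_on (- E - {c})" using insert.prems(1) S by simp
    ultimately obtain g where g: "g holomorphic_on - E" "\<And>z. z \<in> - E - {c} \<Longrightarrow> g z = H z"
      using holomorphic_on_extend_lim insert.prems(2)[of c] by blast
    have "((\<lambda>z. (z - c') * g z) \<longlongrightarrow> 0) (at c')" if c': "c' \<in> E" for c'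
    proof -
      have "eventually (\<lambda>z. z \<in> - (insert c (E - {c'}))) (nhds c')"
        using insert.hyps c' by (intro eventually_nhds_in_open open_Compl finite_imp_closed) auto
      then have "eventually (\<lambda>z. (z - c') * H z = (z - c') * g z) (at c')"
        unfolding eventually_at_filter by eventually_elim (use g(2) in auto)
      then show ?thesis using insert.prems(2)[of c'] c' by (auto elim: Lim_transform_eventually)
    qed
    then obtain g' where "g' holomorphic_on UNIV" "\<forall>z. z \<notin> E \<longrightarrow> g' z = g z"
      using insert.IH[OF g(1)] by blast
    then show ?case using g(2) by (intro exI[of _ g']) auto
  qed
  then show ?thesis using that by blast
qed

lemma tendsto_zero_power_norm:
  fixes f :: "'a \<Rightarrow> complex"
  assumes "((\<lambda>x. norm (f x) ^ m) \<longlongrightarrow> 0) F" "m > 0"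
  shows "(f \<longlongrightarrow> 0) F"
proof -
  have "((\<lambda>x. root m (norm (f x) ^ m)) \<longlongrightarrow> root m 0) F"
    by (rule tendsto_real_root[OF assms(1)])
  then show ?thesis using assms(2) by (simp add: real_root_power_cancel tendsto_norm_zero_iff)
qed

text \<open>The bound makes \<open>H\<close> locally bounded at the exceptional points, hence entire
  after extension. An entire function of linear growth is a polynomial of degree at most 1.\<close>

lemma affine_of_linear_growth:
  assumes "finite E" "H holomorphic_on - E" "\<And>z. z \<notin> E \<Longrightarrow> norm (H z) \<le> C * (1 + norm z)"
  obtains \<alpha> \<beta> where "\<And>z. z \<notin> E \<Longrightarrow> H z = \<alpha> * z + \<beta>"
proof -
  have "((\<lambda>z. (z - c) * H z) \<longlongrightarrow> 0) (at c)" if c: "c \<in> E" for c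
  proof (rule Lim_null_comparison)
    have "eventually (\<lambda>z. z \<in> - (E - {c})) (nhds c)"
      using assms(1) by (intro eventually_nhds_in_open open_Compl finite_imp_closed) auto
    then show "eventually (\<lambda>z. norm ((z - c) * H z) \<le> norm (z - c) * (C * (1 + norm z))) (at c)"
      unfolding eventually_at_filter
      by eventually_elim (use assms(3) in \<open>auto simp: norm_mult intro!: mult_left_mono\<close>)
    have "((\<lambda>z. norm (z - c) * (C * (1 + norm z))) \<longlongrightarrow> norm (c - c) * (C * (1 + norm c))) (at c)"
      by (intro tendsto_intros)
    then show "((\<lambda>z. norm (z - c) * (C * (1 + norm z))) \<longlongrightarrow> 0) (at c)" by simp
  qed
  then obtain g where g: "g holomorphic_on UNIV" "\<And>z. z \<notin> E \<Longrightarrow> g z = H z"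
    using holomorphic_extend_finite[OF assms(1,2)] by blast
  obtain B where B: "\<And>z. z \<in> E \<Longrightarrow> norm z \<le> B"
    using finite_imp_bounded[OF assms(1)] bounded_iff by blast
  have "norm (g z) \<le> (2 * C) * norm z ^ 1" if z: "max 1 (B + 1) \<le> norm z" for z
  proof -
    have "z \<notin> E" using B[of z] z by auto
    then have le: "norm (g z) \<le> C * (1 + norm z)" using g(2) assms(3) by simp
    have "0 < 1 + norm z" by (simp add: add_pos_nonneg)
    then have "C \<ge> 0" using order_trans[OF norm_ge_zero le] by (metis mult_less_0_iff not_less)
    then have "C * (1 + norm z) \<le> C * (2 * norm z)" using z by (intro mult_left_mono) auto
    then show ?thesis using le by simp
  qed
  then have eq: "g z = (\<Sum>k\<le>1. (deriv^^k) g 0 / fact k * z ^ k)" for z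
    by (rule Liouville_polynomial[OF g(1)])
  have "(\<Sum>k\<le>1. (deriv^^k) g 0 / fact k * z ^ k) = deriv g 0 * z + g 0" for z by simp
  then have "g z = deriv g 0 * z + g 0" for z by (rule HOL.trans[OF eq])
  then show ?thesis using g(2) that[of "deriv g 0" "g 0"] by (metis (no_types))
qed

context cyclic_curve begin

text \<open>All roots of \<open>Q\<close> are simple, so it vanishes at most to first order at any
  point.\<close>

lemma Q_lower_local:
  obtains \<delta> where "\<delta> > 0" "eventually (\<lambda>z. norm (Q z) \<ge> \<delta> * norm (z - c)) (at c)"
proof -
  define P where "P z = (\<Prod>a\<in>R - {c}. z - a)" for z
  have P0: "P c \<noteq> 0" using finR by (auto simp: P_def)
  have "isCont P c" unfolding P_def by (intro continuous_intros)
  then have "((\<lambda>z. norm (P z)) \<longlongrightarrow> norm (P c)) (at c)" by (intro tendsto_norm) (simp add: isCont_def)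
  then have ev: "eventually (\<lambda>z. norm (P z) > norm (P c) / 2) (at c)"
    by (rule order_tendstoD) (use P0 in simp)
  have ev1: "eventually (\<lambda>z. norm (z - c) < 1) (at c)"
    by (auto simp: eventually_at dist_norm intro: exI[of _ 1])
  have "eventually (\<lambda>z. norm (Q z) \<ge> (norm (P c) / 2) * norm (z - c)) (at c)"
    using ev ev1
  proof eventually_elim
    case (elim z)
    show ?case
    proof (cases "c \<in> R")
      case True
      then have "Q z = (z - c) * P z" using finR by (simp add: Q_def P_def prod.remove)
      then have "norm (Q z) = norm (P z) * norm (z - c)" by (simp add: norm_mult)
      moreover have "(norm (P c) / 2) * norm (z - c) \<le> norm (P z) * norm (z - c)"
        using elim by (intro mult_right_mono) auto
      ultimately show ?thesis by simp
    next
      case False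
      then have "Q z = P z" by (simp add: Q_def P_def)
      moreover have "(norm (P c) / 2) * norm (z - c) \<le> (norm (P c) / 2) * 1"
        using elim by (intro mult_left_mono) auto
      ultimately show ?thesis using elim by simp
    qed
  qed
  then show ?thesis using that[of "norm (P c) / 2"] P0 by simp
qed

lemma Q_lower_infinity:
  assumes "norm z \<ge> 2 * \<rho>" shows "norm (Q z) \<ge> (norm z / 2) ^ card R"
proof -
  have "norm z / 2 \<le> norm (z - a)" if "a \<in> R" for a
    using norm_root_lt[OF that] assms norm_triangle_ineq2[of z a] by simp
  then have "(\<Prod>a\<in>R. norm z / 2) \<le> (\<Prod>a\<in>R. norm (z - a))" by (intro prod_mono) auto
  then show ?thesis by (simp add: Q_def prod_norm)
qed

text \<open>Here \<open>H\<close> plays the role of the coefficient of \<open>w ^ k\<close>. At a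
  point \<open>c\<close> the m-th power of its norm grows at most like \<open>norm (z - c)\<close>
  to the power \<open>- k\<close>; since \<open>k < m\<close> the singularity is removable. At
  infinity that power is bounded by \<open>norm z\<close> to the power
  \<open>m * t - k * card R\<close>, which is negative, so \<open>H\<close> tends to 0 and Liouville
  applies.\<close>

lemma vanishing:
  assumes E: "finite E" and H: "H holomorphic_on - E"
    and bd: "\<And>z. z \<notin> E \<Longrightarrow> norm (H z) ^ m * norm (Q z) ^ k \<le> C * (1 + norm z) ^ (m * t)"
    and k: "k < m" "m * t < k * card R" and z: "z \<notin> E"
  shows "H z = 0"
proof -
  have "((\<lambda>z. (z - c) * H z) \<longlongrightarrow> 0) (at c)" if c: "c \<in> E" for c
  proof -
    obtain \<delta> where \<delta>: "\<delta> > 0" "eventually (\<lambda>z. norm (Q z) \<ge> \<delta> * norm (z - c)) (at c)"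
      using Q_lower_local .
    have ev: "eventually (\<lambda>z. z \<in> - (E - {c})) (nhds c)"
      using E by (intro eventually_nhds_in_open open_Compl finite_imp_closed) auto
    have "((\<lambda>z. norm ((z - c) * H z) ^ m) \<longlongrightarrow> 0) (at c)"
    proof (rule Lim_null_comparison)
      have "eventually (\<lambda>z. z \<noteq> c \<and> z \<notin> E) (at c)"
        using ev unfolding eventually_at_filter by eventually_elim auto
      with \<delta>(2) show "eventually (\<lambda>z. norm (norm ((z - c) * H z) ^ m) \<le> norm (z - c) ^ (m - k) * (C / \<delta> ^ k * (1 + norm z) ^ (m * t))) (at c)"
      proof eventually_elim
        case (elim z)
        have pos: "norm (z - c) > 0" using elim by simp
        have "(\<delta> * norm (z - c)) ^ k \<le> norm (Q z) ^ k" using elim \<delta> by (intro power_mono) auto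
        then have "norm (H z) ^ m * (\<delta> * norm (z - c)) ^ k \<le> norm (H z) ^ m * norm (Q z) ^ k"
          by (rule mult_left_mono) simp
        also have "\<dots> \<le> C * (1 + norm z) ^ (m * t)" using elim by (intro bd) simp
        finally have "norm (H z) ^ m * (\<delta> * norm (z - c)) ^ k \<le> C * (1 + norm z) ^ (m * t)" .
        then have 1: "norm (H z) ^ m * norm (z - c) ^ k \<le> C / \<delta> ^ k * (1 + norm z) ^ (m * t)"
          using \<delta>(1) by (simp add: power_mult_distrib field_simps)
        have "norm ((z - c) * H z) ^ m = norm (z - c) ^ (m - k) * (norm (H z) ^ m * norm (z - c) ^ k)"
          using k(1) by (simp add: norm_mult power_mult_distrib mult_ac flip: power_add)
        also have "\<dots> \<le> norm (z - c) ^ (m - k) * (C / \<delta> ^ k * (1 + norm z) ^ (m * t))"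
          using 1 by (intro mult_left_mono) auto
        finally show ?case by simp
      qed
      have "((\<lambda>z. norm (z - c) ^ (m - k) * (C / \<delta> ^ k * (1 + norm z) ^ (m * t)))
         \<longlongrightarrow> norm (c - c) ^ (m - k) * (C / \<delta> ^ k * (1 + norm c) ^ (m * t))) (at c)"
        by (intro tendsto_intros)
      then show "((\<lambda>z. norm (z - c) ^ (m - k) * (C / \<delta> ^ k * (1 + norm z) ^ (m * t))) \<longlongrightarrow> 0) (at c)"
        using k(1) by (simp add: zero_power)
    qed
    then show ?thesis by (rule tendsto_zero_power_norm[OF _ m_pos])
  qed
  then obtain g where g: "g holomorphic_on UNIV" "\<And>z. z \<notin> E \<Longrightarrow> g z = H z"
    using holomorphic_extend_finite[OF E H] by blast
  obtain B where B: "\<And>z. z \<in> E \<Longrightarrow> norm z \<le> B"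
    using finite_imp_bounded[OF E] bounded_iff by blast
  \<comment> \<open>The factor \<open>2 ^ (m * t)\<close> pays for replacing
    \<open>1 + norm z\<close> by \<open>2 * norm z\<close>, the other one for the lower bound
    \<open>norm z / 2\<close> on each factor of \<open>Q\<close>.\<close>
  define K where "K = C * 2 ^ (m * t) * 2 ^ (k * card R)"
  have "((\<lambda>z. norm (g z) ^ m) \<longlongrightarrow> 0) at_infinity"
  proof (rule Lim_null_comparison)
    show "eventually (\<lambda>z. norm (norm (g z) ^ m) \<le> K / norm z) at_infinity"
      unfolding eventually_at_infinity
    proof (intro exI allI impI)
      fix z :: complex assume z: "max (2 * \<rho>) (B + 1) \<le> norm z"
      have zE: "z \<notin> E" using B[of z] z by auto
      have z1: "norm z \<ge> 1" using z rho_ge_1 by simp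
      have "((norm z / 2) ^ card R) ^ k \<le> norm (Q z) ^ k"
        using Q_lower_infinity[of z] z by (intro power_mono) auto
      then have "norm (H z) ^ m * ((norm z / 2) ^ card R) ^ k \<le> norm (H z) ^ m * norm (Q z) ^ k"
        by (rule mult_left_mono) simp
      also note bd[OF zE]
      finally have "norm (H z) ^ m * ((norm z / 2) ^ card R) ^ k \<le> C * (1 + norm z) ^ (m * t)" .
      moreover have "((norm z / 2) ^ card R) ^ k = norm z ^ (k * card R) / 2 ^ (k * card R)"
        by (simp add: power_divide mult.commute[of k] power_mult)
      ultimately have "norm (H z) ^ m * (norm z ^ (k * card R) / 2 ^ (k * card R)) \<le> C * (1 + norm z) ^ (m * t)"
        by simp
      then have "norm (H z) ^ m * norm z ^ (k * card R) \<le> C * (1 + norm z) ^ (m * t) * 2 ^ (k * card R)"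
        by (simp add: pos_divide_le_eq)
      also have "\<dots> \<le> C * (2 * norm z) ^ (m * t) * 2 ^ (k * card R)"
      proof -
        have "0 \<le> C * (1 + norm z) ^ (m * t)" by (rule order_trans[OF _ bd[OF zE]]) simp
        moreover have "0 < (1 + norm z) ^ (m * t)" by (intro zero_less_power) (simp add: add_pos_nonneg)
        ultimately have "C \<ge> 0" by (metis mult_less_0_iff not_less)
        then show ?thesis using z1 by (intro mult_right_mono mult_left_mono power_mono) auto
      qed
      also have "\<dots> = K * norm z ^ (m * t)" by (simp add: K_def power_mult_distrib)
      finally have "norm (H z) ^ m * norm z ^ (k * card R) \<le> K * norm z ^ (m * t)" .
      \<comment> \<open>The strict inequality between the exponents leaves one spare factor
        \<open>norm z\<close>, which forces the decay.\<close>
      moreover have "norm z ^ (m * t) * norm z \<le> norm z ^ (k * card R)"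
        using power_increasing[of "Suc (m * t)" "k * card R" "norm z"] k(2) z1 by (simp add: mult.commute)
      then have "norm (H z) ^ m * (norm z ^ (m * t) * norm z) \<le> norm (H z) ^ m * norm z ^ (k * card R)"
        by (intro mult_left_mono) auto
      ultimately have "(norm (H z) ^ m * norm z) * norm z ^ (m * t) \<le> K * norm z ^ (m * t)" by (simp add: mult_ac)
      moreover have "0 < norm z ^ (m * t)" using z1 by (intro zero_less_power) linarith
      ultimately have "norm (H z) ^ m * norm z \<le> K" by (simp only: mult_le_cancel_right_pos)
      moreover have "0 < norm z" using z1 by linarith
      ultimately have "norm (H z) ^ m \<le> K / norm z" by (simp only: pos_le_divide_eq)
      then show "norm (norm (g z) ^ m) \<le> K / norm z" using g(2)[OF zE] by simp
    qed
    have "((\<lambda>z. K * inverse (norm z)) \<longlongrightarrow> K * 0) at_infinity"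
      by (intro tendsto_intros tendsto_inverse_0_at_top filterlim_norm_at_top)
    then show "((\<lambda>z::complex. K / norm z) \<longlongrightarrow> 0) at_infinity" by (simp add: field_simps)
  qed
  then have "(g \<longlongrightarrow> 0) at_infinity" by (rule tendsto_zero_power_norm[OF _ m_pos])
  then have "g z = 0" using Liouville_weak_0 g(1) by blast
  then show ?thesis using g(2) z by simp
qed

end

section \<open>The pole of the first coordinate of a conformal automorphism\<close>

locale curve_automorphism = cyclic_curve +
  fixes \<phi> assumes conf: "conformal_automorphism X atlas \<phi>"
begin

lemma bij: "bij_betw \<phi> pts pts"
  and ext: "\<phi> \<in> extensional pts"
  and homeo: "homeomorphic_map X X \<phi>"
  and cont: "continuous_map X X \<phi>"
  using conf homeomorphic_imp_continuous_map by (auto simp: conformal_automorphism_def Bij_def)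

lemma phi_pts: "q \<in> pts \<Longrightarrow> \<phi> q \<in> pts" using bij bij_betwE by blast
lemma phi_inj: "\<lbrakk>q \<in> pts; q' \<in> pts; \<phi> q = \<phi> q'\<rbrakk> \<Longrightarrow> q = q'" using bij by (auto simp: bij_betw_def inj_on_def)

lemma curve_pts: "q \<in> curve \<Longrightarrow> q \<in> pts" by (simp add: pts_def)
lemma pts_cases: "q \<in> pts \<Longrightarrow> q \<noteq> om \<Longrightarrow> q \<in> curve" by (simp add: pts_def)

text \<open>The only place where \<open>fst \<circ> \<phi>\<close> can have a pole.\<close>

definition p where "p = inv_into pts \<phi> om"

lemma p_pts: "p \<in> pts" and phi_p: "\<phi> p = om"
proof -
  have "om \<in> \<phi> ` pts" using bij by (simp add: bij_betw_def pts_def)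
  then show "p \<in> pts" "\<phi> p = om" unfolding p_def by (auto simp: inv_into_into f_inv_into_f)
qed

lemma phi_curve: "\<lbrakk>q \<in> pts; q \<noteq> p\<rbrakk> \<Longrightarrow> \<phi> q \<in> curve"
  using phi_pts phi_inj p_pts phi_p pts_cases by metis

lemma chart_holo:
  assumes i: "i \<in> I" and j: "j \<in> I"
  shows "(\<lambda>s. cc j (\<phi> (cp i s))) holomorphic_on {s \<in> cD i. \<phi> (cp i s) \<in> cU j}"
proof -
  have "(cU i, cc i) \<in> atlas" "(cU j, cc j) \<in> atlas" using i j by (auto simp: atlas_def)
  then have "(cc j \<circ> \<phi> \<circ> inv_into (cU i) (cc i)) holomorphic_on cc i ` {p \<in> cU i. \<phi> p \<in> cU j}"
    using conf unfolding conformal_automorphism_def by blast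
  then show ?thesis
    unfolding chart_domain_open(2)[OF cont i j]
    by (rule holomorphic_transform) (simp add: inv_into_cc[OF i])
qed

lemma section_cont:
  assumes "continuous_on D u" "continuous_on D v" "\<And>s. s \<in> D \<Longrightarrow> (u s, v s) \<in> curve"
  shows "continuous_map (top_of_set D) X (\<lambda>s. (u s, v s))"
proof -
  have "continuous_on D (\<lambda>s. (u s, v s))" using assms by (intro continuous_on_Pair)
  then have "continuous_map (top_of_set D) (subtopology X curve) (\<lambda>s. (u s, v s))"
    using assms(3) by (auto simp del: mem_over)
  then show ?thesis by (simp add: continuous_map_in_subtopology del: subtopology_curve)
qed

lemma fst_coord: "\<lbrakk>a \<in> R; q \<in> over (Kset a)\<rbrakk> \<Longrightarrow> fst q = a + cc (Some a) q ^ m"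
  using coord_param(2)[OF hroot] by simp

lemma fst_phi_holo:
  assumes D: "open D" and u: "u holomorphic_on D" and v: "v holomorphic_on D"
    and mem: "\<And>s. s \<in> D \<Longrightarrow> (u s, v s) \<in> curve" and ne: "\<And>s. s \<in> D \<Longrightarrow> (u s, v s) \<noteq> p"
  shows "(\<lambda>s. fst (\<phi> (u s, v s))) holomorphic_on D"
proof -
  let ?q = "\<lambda>s. (u s, v s)"
  have qc: "continuous_map (top_of_set D) X ?q"
    using u v mem by (intro section_cont holomorphic_on_imp_continuous_on)
  have pc: "continuous_map (top_of_set D) X (\<lambda>s. \<phi> (?q s))"
    using continuous_map_compose[OF qc cont] by (simp add: o_def)
  have in_c: "\<phi> (?q s) \<in> curve" if "s \<in> D" for s using phi_curve curve_pts mem ne that by blast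
  have "\<exists>T. open T \<and> s0 \<in> T \<and> T \<subseteq> D \<and> (\<lambda>s. fst (\<phi> (?q s))) holomorphic_on T" if s0: "s0 \<in> D" for s0
  proof -
    obtain a where a: "a \<in> R" "fst (?q s0) \<in> Kset a" using Kset_cover .
    obtain b where b: "b \<in> R" "fst (\<phi> (?q s0)) \<in> Kset b" using Kset_cover .
    define i where "i = Some a"
    define j where "j = Some b"
    have ij: "i \<in> I" "j \<in> I" using a b by (auto simp: I_def i_def j_def)
    define T where "T = {s \<in> D. ?q s \<in> cU i \<and> \<phi> (?q s) \<in> cU j}"
    have "openin (top_of_set D) {s \<in> topspace (top_of_set D). ?q s \<in> cU i}"
      using qc openin_cU[OF ij(1)] unfolding continuous_map_def by blast
    moreover have "openin (top_of_set D) {s \<in> topspace (top_of_set D). \<phi> (?q s) \<in> cU j}"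
      using pc openin_cU[OF ij(2)] unfolding continuous_map_def by blast
    ultimately have "openin (top_of_set D) ({s \<in> topspace (top_of_set D). ?q s \<in> cU i} \<inter> {s \<in> topspace (top_of_set D). \<phi> (?q s) \<in> cU j})"
      by (rule openin_Int)
    moreover have "{s \<in> topspace (top_of_set D). ?q s \<in> cU i} \<inter> {s \<in> topspace (top_of_set D). \<phi> (?q s) \<in> cU j} = T"
      by (auto simp: T_def)
    ultimately have oT: "open T" using openin_open_trans D by metis
    have s0T: "s0 \<in> T" using s0 mem[OF s0] in_c[OF s0] a b by (simp add: T_def i_def j_def)
    have TD: "T \<subseteq> D" by (auto simp: T_def)
    have c1: "(\<lambda>s. cc i (?q s)) holomorphic_on T"
      using TD mem by (intro cc_holo[OF ij(1) oT] holomorphic_on_subset[OF u] holomorphic_on_subset[OF v]) (auto simp: T_def simp del: mem_over cU.simps)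
    have "(\<lambda>s. cc i (?q s)) ` T \<subseteq> {s \<in> cD i. \<phi> (cp i s) \<in> cU j}"
      using cc_in[OF ij(1)] cp_cc[OF ij(1)] by (auto simp: T_def simp del: cU.simps cD.simps cc.simps cp.simps)
    then have "(\<lambda>s. cc j (\<phi> (cp i (cc i (?q s))))) holomorphic_on T"
      using holomorphic_on_compose_gen[OF c1 chart_holo[OF ij]] by (simp add: o_def)
    then have "(\<lambda>s. b + cc j (\<phi> (cp i (cc i (?q s)))) ^ m) holomorphic_on T"
      by (intro holomorphic_intros)
    moreover have "b + cc j (\<phi> (cp i (cc i (?q s)))) ^ m = fst (\<phi> (?q s))" if "s \<in> T" for s
    proof -
      have "cp i (cc i (?q s)) = ?q s" using cp_cc[OF ij(1)] that by (simp add: T_def del: cU.simps cc.simps cp.simps)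
      moreover have "\<phi> (?q s) \<in> over (Kset b)" using that by (simp add: T_def j_def)
      ultimately show ?thesis using fst_coord[OF b(1)] by (metis j_def)
    qed
    ultimately have "(\<lambda>s. fst (\<phi> (?q s))) holomorphic_on T" by (rule holomorphic_transform)
    then show ?thesis using oT s0T TD by blast
  qed
  then have "(\<lambda>s. fst (\<phi> (?q s))) field_differentiable at s0 within D" if "s0 \<in> D" for s0
    using holomorphic_on_imp_differentiable_at field_differentiable_at_within that by blast
  then show ?thesis by (simp add: holomorphic_on_def)
qed

text \<open>Read in charts, \<phi> is injective and holomorphic, so its derivative does not vanish
  and \<open>cinf \<circ> \<phi>\<close> has a simple zero at \<open>p\<close>. As the m-th power of
  \<open>cinf\<close> is \<open>1 / z\<close>, the first coordinate of \<phi> has a pole of order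
  \<open>m\<close> in the local coordinate.\<close>

lemma local_pole:
  assumes i: "i \<in> I" "p \<in> cU i"
  obtains N C where "openin X N" "p \<in> N" "N \<subseteq> cU i" "\<And>q. q \<in> N \<Longrightarrow> norm (cc i q - cc i p) < 1"
    "\<And>q. \<lbrakk>q \<in> N; q \<noteq> p\<rbrakk> \<Longrightarrow> norm (fst (\<phi> q)) * norm (cc i q - cc i p) ^ m \<le> C"
proof -
  have N0: "None \<in> I" by (simp add: I_def)
  let ?W = "{s \<in> cD i. \<phi> (cp i s) \<in> Vinf}"
  define g where "g s = cinf (\<phi> (cp i s))" for s
  define c0 where "c0 = cc i p"
  have W: "open ?W" using chart_domain_open(1)[OF cont i(1) N0] by simp
  have g: "g holomorphic_on ?W" using chart_holo[OF i(1) N0] by (simp add: g_def[abs_def])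
  have c0: "c0 \<in> ?W" "g c0 = 0"
    using cc_in[OF i] cp_cc[OF i] phi_p by (auto simp: c0_def g_def Vinf_def cinf_def)
  have "inj_on g ?W"
  proof (rule inj_onI)
    fix s s' assume s: "s \<in> ?W" "s' \<in> ?W" "g s = g s'"
    then have "\<phi> (cp i s) = \<phi> (cp i s')" unfolding g_def using pinf_cinf by (metis (mono_tags, lifting) mem_Collect_eq)
    then have "cp i s = cp i s'" using s phi_inj cp_in[OF i(1)] cU_subset[OF i(1)] by blast
    then show "s = s'" using cc_cp[OF i(1)] s by (metis (mono_tags, lifting) mem_Collect_eq)
  qed
  then have d: "deriv g c0 \<noteq> 0" using holomorphic_injective_imp_regular[OF g W] c0 by blast
  have "(g has_field_derivative deriv g c0) (at c0)" using holomorphic_derivI[OF g W c0(1)] by simp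
  then have "((\<lambda>s. (g s - g c0) / (s - c0)) \<longlongrightarrow> deriv g c0) (at c0)" by (simp add: has_field_derivative_iff)
  then have "((\<lambda>s. norm ((g s - g c0) / (s - c0))) \<longlongrightarrow> norm (deriv g c0)) (at c0)" by (rule tendsto_norm)
  then have "eventually (\<lambda>s. norm ((g s - g c0) / (s - c0)) > norm (deriv g c0) / 2) (at c0)"
    by (rule order_tendstoD) (use d in simp)
  moreover have "eventually (\<lambda>s. s \<in> ?W) (at c0)" using eventually_at_topological W c0(1) by blast
  ultimately have "eventually (\<lambda>s. norm ((g s - g c0) / (s - c0)) > norm (deriv g c0) / 2 \<and> s \<in> ?W) (at c0)"
    by (rule eventually_conj)
  then obtain r where r: "r > 0" "\<And>s. \<lbrakk>s \<noteq> c0; dist s c0 < r\<rbrakk> \<Longrightarrow> norm ((g s - g c0) / (s - c0)) > norm (deriv g c0) / 2 \<and> s \<in> ?W"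
    unfolding eventually_at by auto
  \<comment> \<open>The cap 1 provides the range in which differences of m-th powers are later
    estimated by \<open>norm_power_diff_local\<close>.\<close>
  define \<epsilon> where "\<epsilon> = min r 1"
  define \<delta> where "\<delta> = norm (deriv g c0) / 2"
  have \<delta>: "\<delta> > 0" using d by (simp add: \<delta>_def)
  define N where "N = {q \<in> cU i. cc i q \<in> ball c0 \<epsilon>}"
  show ?thesis
  proof (rule that[of N "1 / \<delta> ^ m"])
    have "continuous_map (subtopology X (cU i)) euclidean (cc i)"
      using chart_maps[OF i(1)] by (auto simp: homeomorphic_maps_def continuous_map_in_subtopology)
    then have "openin (subtopology X (cU i)) {q \<in> topspace (subtopology X (cU i)). cc i q \<in> ball c0 \<epsilon>}"
      by (rule openin_continuous_map_preimage) simp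
    moreover have "topspace (subtopology X (cU i)) = cU i" using cU_subset[OF i(1)] by auto
    ultimately have "openin (subtopology X (cU i)) {q \<in> cU i. cc i q \<in> ball c0 \<epsilon>}" by metis
    then show "openin X N"
      unfolding openin_open_subtopology[OF openin_cU[OF i(1)]] N_def by metis
    show "p \<in> N" using i r by (simp add: N_def c0_def \<epsilon>_def)
    show "N \<subseteq> cU i" by (auto simp: N_def)
    show "norm (cc i q - cc i p) < 1" if "q \<in> N" for q
      using that by (auto simp: N_def c0_def \<epsilon>_def dist_norm norm_minus_commute)
    fix q assume q: "q \<in> N" "q \<noteq> p"
    let ?s = "cc i q"
    have qU: "q \<in> cU i" using q by (simp add: N_def)
    have sc: "?s \<noteq> c0" using cp_cc[OF i(1)] qU i(2) q(2) unfolding c0_def by metis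
    have ds: "dist ?s c0 < r" using q(1) by (simp add: N_def \<epsilon>_def dist_commute)
    have b: "\<delta> < norm (g ?s) / norm (?s - c0)" "?s \<in> ?W"
      using r(2)[OF sc ds] c0(2) by (auto simp: \<delta>_def norm_divide)
    then have lo: "\<delta> * norm (?s - c0) \<le> norm (g ?s)" using sc by (simp add: field_simps)
    have "\<phi> q \<in> Vinf" using b(2) cp_cc[OF i(1) qU] by simp
    moreover have "q \<in> pts" using qU cU_subset[OF i(1)] by blast
    then have "\<phi> q \<noteq> om" using phi_inj p_pts phi_p q(2) by metis
    ultimately have "\<phi> q \<in> over {z. norm z > \<rho>}" by (simp add: Vinf_def)
    from cinf_pow[OF this] have e: "g ?s ^ m = 1 / fst (\<phi> q)" "fst (\<phi> q) \<noteq> 0"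
      using cp_cc[OF i(1) qU] by (auto simp: g_def)
    have "(\<delta> * norm (?s - c0)) ^ m \<le> norm (g ?s) ^ m" using lo \<delta> by (intro power_mono) auto
    also have "\<dots> = 1 / norm (fst (\<phi> q))" using e(1) by (metis norm_divide norm_one norm_power)
    finally have "\<delta> ^ m * norm (?s - c0) ^ m \<le> 1 / norm (fst (\<phi> q))" by (simp add: power_mult_distrib)
    moreover have "0 < norm (fst (\<phi> q))" using e(2) by simp
    ultimately show "norm (fst (\<phi> q)) * norm (?s - cc i p) ^ m \<le> 1 / \<delta> ^ m"
      using \<delta> by (simp add: c0_def field_simps)
  qed
qed

text \<open>Off \<open>N\<close> the surface is compact, and its image under \<phi> is a compact
  subset of the affine curve.\<close>

lemma bounded_off:
  assumes N: "openin X N" "p \<in> N"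
  obtains B where "\<And>q. \<lbrakk>q \<in> pts; q \<notin> N\<rbrakk> \<Longrightarrow> norm (fst (\<phi> q)) \<le> B"
proof -
  have "compactin X (pts - N)"
    using N(1) compact_X closedin_compact_space by (metis closedin_diff closedin_topspace topspace_X)
  then have "compactin X (\<phi> ` (pts - N))" using image_compactin cont by blast
  moreover have sub: "\<phi> ` (pts - N) \<subseteq> curve" using phi_curve N(2) by blast
  ultimately have "compactin (subtopology X curve) (\<phi> ` (pts - N))" by (simp add: compactin_subtopology del: subtopology_curve)
  then have "compact (\<phi> ` (pts - N))" by (simp add: compactin_subtopology)
  then have "compact (fst ` (\<phi> ` (pts - N)))"
    by (rule compact_continuous_image[rotated]) (intro continuous_intros)
  then have "bounded (fst ` (\<phi> ` (pts - N)))" by (rule compact_imp_bounded)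
  then obtain B where "\<forall>x \<in> fst ` (\<phi> ` (pts - N)). norm x \<le> B" unfolding bounded_iff by blast
  then show ?thesis using that by auto
qed

end

lemma norm_power_diff_local:
  fixes c :: complex
  obtains M where "M \<ge> 0" "\<And>s. norm (s - c) < 1 \<Longrightarrow> norm (s ^ m - c ^ m) \<le> M * norm (s - c)"
proof -
  define S where "S s = (\<Sum>i<m. c ^ (m - Suc i) * s ^ i)" for s
  have "continuous_on (cball c 1) S" unfolding S_def by (intro continuous_intros)
  then have "bounded (S ` cball c 1)"
    using compact_continuous_image compact_imp_bounded compact_cball by blast
  then obtain M where M: "\<forall>x\<in>S ` cball c 1. norm x \<le> M" unfolding bounded_iff by blast
  have "norm (s ^ m - c ^ m) \<le> M * norm (s - c)" if "norm (s - c) < 1" for s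
  proof -
    have "s \<in> cball c 1" using that by (simp add: dist_norm norm_minus_commute)
    then have "norm (S s) \<le> M" using M by blast
    moreover have "s ^ m - c ^ m = (s - c) * S s" unfolding S_def by (rule power_diff_sumr2)
    ultimately show ?thesis by (simp add: norm_mult mult.commute mult_right_mono)
  qed
  moreover have "norm (S c) \<le> M" using M by auto
  then have "M \<ge> 0" using norm_ge_zero order_trans by blast
  ultimately show ?thesis using that by blast
qed

context curve_automorphism begin

text \<open>\<open>W\<close> clears the pole of \<open>fst \<circ> \<phi>\<close> at \<open>p\<close>, at the cost of growth of order \<open>t\<close> at infinity.\<close>

definition W :: "complex \<Rightarrow> complex" where
  "W z = (if p = om then 1 else if fst p \<in> R then z - fst p else (z - fst p) ^ m)"

text \<open>Over a root \<open>a\<close>, the function \<open>z - a\<close> is already the m-th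
  power of the coordinate and clears the pole. At an unramified point it has only a simple zero, so
  the m-th power is required and the growth rises to \<open>m\<close>.\<close>

definition t :: nat where "t = (if p \<noteq> om \<and> fst p \<notin> R then m else 1)"

text \<open>Over the complement the projection is unramified and no sheet meets the pole of
  \<open>fst \<circ> \<phi>\<close>.\<close>

definition E :: "complex set" where "E = (if p = om then R else insert (fst p) R)"

lemma finE: "finite E" and RE: "R \<subseteq> E" and pE: "q \<in> curve \<Longrightarrow> fst q \<notin> E \<Longrightarrow> q \<noteq> p"
  using finR over_neq_om by (auto simp: E_def split: if_splits)

lemma W_nonzero: "z \<notin> E \<Longrightarrow> W z \<noteq> 0"
  by (auto simp: W_def E_def split: if_splits)

lemma W_holo: "W holomorphic_on S"
  by (cases "p = om"; cases "fst p \<in> R") (auto simp: W_def[abs_def] intro!: holomorphic_intros)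

lemma W_growth: "norm (W z) \<le> (1 + norm (fst p)) ^ t * (1 + norm z) ^ t"
proof -
  have a: "norm (z - fst p) \<le> (1 + norm (fst p)) * (1 + norm z)"
  proof -
    have "(1 + norm (fst p)) * (1 + norm z) = 1 + norm z + norm (fst p) + norm (fst p) * norm z"
      by (simp add: algebra_simps)
    moreover have "0 \<le> norm (fst p) * norm z" by simp
    ultimately show ?thesis using norm_triangle_ineq4[of z "fst p"] by linarith
  qed
  have b: "1 \<le> (1 + norm (fst p)) * (1 + norm z)"
    using mult_mono[of 1 "1 + norm (fst p)" 1 "1 + norm z"] by simp
  consider "p = om" | "p \<noteq> om" "fst p \<in> R" | "p \<noteq> om" "fst p \<notin> R" by blast
  then show ?thesis
  proof cases
    case 3
    have "norm (z - fst p) ^ m \<le> ((1 + norm (fst p)) * (1 + norm z)) ^ m" using a by (intro power_mono) auto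
    then show ?thesis using 3 by (simp add: W_def t_def norm_power power_mult_distrib)
  qed (use a b in \<open>auto simp: W_def t_def\<close>)
qed

text \<open>Near an affine \<open>p\<close> the factor \<open>W\<close> supplies the m-th power of
  the coordinate that the pole consumes. If \<open>p\<close> is \<open>om\<close>, the pole is
  itself linear growth in \<open>z\<close>. Away from \<open>p\<close> the first coordinate is
  bounded and only the growth of \<open>W\<close> remains.\<close>

lemma pole_bound:
  obtains C where "C \<ge> 0"
    "\<And>q. \<lbrakk>q \<in> curve; q \<noteq> p\<rbrakk> \<Longrightarrow> norm (W (fst q)) * norm (fst (\<phi> q)) \<le> C * (1 + norm (fst q)) ^ t"
proof -
  have "\<exists>N C. openin X N \<and> p \<in> N \<and> (\<forall>q\<in>N. q \<in> curve \<longrightarrow> q \<noteq> p \<longrightarrow>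
       norm (W (fst q)) * norm (fst (\<phi> q)) \<le> C * (1 + norm (fst q)) ^ t)"
  proof (cases "p = om")
    case True
    have i: "None \<in> I" "p \<in> cU None" using True by (auto simp: I_def Vinf_def)
    obtain N C where N: "openin X N" "p \<in> N" "N \<subseteq> cU None"
      "\<And>q. \<lbrakk>q \<in> N; q \<noteq> p\<rbrakk> \<Longrightarrow> norm (fst (\<phi> q)) * norm (cc None q - cc None p) ^ m \<le> C"
      using local_pole[OF i] by metis
    have "norm (W (fst q)) * norm (fst (\<phi> q)) \<le> C * (1 + norm (fst q)) ^ t" if q: "q \<in> N" "q \<in> curve" "q \<noteq> p" for q
    proof -
      have q': "q \<in> over {z. norm z > \<rho>}" using N(3) q True by (auto simp: Vinf_def)
      have "norm (cinf q) ^ m = 1 / norm (fst q)" using cinf_pow(1)[OF q'] by (metis norm_divide norm_one norm_power)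
      then have "norm (fst (\<phi> q)) / norm (fst q) \<le> C" using N(4)[OF q(1,3)] True by (simp add: cinf_def)
      moreover have pos: "0 < norm (fst q)" using cinf_pow(2)[OF q'] by simp
      ultimately have le: "norm (fst (\<phi> q)) \<le> C * norm (fst q)" by (simp add: pos_divide_le_eq)
      then have "C \<ge> 0" using pos by (metis norm_ge_zero order_trans mult_less_0_iff not_less)
      then have "norm (fst (\<phi> q)) \<le> C * (1 + norm (fst q))" using le by (simp add: distrib_left)
      then show ?thesis using True by (simp add: W_def t_def)
    qed
    then show ?thesis using N(1,2) by blast
  next
    case False
    then have pc: "p \<in> curve" using p_pts pts_cases by blast
    obtain a where a: "a \<in> R" "fst p \<in> Kset a" using Kset_cover .
    have i: "Some a \<in> I" "p \<in> cU (Some a)" using a pc by (auto simp: I_def)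
    let ?s = "cc (Some a)"
    obtain N C where N: "openin X N" "p \<in> N" "N \<subseteq> cU (Some a)" "\<And>q. q \<in> N \<Longrightarrow> norm (?s q - ?s p) < 1"
      "\<And>q. \<lbrakk>q \<in> N; q \<noteq> p\<rbrakk> \<Longrightarrow> norm (fst (\<phi> q)) * norm (?s q - ?s p) ^ m \<le> C"
      using local_pole[OF i] by metis
    have fst: "fst q = a + ?s q ^ m" if "q \<in> N" for q
    proof (rule fst_coord[OF a(1)])
      show "q \<in> over (Kset a)" using N(3) that by (simp only: cU.simps) blast
    qed
    show ?thesis
    proof (cases "fst p \<in> R")
      case True
      then have ap: "fst p = a" using Kset_root[OF a(1)] a(2) by auto
      have "?s p ^ m = 0" using fst[OF N(2)] ap by simp
      then have s0: "?s p = 0" using m_pos by simp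
      have "norm (W (fst q)) * norm (fst (\<phi> q)) \<le> C * (1 + norm (fst q)) ^ t" if q: "q \<in> N" "q \<in> curve" "q \<noteq> p" for q
      proof -
        have "W (fst q) = ?s q ^ m" using False True fst[OF q(1)] ap by (simp add: W_def del: cc.simps)
        then have le: "norm (W (fst q)) * norm (fst (\<phi> q)) \<le> C"
          using N(5)[OF q(1,3)] s0 by (simp add: norm_power mult.commute del: cc.simps)
        then have "C \<ge> 0" by (rule order_trans[OF mult_nonneg_nonneg[OF norm_ge_zero norm_ge_zero]])
        then have "C \<le> C * (1 + norm (fst q))" by (simp add: distrib_left)
        then show ?thesis using le True by (simp add: t_def)
      qed
      then show ?thesis using N(1,2) by blast
    next
      case nR: False
      obtain M where M: "M \<ge> 0" "\<And>s. norm (s - ?s p) < 1 \<Longrightarrow> norm (s ^ m - ?s p ^ m) \<le> M * norm (s - ?s p)"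
        using norm_power_diff_local[of "?s p" m] by metis
      have "norm (W (fst q)) * norm (fst (\<phi> q)) \<le> (M ^ m * C) * (1 + norm (fst q)) ^ t"
        if q: "q \<in> N" "q \<in> curve" "q \<noteq> p" for q
      proof -
        have "fst q - fst p = ?s q ^ m - ?s p ^ m" using fst[OF q(1)] fst[OF N(2)] by (simp del: cc.simps)
        then have "norm (fst q - fst p) \<le> M * norm (?s q - ?s p)" using M(2)[OF N(4)[OF q(1)]] by simp
        then have "norm (fst q - fst p) ^ m \<le> (M * norm (?s q - ?s p)) ^ m" by (intro power_mono) auto
        then have "norm (W (fst q)) \<le> M ^ m * norm (?s q - ?s p) ^ m"
          using False nR by (simp add: W_def norm_power power_mult_distrib del: cc.simps)
        then have "norm (W (fst q)) * norm (fst (\<phi> q)) \<le> (M ^ m * norm (?s q - ?s p) ^ m) * norm (fst (\<phi> q))"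
          by (rule mult_right_mono) simp
        also have "\<dots> = M ^ m * (norm (fst (\<phi> q)) * norm (?s q - ?s p) ^ m)" by (simp only: mult_ac)
        also have "\<dots> \<le> M ^ m * C" using N(5)[OF q(1,3)] M(1) by (intro mult_left_mono) auto
        finally have le: "norm (W (fst q)) * norm (fst (\<phi> q)) \<le> M ^ m * C" .
        then have C0: "M ^ m * C \<ge> 0" by (rule order_trans[OF mult_nonneg_nonneg[OF norm_ge_zero norm_ge_zero]])
        have "1 \<le> (1 + norm (fst q)) ^ t" by (intro one_le_power) simp
        then have "M ^ m * C * 1 \<le> M ^ m * C * (1 + norm (fst q)) ^ t" using C0 by (intro mult_left_mono) auto
        then show ?thesis using le by simp
      qed
      then show ?thesis using N(1,2) by blast
    qed
  qed
  then obtain N C where N: "openin X N" "p \<in> N"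
    "\<And>q. \<lbrakk>q \<in> N; q \<in> curve; q \<noteq> p\<rbrakk> \<Longrightarrow> norm (W (fst q)) * norm (fst (\<phi> q)) \<le> C * (1 + norm (fst q)) ^ t"
    by blast
  obtain B where B: "\<And>q. \<lbrakk>q \<in> pts; q \<notin> N\<rbrakk> \<Longrightarrow> norm (fst (\<phi> q)) \<le> B" using bounded_off[OF N(1,2)] by metis
  let ?K = "(1 + norm (fst p)) ^ t"
  show ?thesis
  proof (rule that[of "max \<bar>C\<bar> (?K * \<bar>B\<bar>)"])
    show "max \<bar>C\<bar> (?K * \<bar>B\<bar>) \<ge> 0" by simp
    fix q assume q: "q \<in> curve" "q \<noteq> p"
    have pos: "0 \<le> (1 + norm (fst q)) ^ t" by simp
    show "norm (W (fst q)) * norm (fst (\<phi> q)) \<le> max \<bar>C\<bar> (?K * \<bar>B\<bar>) * (1 + norm (fst q)) ^ t"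
    proof (cases "q \<in> N")
      case True
      have "C * (1 + norm (fst q)) ^ t \<le> max \<bar>C\<bar> (?K * \<bar>B\<bar>) * (1 + norm (fst q)) ^ t"
        using pos by (intro mult_right_mono) auto
      then show ?thesis using N(3)[OF True q] by linarith
    next
      case False
      have "norm (W (fst q)) * norm (fst (\<phi> q)) \<le> (?K * (1 + norm (fst q)) ^ t) * \<bar>B\<bar>"
        using W_growth B[OF curve_pts[OF q(1)] False] by (intro mult_mono) auto
      also have "\<dots> = (?K * \<bar>B\<bar>) * (1 + norm (fst q)) ^ t" by (simp only: mult_ac)
      also have "\<dots> \<le> max \<bar>C\<bar> (?K * \<bar>B\<bar>) * (1 + norm (fst q)) ^ t"
        using pos by (intro mult_right_mono) auto
      finally show ?thesis .
    qed
  qed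
qed

section \<open>Eigencomponents under the rotation\<close>

definition f :: "nat \<Rightarrow> complex \<times> complex \<Rightarrow> complex" where
  "f j q = fst (\<phi> (fst q, \<zeta> ^ j * snd q))"

text \<open>The projections of \<open>fst \<circ> \<phi>\<close> to the eigenspaces of the rotation.\<close>

definition F :: "nat \<Rightarrow> complex \<times> complex \<Rightarrow> complex" where
  "F k q = (\<Sum>j<m. inverse \<zeta> ^ (j * k) * f j q)"

lemma zeta_pow_curve: "q \<in> over K \<Longrightarrow> (fst q, \<zeta> ^ j * snd q) \<in> over K"
proof -
  have "(\<zeta> ^ j) ^ m = 1" by (metis mult.commute power_mult power_one zeta_m)
  then show "q \<in> over K \<Longrightarrow> (fst q, \<zeta> ^ j * snd q) \<in> over K" by (simp add: power_mult_distrib)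
qed

lemma f_shift: "f j (fst q, \<zeta> ^ i * snd q) = f (i + j) q"
  by (simp add: f_def power_add mult_ac)

lemma f_period: "f (m + j) q = f j q"
  by (simp add: f_def power_add)

lemma F_rot: "F k (fst q, \<zeta> * snd q) = \<zeta> ^ k * F k q"
proof -
  let ?h = "\<lambda>j. inverse \<zeta> ^ (j * k) * f j q"
  have e: "inverse \<zeta> ^ (m * k) = 1" by (simp add: power_mult power_inverse)
  have shift: "(\<Sum>j<m. ?h (Suc j)) = (\<Sum>j<m. ?h j)"
  proof -
    have "?h 0 + (\<Sum>j<m. ?h (Suc j)) = (\<Sum>j<m. ?h j) + ?h m"
      using sum.lessThan_Suc_shift[of ?h m] sum.lessThan_Suc[of ?h m] by simp
    moreover have "?h m = ?h 0" using f_period[of 0 q] e by simp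
    ultimately show ?thesis by simp
  qed
  have "F k (fst q, \<zeta> * snd q) = (\<Sum>j<m. inverse \<zeta> ^ (j * k) * f (Suc j) q)"
    using f_shift[of _ q 1] by (simp add: F_def)
  also have "\<dots> = (\<Sum>j<m. \<zeta> ^ k * ?h (Suc j))"
    by (rule sum.cong) (simp_all add: power_add field_simps)
  also have "\<dots> = \<zeta> ^ k * F k q" using shift by (simp add: F_def flip: sum_distrib_left)
  finally show ?thesis .
qed

lemma F_zeta: "F k (fst q, \<zeta> ^ i * snd q) = \<zeta> ^ (i * k) * F k q"
proof (induction i)
  case (Suc i)
  have "F k (fst q, \<zeta> ^ Suc i * snd q) = F k (fst (fst q, \<zeta> ^ i * snd q), \<zeta> * snd (fst q, \<zeta> ^ i * snd q))"
    by (simp add: mult_ac)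
  also have "\<dots> = \<zeta> ^ k * F k (fst q, \<zeta> ^ i * snd q)" by (rule F_rot)
  finally show ?case using Suc by (simp add: power_add mult_ac)
qed simp

lemma fiber_zeta:
  assumes "q \<in> curve" "q' \<in> curve" "fst q = fst q'" obtains i where "i < m" "q' = (fst q, \<zeta> ^ i * snd q)"
proof (cases "snd q = 0")
  case True
  then have "snd q' ^ m = 0" using assms m_pos by (simp add: zero_power)
  then have "snd q' = 0" by simp
  then show ?thesis using that[of 0] m_pos True assms(3) by (simp add: prod_eq_iff)
next
  case False
  have "snd q' ^ m = snd q ^ m" using assms by simp
  then have "(snd q' / snd q) ^ m = 1" using False by (simp add: power_divide)
  then obtain i where "i < m" "snd q' / snd q = \<zeta> ^ i" using zeta_exists by metis
  then show ?thesis using that[of i] False assms(3) by (simp add: prod_eq_iff field_simps)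
qed

lemma local_section:
  assumes "z \<notin> E"
  obtains K v where "open K" "z \<in> K" "K \<subseteq> - E" "v holomorphic_on K" "\<And>x. x \<in> K \<Longrightarrow> (x, v x) \<in> curve \<and> v x \<noteq> 0"
proof -
  have "open (- E)" using finE by (simp add: finite_imp_closed open_Compl)
  then obtain r where r: "r > 0" "ball z r \<subseteq> - E" using assms openE by blast
  then have "R \<inter> ball z r = {}" using RE by blast
  then obtain h where h: "h holomorphic_on ball z r" "\<And>x. x \<in> ball z r \<Longrightarrow> Q x = exp (h x)"
    using Q_log[OF convex_ball open_ball] by metis
  show ?thesis
  proof (rule that[of "ball z r" "\<lambda>x. exp (h x / m)"])
    show "(\<lambda>x. exp (h x / m)) holomorphic_on ball z r" using h m_pos by (intro holomorphic_intros) auto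
    show "(x, exp (h x / m)) \<in> curve \<and> exp (h x / m) \<noteq> 0" if "x \<in> ball z r" for x
      using h(2)[OF that] by (simp add: exp_div_pow)
  qed (use r in auto)
qed

lemma f_holo:
  assumes "open K" "K \<subseteq> - E" "v holomorphic_on K" "\<And>x. x \<in> K \<Longrightarrow> (x, v x) \<in> curve \<and> v x \<noteq> 0"
  shows "(\<lambda>x. f j (x, v x)) holomorphic_on K"
  unfolding f_def fst_conv snd_conv
proof (rule fst_phi_holo[OF assms(1)])
  show "(\<lambda>x. \<zeta> ^ j * v x) holomorphic_on K" using assms by (intro holomorphic_intros)
  show c: "(x, \<zeta> ^ j * v x) \<in> curve" if "x \<in> K" for x
    using zeta_pow_curve[of "(x, v x)" UNIV j] assms(4)[OF that] by (simp del: mem_over)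
  show "(x, \<zeta> ^ j * v x) \<noteq> p" if "x \<in> K" for x
    using pE[OF c[OF that]] assms(2) that by auto
qed (intro holomorphic_intros)

text \<open>Both \<open>F k\<close> and \<open>w ^ k\<close> are multiplied by
  \<open>\<zeta> ^ k\<close> under the rotation, so their quotient depends on \<open>z\<close> only.
  Multiplied by \<open>W\<close> it satisfies the bounds of \<open>vanishing\<close>.\<close>

lemma eigen_zero:
  assumes k: "k < m" "m * t < k * card R" and q: "q \<in> curve" "fst q \<notin> E"
  shows "F k q = 0"
proof -
  obtain C where C: "C \<ge> 0"
    "\<And>q. \<lbrakk>q \<in> curve; q \<noteq> p\<rbrakk> \<Longrightarrow> norm (W (fst q)) * norm (fst (\<phi> q)) \<le> C * (1 + norm (fst q)) ^ t"
    using pole_bound by metis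
  \<comment> \<open>The root is chosen pointwise, without continuity. Holomorphy of \<open>H\<close>
    follows because by \<open>loc\<close> any local holomorphic section gives the same
    value.\<close>
  define w where "w z = (SOME w. (z, w) \<in> curve)" for z
  have w: "(z, w z) \<in> curve" for z
    unfolding w_def using over_fiber_nonempty[of z] by (metis (mono_tags, lifting) someI_ex UNIV_I fst_conv mem_over snd_conv)
  have w0: "w z \<noteq> 0" if "z \<notin> E" for z
    using w[of z] that RE m_pos by (auto simp: Q_eq_0_iff[symmetric] zero_power)
  define H where "H z = W z * (F k (z, w z) / w z ^ k)" for z
  have loc: "H z = W z * (F k (z, v) / v ^ k)" if zv: "(z, v) \<in> curve" "v \<noteq> 0" for z v
  proof -
    obtain i where "w z = \<zeta> ^ i * v" using fiber_zeta[OF zv(1) w[of z]] by auto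
    then have "F k (z, w z) / w z ^ k = \<zeta> ^ (i * k) * F k (z, v) / (\<zeta> ^ (i * k) * v ^ k)"
      using F_zeta[of k "(z, v)" i] by (simp add: power_mult_distrib power_mult)
    also have "\<dots> = F k (z, v) / v ^ k" by simp
    finally show ?thesis by (simp add: H_def)
  qed
  have "H z = 0" if "z \<notin> E" for z
  proof (rule vanishing[OF finE _ _ k that])
    have "\<exists>T. open T \<and> z \<in> T \<and> H holomorphic_on T" if zE: "z \<notin> E" for z
    proof -
      obtain K v where K: "open K" "z \<in> K" "K \<subseteq> - E" "v holomorphic_on K" "\<And>x. x \<in> K \<Longrightarrow> (x, v x) \<in> curve \<and> v x \<noteq> 0"
        using local_section[OF zE] by metis
      have "(\<lambda>x. F k (x, v x)) holomorphic_on K"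
        unfolding F_def using f_holo[OF K(1,3,4,5)] by (intro holomorphic_intros)
      then have "(\<lambda>x. W x * (F k (x, v x) / v x ^ k)) holomorphic_on K"
        using K(4,5) W_holo by (intro holomorphic_intros) auto
      then have "H holomorphic_on K" by (rule holomorphic_transform) (use loc K(5) in metis)
      then show ?thesis using K by blast
    qed
    then have "H field_differentiable at z within - E" if "z \<in> - E" for z
      using holomorphic_on_imp_differentiable_at field_differentiable_at_within that by blast
    then show "H holomorphic_on - E" by (simp add: holomorphic_on_def)
    fix z assume z: "z \<notin> E"
    have "norm (W z) * norm (F k (z, w z)) \<le> (\<Sum>j<m. norm (W z) * norm (f j (z, w z)))"
    proof -
      have "norm (F k (z, w z)) \<le> (\<Sum>j<m. norm (inverse \<zeta> ^ (j * k) * f j (z, w z)))"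
        unfolding F_def by (rule norm_sum)
      also have "\<dots> = (\<Sum>j<m. norm (f j (z, w z)))" by (simp add: norm_mult norm_power norm_inverse)
      finally show ?thesis by (simp add: mult_left_mono flip: sum_distrib_left)
    qed
    also have "\<dots> \<le> (\<Sum>j<m. C * (1 + norm z) ^ t)"
    proof (rule sum_mono)
      fix j
      have "(z, \<zeta> ^ j * w z) \<in> curve" using zeta_pow_curve[OF w[of z], of j] by simp
      then show "norm (W z) * norm (f j (z, w z)) \<le> C * (1 + norm z) ^ t"
        using C(2)[of "(z, \<zeta> ^ j * w z)"] pE[of "(z, \<zeta> ^ j * w z)"] z by (simp add: f_def)
    qed
    finally have le: "norm (W z) * norm (F k (z, w z)) \<le> m * C * (1 + norm z) ^ t" by simp
    have wm: "norm (w z) ^ m = norm (Q z)" using w[of z] by (simp flip: norm_power)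
    have "norm (H z) ^ m * norm (Q z) ^ k = (norm (W z) * norm (F k (z, w z))) ^ m"
    proof -
      have "norm (H z) ^ m = (norm (W z) * norm (F k (z, w z))) ^ m / (norm (w z) ^ m) ^ k"
        by (simp add: H_def norm_mult norm_divide norm_power power_mult_distrib power_divide mult.commute flip: power_mult)
      moreover have "norm (w z) ^ m \<noteq> 0" using w0[OF z] by simp
      ultimately show ?thesis unfolding wm by simp
    qed
    also have "\<dots> \<le> (m * C * (1 + norm z) ^ t) ^ m" using le by (intro power_mono) auto
    also have "\<dots> = (m * C) ^ m * (1 + norm z) ^ (m * t)"
      by (simp add: power_mult_distrib mult.commute flip: power_mult)
    finally show "norm (H z) ^ m * norm (Q z) ^ k \<le> (m * C) ^ m * (1 + norm z) ^ (m * t)" .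
  qed
  then have "H (fst q) = 0" using q(2) .
  then have "F k (fst q, w (fst q)) = 0" using W_nonzero[OF q(2)] w0[OF q(2)] by (simp add: H_def)
  moreover have "\<exists>i. q = (fst q, \<zeta> ^ i * w (fst q))"
    using fiber_zeta[OF w[of "fst q"] q(1)] by (metis fst_conv snd_conv)
  then obtain i where "q = (fst q, \<zeta> ^ i * w (fst q))" by blast
  then have "F k q = \<zeta> ^ (i * k) * F k (fst q, w (fst q))" using F_zeta[of k "(fst q, w (fst q))" i] by simp
  ultimately show ?thesis by simp
qed

end

section \<open>Generic points and deck transformations\<close>

context cyclic_curve begin

text \<open>A nonempty open set contains infinitely many points of a chart, and only finitely many
  points of a chart lie over a finite set or at its centre.\<close>

lemma generic_point:
  assumes "openin X N" "q0 \<in> N" "finite E"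
  obtains q where "q \<in> N" "q \<in> over (- R)" "fst q \<notin> E"
proof -
  have "q0 \<in> pts" using assms(1,2) openin_subset by fastforce
  then obtain i where i: "i \<in> I" "q0 \<in> cU i" using cU_cover by blast
  let ?T = "{s \<in> cD i. cp i s \<in> N}"
  have "continuous_map (top_of_set (cD i)) X (cp i)"
    using chart_maps[OF i(1)] by (auto simp: homeomorphic_maps_def continuous_map_in_subtopology)
  then have "openin (top_of_set (cD i)) {s \<in> topspace (top_of_set (cD i)). cp i s \<in> N}"
    using assms(1) by (rule openin_continuous_map_preimage)
  then have "openin (top_of_set (cD i)) ?T" by simp
  then have T: "open ?T" using openin_open_trans open_cD[OF i(1)] by blast
  have "cc i q0 \<in> ?T" using cc_in[OF i] cp_cc[OF i] assms(2) by simp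
  then have "infinite ?T" using finite_imp_not_open[of ?T] T by blast
  then have "infinite (?T - {s \<in> cD i. s = 0 \<or> fst (cp i s) \<in> E})"
    using finite_cp_fiber[OF i(1) assms(3)] by (rule Diff_infinite_finite[rotated])
  then have "?T - {s \<in> cD i. s = 0 \<or> fst (cp i s) \<in> E} \<noteq> {}" by (rule infinite_imp_nonempty)
  then obtain s where s: "s \<in> ?T - {s \<in> cD i. s = 0 \<or> fst (cp i s) \<in> E}" by blast
  then show ?thesis using that[of "cp i s"] cp_nonzero[OF i(1), of s] by (auto simp del: mem_over)
qed

lemma openin_nbhd_om: "openin X (insert om (over {z. norm z > B}))"
proof -
  have "curve - insert om (over {z. norm z > B}) = over (cball 0 B)" using over_neq_om by auto
  moreover have "insert om (over {z. norm z > B}) - {om} = over {z. norm z > B}" using over_neq_om by auto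
  ultimately show ?thesis
    using openin_curve[OF open_outside] compact_over[of "cball 0 B"] by (auto simp: openin_X pts_def)
qed

lemma root_sum:
  assumes "i < m" "j < m"
  shows "(\<Sum>k<m. \<zeta> ^ (i * k) * inverse \<zeta> ^ (j * k)) = (if i = j then of_nat m else 0)"
proof -
  define x where "x = \<zeta> ^ i * inverse \<zeta> ^ j"
  have eq: "\<zeta> ^ (i * k) * inverse \<zeta> ^ (j * k) = x ^ k" for k
    by (simp add: x_def power_mult_distrib power_mult)
  show ?thesis
  proof (cases "i = j")
    case True
    then have "x = 1" by (simp add: x_def power_inverse)
    then show ?thesis using True unfolding eq by simp
  next
    case False
    then have "\<zeta> ^ i \<noteq> \<zeta> ^ j" using zeta_inj assms by blast
    then have x1: "x \<noteq> 1" by (simp add: x_def power_inverse field_simps)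
    have "x ^ m = 1" using eq[of m] by (simp add: mult.commute[of _ m] power_mult power_inverse)
    then have "(\<Sum>k<m. x ^ k) = 0" using geometric_sum[OF x1, of m] by simp
    then show ?thesis using False unfolding eq by simp
  qed
qed

text \<open>The ratio of the second coordinates of \<open>\<psi> q\<close> and \<open>q\<close> is
  an m-th root of unity depending continuously on \<open>q\<close>. Over a punctured
  \<open>Kset a\<close> the curve is connected, so the ratio is constant there. It thus descends to
  a locally constant function of \<open>z\<close> on the connected complement of
  \<open>R\<close>.\<close>

lemma deck_transformation:
  assumes \<psi>: "continuous_map X X \<psi>" "\<And>q. q \<in> curve \<Longrightarrow> \<psi> q \<in> curve \<and> fst (\<psi> q) = fst q"
  obtains j where "j < m" "\<And>q. q \<in> curve \<Longrightarrow> \<psi> q = (fst q, \<zeta> ^ j * snd q)"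
proof -
  define u where "u q = snd (\<psi> q) / snd q" for q
  have snd0: "snd q \<noteq> 0" if "q \<in> over (- R)" for q
    using that m_pos by (auto simp: Q_eq_0_iff[symmetric] zero_power)
  have sub: "over (- R) \<subseteq> curve" by auto
  have u1: "u q ^ m = 1" if q: "q \<in> over (- R)" for q
  proof -
    have "snd (\<psi> q) ^ m = snd q ^ m" using \<psi>(2)[of q] q by simp
    then show ?thesis using snd0[OF q] by (simp add: u_def power_divide)
  qed
  have "continuous_map (subtopology X curve) (subtopology X curve) \<psi>"
    using \<psi> by (auto simp: continuous_map_in_subtopology continuous_map_from_subtopology simp del: subtopology_curve mem_over)
  then have "continuous_on curve \<psi>" by (simp add: continuous_map_in_subtopology)
  then have "continuous_on (over (- R)) \<psi>" using continuous_on_subset sub by blast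
  then have ucont: "continuous_on (over (- R)) u"
    unfolding u_def using snd0 by (intro continuous_intros) auto
  have const: "u q = u q'" if a: "a \<in> R" and q: "q \<in> over (Kset a - {a})" "q' \<in> over (Kset a - {a})" for a q q'
  proof -
    let ?S = "over (Kset a - {a})"
    have i: "Some a \<in> I" using a by (simp add: I_def)
    have D0: "0 \<in> cD (Some a)" using Kset_root[OF a] m_pos by (auto simp: zero_power)
    have SR: "?S \<subseteq> over (- R)" using Kset_root[OF a] by auto
    have "connected (cD (Some a))"
      using starlike_imp_connected[OF starlike_disc[OF Kset_convex[of a], of a]] Kset_root[OF a] by auto
    then have "connected (cD (Some a) - {0})"
      using connected_open_delete[OF open_cD[OF i]] by simp
    moreover have h: "homeomorphism (over (Kset a)) (cD (Some a)) (cc (Some a)) (cp (Some a))"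
      using coord_param(1)[OF hroot[OF a]] by simp
    have "continuous_on (cD (Some a) - {0}) (cp (Some a))"
      using homeomorphism_cont2[OF h] continuous_on_subset by blast
    ultimately have "connected (cp (Some a) ` (cD (Some a) - {0}))" using connected_continuous_image by blast
    moreover have "cp (Some a) ` (cD (Some a) - {0}) = ?S"
    proof
      show "cp (Some a) ` (cD (Some a) - {0}) \<subseteq> ?S"
      proof
        fix q assume "q \<in> cp (Some a) ` (cD (Some a) - {0})"
        then obtain s where s: "s \<in> cD (Some a)" "s \<noteq> 0" "q = cp (Some a) s" by blast
        then have "q \<in> over (Kset a)" "q \<in> over (- R)" using cp_in[OF i s(1)] cp_nonzero[OF i s(1,2)] by auto
        then show "q \<in> ?S" using a by auto
      qed
      show "?S \<subseteq> cp (Some a) ` (cD (Some a) - {0})"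
      proof
        fix q assume q: "q \<in> ?S"
        then have q': "q \<in> over (Kset a)" "fst q \<noteq> a" by auto
        then have "cc (Some a) q \<noteq> 0" using coord_param(2)[OF hroot[OF a] q'(1)] m_pos by (auto simp: zero_power)
        then show "q \<in> cp (Some a) ` (cD (Some a) - {0})"
          using cc_in[OF i, of q] cp_cc[OF i, of q] q'(1) by (metis DiffI cU.simps(2) image_eqI singletonD)
      qed
    qed
    ultimately have "connected ?S" by simp
    moreover have "continuous_on ?S u" using ucont SR continuous_on_subset by blast
    moreover have "finite (u ` ?S)"
    proof (rule finite_subset)
      show "u ` ?S \<subseteq> {x. x ^ m = 1}" using u1 SR by blast
      show "finite {x::complex. x ^ m = 1}" using finite_pow_eq .
    qed
    ultimately have "u constant_on ?S" by (rule continuous_finite_range_constant)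
    then show ?thesis using q by (auto simp: constant_on_def simp del: mem_over)
  qed
  define w where "w z = (SOME w. (z, w) \<in> curve)" for z
  have w: "(z, w z) \<in> curve" for z
    unfolding w_def using over_fiber_nonempty[of z] by (metis (mono_tags, lifting) someI_ex UNIV_I fst_conv mem_over snd_conv)
  define U where "U z = u (z, w z)" for z
  have Uu: "U (fst q) = u q" if q: "q \<in> over (- R)" for q
  proof -
    obtain a where a: "a \<in> R" "fst q \<in> Kset a" using Kset_cover by metis
    then have "q \<in> over (Kset a - {a})" "(fst q, w (fst q)) \<in> over (Kset a - {a})" using q w[of "fst q"] by auto
    then show ?thesis unfolding U_def by (intro const[OF a(1)])
  qed
  have "connected (- R)"
    using connected_open_delete_finite[of UNIV R] finR convex_connected[OF convex_UNIV]
    by (simp add: Compl_eq_Diff_UNIV)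
  moreover have "\<forall>z\<in>- R. eventually (\<lambda>z'. U z = U z') (at z within - R)"
  proof
    fix z assume z: "z \<in> - R"
    obtain a where a: "a \<in> R" "z \<in> Kset a" using Kset_cover by metis
    have "open (Kset a - {a})" using Kset_open by auto
    moreover have "z \<in> Kset a - {a}" using a z by auto
    ultimately have "eventually (\<lambda>z'. z' \<in> Kset a - {a}) (at z within - R)"
      using eventually_at_topological by blast
    then show "eventually (\<lambda>z'. U z = U z') (at z within - R)"
    proof eventually_elim
      case (elim z')
      have "(z, w z) \<in> over (Kset a - {a})" "(z', w z') \<in> over (Kset a - {a})"
        using a z elim w[of z] w[of z'] by auto
      then show ?case unfolding U_def by (rule const[OF a(1)])
    qed
  qed
  ultimately have Uconst: "U z = U z'" if "z \<in> - R" "z' \<in> - R" for z z'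
    using connected_local_const that by metis
  obtain z0 where z0: "z0 \<in> - R" using finR infinite_UNIV_char_0 by (metis ComplI ex_new_if_finite)
  have "(z0, w z0) \<in> over (- R)" using z0 w[of z0] by simp
  then have "U z0 ^ m = 1" using u1 by (simp add: U_def del: mem_over)
  then obtain j where j: "j < m" "U z0 = \<zeta> ^ j" using zeta_exists by metis
  have "\<psi> q = (fst q, \<zeta> ^ j * snd q)" if q: "q \<in> curve" for q
  proof (cases "fst q \<in> R")
    case True
    then have "Q (fst q) = 0" by (simp add: Q_eq_0_iff)
    then have "snd q ^ m = 0" "snd (\<psi> q) ^ m = 0" using \<psi>(2)[OF q] q by auto
    then show ?thesis using \<psi>(2)[OF q] by (simp add: prod_eq_iff)
  next
    case False
    then have q': "q \<in> over (- R)" using q by simp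
    then have "u q = \<zeta> ^ j" using Uu Uconst[of "fst q" z0] z0 j False by auto
    then have "snd (\<psi> q) = \<zeta> ^ j * snd q" using snd0[OF q'] by (simp add: u_def field_simps)
    then show ?thesis using \<psi>(2)[OF q] by (simp add: prod_eq_iff)
  qed
  then show ?thesis using that j by blast
qed

end

section \<open>Descent of a conformal automorphism to a Moebius map\<close>

context curve_automorphism begin

lemma card_R: "3 * m - 1 \<le> card R"
proof -
  have "m * 3 \<le> m * e" using e3 by (rule mult_left_mono) simp
  then show ?thesis using cardR by linarith
qed

lemma sheet_map_openin:
  assumes U: "openin X U"
  shows "openin X {q \<in> curve. \<phi> (fst q, \<zeta> ^ j * snd q) \<in> U}"
proof -
  have "continuous_on curve (\<lambda>q. (fst q, \<zeta> ^ j * snd q))" by (intro continuous_intros)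
  moreover have "(\<lambda>q. (fst q, \<zeta> ^ j * snd q)) \<in> curve \<rightarrow> curve"
  proof
    fix q assume "q \<in> curve" then show "(fst q, \<zeta> ^ j * snd q) \<in> curve" by (rule zeta_pow_curve)
  qed
  ultimately have "continuous_map (top_of_set curve) (subtopology X curve) (\<lambda>q. (fst q, \<zeta> ^ j * snd q))"
    by (simp add: image_subset_iff_funcset del: mem_over)
  then have "continuous_map (top_of_set curve) X (\<lambda>q. (fst q, \<zeta> ^ j * snd q))"
    by (simp add: continuous_map_in_subtopology del: subtopology_curve)
  then have "continuous_map (top_of_set curve) X (\<lambda>q. \<phi> (fst q, \<zeta> ^ j * snd q))"
    using continuous_map_compose[OF _ cont] by (fastforce simp: o_def)
  then have "openin (top_of_set curve) {q \<in> topspace (top_of_set curve). \<phi> (fst q, \<zeta> ^ j * snd q) \<in> U}"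
    using U by (rule openin_continuous_map_preimage)
  then have "openin (top_of_set curve) {q \<in> curve. \<phi> (fst q, \<zeta> ^ j * snd q) \<in> U}" by simp
  moreover have "om \<notin> {q \<in> curve. \<phi> (fst q, \<zeta> ^ j * snd q) \<in> U}" by simp
  ultimately show ?thesis by (rule openin_X_affine[THEN iffD2, rotated])
qed

lemma snd_zero_iff: "q \<in> curve \<Longrightarrow> snd q = 0 \<longleftrightarrow> fst q \<in> R"
  using m_pos by (auto simp: Q_eq_0_iff[symmetric] zero_power)

lemma zeta_pow_neq_1: "0 < j \<Longrightarrow> j < m \<Longrightarrow> \<zeta> ^ j \<noteq> 1"
  using zeta_inj[of j 0] by auto

text \<open>Otherwise the poles of the functions \<open>f j\<close> are at distinct points, while \<open>F (m - 1) = 0\<close>.\<close>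

lemma p_ramified: "p = om \<or> fst p \<in> R"
proof (rule ccontr)
  assume "\<not> (p = om \<or> fst p \<in> R)"
  then have np: "p \<noteq> om" "fst p \<notin> R" by auto
  then have pc: "p \<in> curve" using p_pts pts_cases by blast
  have tm: "t = m" using np by (simp add: t_def)
  \<comment> \<open>The weight \<open>m - 1\<close> is the most favourable one:
    \<open>w ^ (m - 1)\<close> has \<open>(m - 1) * card R\<close> zeros, against the exponent
    \<open>m * m\<close> coming from the growth of \<open>W\<close>.\<close>
  have lt: "m * t < (m - 1) * card R"
  proof -
    obtain n where n: "m = n + 2" using m2 by (metis add.commute le_Suc_ex)
    have "m * m < (m - 1) * (3 * m - 1)" unfolding n by (simp add: algebra_simps)
    also have "\<dots> \<le> (m - 1) * card R" using card_R by (rule mult_left_mono) simp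
    finally show ?thesis by (simp add: tm)
  qed
  \<comment> \<open>Close to \<open>p\<close> the functions \<open>f j\<close> with
    \<open>j \<ge> 1\<close> stay below \<open>M j\<close>, while \<open>f 0\<close> exceeds the sum
    \<open>B\<close> of these bounds. Hence \<open>f 0\<close> cannot be cancelled by the others in
    \<open>F (m - 1)\<close>.\<close>
  define M where "M j = norm (f j p) + 1" for j
  define B where "B = (\<Sum>j\<in>{1..<m}. M j)"
  define Oj where "Oj j = {q \<in> curve. \<phi> (fst q, \<zeta> ^ j * snd q) \<in> over (ball 0 (M j))}" for j
  define O0 where "O0 = {q \<in> curve. \<phi> (fst q, \<zeta> ^ 0 * snd q) \<in> insert om (over {z. norm z > B})}"
  define N where "N = O0 \<inter> (\<Inter>j\<in>{1..<m}. Oj j)"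
  have "openin X O0" unfolding O0_def using sheet_map_openin[OF openin_nbhd_om[of B], of 0] .
  moreover have "openin X (\<Inter>j\<in>{1..<m}. Oj j)"
  proof (rule openin_Inter)
    show "Oj ` {1..<m} \<noteq> {}" using m2 by auto
    fix V assume "V \<in> Oj ` {1..<m}"
    then obtain j where "V = Oj j" by blast
    then show "openin X V" unfolding Oj_def using sheet_map_openin[OF openin_X_over[OF open_ball], of j 0 "M j"] by simp
  qed simp
  ultimately have N: "openin X N" unfolding N_def by blast
  have "p \<in> Oj j" if j: "j \<in> {1..<m}" for j
  proof -
    have "(fst p, \<zeta> ^ j * snd p) \<noteq> p"
    proof
      assume "(fst p, \<zeta> ^ j * snd p) = p"
      then have "\<zeta> ^ j * snd p = snd p" by (metis snd_conv)
      then show False using zeta_pow_neq_1[of j] j snd_zero_iff[OF pc] np by auto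
    qed
    then have "\<phi> (fst p, \<zeta> ^ j * snd p) \<in> curve" using phi_curve curve_pts zeta_pow_curve[OF pc] by blast
    then show ?thesis using pc by (simp add: Oj_def M_def f_def)
  qed
  moreover have "p \<in> O0" using pc phi_p by (simp add: O0_def)
  ultimately have pN: "p \<in> N" by (simp add: N_def)
  obtain q where q: "q \<in> N" "q \<in> over (- R)" "fst q \<notin> E" using generic_point[OF N pN finE] .
  have qc: "q \<in> curve" using q(2) by simp
  have "F (m - 1) q = 0" using eigen_zero[of "m - 1" q] lt qc q(3) m_pos by simp
  then have "f 0 q + (\<Sum>j\<in>{1..<m}. inverse \<zeta> ^ (j * (m - 1)) * f j q) = 0"
  proof -
    have "{..<m} = insert 0 {1..<m}" using m_pos by auto
    then show ?thesis using \<open>F (m - 1) q = 0\<close> by (simp add: F_def)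
  qed
  then have "f 0 q = - (\<Sum>j\<in>{1..<m}. inverse \<zeta> ^ (j * (m - 1)) * f j q)" by (simp add: eq_neg_iff_add_eq_0)
  then have "norm (f 0 q) \<le> (\<Sum>j\<in>{1..<m}. norm (inverse \<zeta> ^ (j * (m - 1)) * f j q))" by (simp add: norm_sum)
  also have "\<dots> = (\<Sum>j\<in>{1..<m}. norm (f j q))" by (simp add: norm_mult norm_power norm_inverse)
  also have "\<dots> \<le> B" unfolding B_def
  proof (rule sum_mono)
    fix j assume "j \<in> {1..<m}"
    then have "q \<in> Oj j" using q(1) by (auto simp: N_def)
    then show "norm (f j q) \<le> M j" by (simp add: Oj_def f_def)
  qed
  finally have le: "norm (f 0 q) \<le> B" .
  have "\<phi> q \<in> insert om (over {z. norm z > B})" using q(1) by (simp add: N_def O0_def)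
  moreover have "\<phi> q \<noteq> om" using over_neq_om[OF phi_curve[OF curve_pts[OF qc] pE[OF qc q(3)]]] .
  ultimately show False using le by (simp add: f_def)
qed

lemma t_1: "t = 1" using p_ramified by (auto simp: t_def)

lemma p_unique: "\<lbrakk>q \<in> curve; p \<noteq> om; fst q = fst p\<rbrakk> \<Longrightarrow> q = p"
  using p_ramified snd_zero_iff[of q] snd_zero_iff[of p] pts_cases[OF p_pts] by (metis prod_eqI)

lemma W_nonzero': "q \<in> curve \<Longrightarrow> q \<noteq> p \<Longrightarrow> W (fst q) \<noteq> 0"
  using p_unique[of q] p_ramified by (auto simp: W_def)

text \<open>Once \<open>t\<close> is 1, a single factor \<open>w\<close> already has more zeros than
  the bound allows, so every eigencomponent except \<open>F 0\<close> vanishes. Fourier inversion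
  over the m-th roots of unity then gives \<open>m * f i = F 0\<close> for each
  \<open>i\<close>.\<close>

lemma f_invariant:
  assumes q: "q \<in> curve" "fst q \<notin> E" and i: "i < m" shows "f i q = f 0 q"
proof -
  have Fz: "F k q = 0" if "0 < k" "k < m" for k
  proof (rule eigen_zero[OF that(2) _ q])
    have "m * t < 1 * card R" using card_R m2 unfolding t_1 by linarith
    also have "\<dots> \<le> k * card R" using that by (intro mult_right_mono) auto
    finally show "m * t < k * card R" .
  qed
  have key: "of_nat m * f i q = F 0 q" if i: "i < m" for i
  proof -
    have "(\<Sum>k<m. \<zeta> ^ (i * k) * F k q) = (\<Sum>k<m. \<Sum>j<m. \<zeta> ^ (i * k) * inverse \<zeta> ^ (j * k) * f j q)"
      by (simp add: F_def sum_distrib_left mult.assoc)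
    also have "\<dots> = (\<Sum>j<m. (\<Sum>k<m. \<zeta> ^ (i * k) * inverse \<zeta> ^ (j * k)) * f j q)"
      by (subst sum.swap) (simp add: sum_distrib_right)
    also have "\<dots> = (\<Sum>j<m. if i = j then of_nat m * f j q else 0)"
      by (rule sum.cong) (use root_sum[OF i] in auto)
    also have "\<dots> = of_nat m * f i q" using i by simp
    finally have 1: "(\<Sum>k<m. \<zeta> ^ (i * k) * F k q) = of_nat m * f i q" .
    have "(\<Sum>k<m. \<zeta> ^ (i * k) * F k q) = (\<Sum>k<m. if k = 0 then F 0 q else 0)"
      by (rule sum.cong) (use Fz in auto)
    also have "\<dots> = F 0 q" using m_pos by simp
    finally show ?thesis using 1 by simp
  qed
  have "of_nat m * f i q = of_nat m * f 0 q" using key[OF i] key[OF m_pos] by simp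
  then show ?thesis using m_pos by simp
qed

text \<open>As \<open>f 0\<close> is the same on all sheets, its product with \<open>W\<close> is a
  function of \<open>z\<close>, and its growth is linear.\<close>

lemma mobius_generic:
  obtains \<alpha> \<beta> where "\<And>q. \<lbrakk>q \<in> curve; fst q \<notin> E\<rbrakk> \<Longrightarrow> W (fst q) * fst (\<phi> q) = \<alpha> * fst q + \<beta>"
proof -
  obtain C where C: "C \<ge> 0"
    "\<And>q. \<lbrakk>q \<in> curve; q \<noteq> p\<rbrakk> \<Longrightarrow> norm (W (fst q)) * norm (fst (\<phi> q)) \<le> C * (1 + norm (fst q)) ^ t"
    using pole_bound by metis
  define w where "w z = (SOME w. (z, w) \<in> curve)" for z
  have w: "(z, w z) \<in> curve" for z
    unfolding w_def using over_fiber_nonempty[of z] by (metis (mono_tags, lifting) someI_ex UNIV_I fst_conv mem_over snd_conv)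
  define H where "H z = W z * f 0 (z, w z)" for z
  have loc: "H (fst q) = W (fst q) * f 0 q" if q: "q \<in> curve" "fst q \<notin> E" for q
  proof -
    obtain i where i: "i < m" "q = (fst q, \<zeta> ^ i * w (fst q))"
      using fiber_zeta[OF w[of "fst q"] q(1)] by (metis fst_conv snd_conv)
    have "f 0 q = f i (fst q, w (fst q))" using f_shift[of 0 "(fst q, w (fst q))" i] i(2) by simp
    also have "\<dots> = f 0 (fst q, w (fst q))" using f_invariant[OF w _ i(1)] q(2) by simp
    finally show ?thesis by (simp add: H_def)
  qed
  have "\<exists>T. open T \<and> z \<in> T \<and> H holomorphic_on T" if zE: "z \<notin> E" for z
  proof -
    obtain K v where K: "open K" "z \<in> K" "K \<subseteq> - E" "v holomorphic_on K" "\<And>x. x \<in> K \<Longrightarrow> (x, v x) \<in> curve \<and> v x \<noteq> 0"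
      using local_section[OF zE] by metis
    have "(\<lambda>x. W x * f 0 (x, v x)) holomorphic_on K"
      using f_holo[OF K(1,3,4,5)] W_holo by (intro holomorphic_intros)
    then have "H holomorphic_on K"
    proof (rule holomorphic_transform)
      fix x assume "x \<in> K"
      then show "W x * f 0 (x, v x) = H x" using loc[of "(x, v x)"] K(3,5) by auto
    qed
    then show ?thesis using K by blast
  qed
  then have "H field_differentiable at z within - E" if "z \<in> - E" for z
    using holomorphic_on_imp_differentiable_at field_differentiable_at_within that by blast
  then have "H holomorphic_on - E" by (simp add: holomorphic_on_def)
  moreover have "norm (H z) \<le> C * (1 + norm z)" if "z \<notin> E" for z
    using C(2)[OF w[of z]] pE[OF w[of z]] that by (simp add: H_def f_def norm_mult t_1)
  ultimately obtain \<alpha> \<beta> where ab: "\<And>z. z \<notin> E \<Longrightarrow> H z = \<alpha> * z + \<beta>"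
    using affine_of_linear_growth[OF finE] by metis
  show ?thesis
  proof (rule that[of \<alpha> \<beta>])
    fix q assume q: "q \<in> curve" "fst q \<notin> E"
    then show "W (fst q) * fst (\<phi> q) = \<alpha> * fst q + \<beta>"
      using loc[OF q] ab[OF q(2)] by (simp add: f_def)
  qed
qed

text \<open>The difference of the two sides is continuous off \<open>p\<close>, and the points with
  \<open>z\<close> outside \<open>E\<close> are dense.\<close>

lemma mobius:
  obtains \<alpha> \<beta> where "\<And>q. \<lbrakk>q \<in> curve; q \<noteq> p\<rbrakk> \<Longrightarrow> W (fst q) * fst (\<phi> q) = \<alpha> * fst q + \<beta>"
proof -
  obtain \<alpha> \<beta> where ab: "\<And>q. \<lbrakk>q \<in> curve; fst q \<notin> E\<rbrakk> \<Longrightarrow> W (fst q) * fst (\<phi> q) = \<alpha> * fst q + \<beta>"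
    using mobius_generic by metis
  let ?Y = "subtopology X (curve - {p})"
  define D where "D q = W (fst q) * fst (\<phi> q) - (\<alpha> * fst q + \<beta>)" for q
  have t1: "closedin X {p}" using Hausdorff_X p_pts by (simp add: closedin_Hausdorff_singleton)
  have opc: "openin X (curve - {p})" using openin_diff[OF openin_X_over t1] by simp
  have Y: "?Y = top_of_set (curve - {p})"
  proof -
    have "?Y = subtopology (subtopology X curve) (curve - {p})"
      unfolding subtopology_subtopology by (rule arg_cong[where f="subtopology X"]) blast
    also have "\<dots> = top_of_set (curve - {p})"
      unfolding subtopology_curve subtopology_subtopology by (rule arg_cong[where f=top_of_set]) blast
    finally show ?thesis .
  qed
  have "continuous_map ?Y X \<phi>" using cont by (rule continuous_map_from_subtopology)
  moreover have "\<phi> \<in> topspace ?Y \<rightarrow> curve" unfolding Y using phi_curve curve_pts by force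
  ultimately have "continuous_map ?Y (subtopology X curve) \<phi>" unfolding continuous_map_in_subtopology by blast
  then have ph: "continuous_on (curve - {p}) \<phi>"
    unfolding subtopology_curve Y continuous_map_in_subtopology by simp
  have Wc: "continuous_on UNIV W" using holomorphic_on_imp_continuous_on[OF W_holo] .
  have "continuous_on (curve - {p}) (\<lambda>q. W (fst q))"
    by (rule continuous_on_compose2[OF Wc]) (auto intro!: continuous_intros)
  then have "continuous_on (curve - {p}) D"
    unfolding D_def[abs_def] using ph by (intro continuous_intros)
  then have "continuous_map ?Y euclidean D" unfolding Y by simp
  then have "openin ?Y {q \<in> topspace ?Y. D q \<in> - {0}}"
    by (rule openin_continuous_map_preimage) auto
  moreover have "topspace ?Y = curve - {p}" unfolding Y by simp
  ultimately have "openin ?Y {q \<in> curve - {p}. D q \<in> - {0}}" by metis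
  then have N: "openin X {q \<in> curve - {p}. D q \<in> - {0}}"
    unfolding openin_open_subtopology[OF opc] by blast
  have "D q = 0" if q: "q \<in> curve" "q \<noteq> p" for q
  proof (rule ccontr)
    assume "D q \<noteq> 0"
    then have qN: "q \<in> {q \<in> curve - {p}. D q \<in> - {0}}" using q by blast
    obtain q' where "q' \<in> {q \<in> curve - {p}. D q \<in> - {0}}" "fst q' \<notin> E"
      by (rule generic_point[OF N qN finE])
    then have "q' \<in> curve" "D q' \<noteq> 0" "fst q' \<notin> E" by blast+
    then show False using ab[of q'] unfolding D_def right_minus_eq by blast
  qed
  then show ?thesis unfolding D_def right_minus_eq using that by blast
qed

end

section \<open>The branch points\<close>

lemma quadratic_three_roots:
  fixes a b c :: complex
  assumes "x \<noteq> y" "y \<noteq> z" "x \<noteq> z" "a * x\<^sup>2 + b * x + c = 0" "a * y\<^sup>2 + b * y + c = 0" "a * z\<^sup>2 + b * z + c = 0"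
  shows "a = 0 \<and> b = 0 \<and> c = 0"
proof -
  have "(x - y) * (a * (x + y) + b) = (a * x\<^sup>2 + b * x + c) - (a * y\<^sup>2 + b * y + c)"
    by (simp add: power2_eq_square algebra_simps)
  then have 1: "a * (x + y) + b = 0" using assms by simp
  have "(x - z) * (a * (x + z) + b) = (a * x\<^sup>2 + b * x + c) - (a * z\<^sup>2 + b * z + c)"
    by (simp add: power2_eq_square algebra_simps)
  then have 2: "a * (x + z) + b = 0" using assms by simp
  have "a * (y - z) = (a * (x + y) + b) - (a * (x + z) + b)" by (simp add: algebra_simps)
  then have "a = 0" using 1 2 assms by simp
  then show ?thesis using 1 assms by simp
qed

text \<open>Antipodal pairs: 0 with infinity, 2i with -i/2, and \<open>j\<close> with
  \<open>- 1 / j\<close>. Starting \<open>j\<close> at 2 gives \<open>l\<close> pairs in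
  all.\<close>

definition branch_points :: "nat \<Rightarrow> complex set" where
  "branch_points l = {0, 2 * \<i>, - \<i> / 2} \<union> of_nat ` {2..<l} \<union> (\<lambda>j. - 1 / of_nat j) ` {2..<l}"

text \<open>A Moebius map preserving \<open>branch_points l\<close> together with infinity sends three real points to real
  ones and hence is real; so it permutes the two nonreal points. Fixing them makes it the identity,
  and swapping them makes it \<open>1 / z\<close>, which does not preserve the real points.\<close>

lemma branch_points_rigid:
  fixes \<alpha> \<beta> \<gamma> \<delta> :: complex
  assumes l: "l \<ge> 6" and det: "\<alpha> * \<delta> - \<beta> * \<gamma> \<noteq> 0" and cases: "\<gamma> = 0 \<and> \<delta> = 1 \<or> \<gamma> = 1"
    and R: "\<And>b. \<lbrakk>b \<in> branch_points l; \<gamma> * b + \<delta> \<noteq> 0\<rbrakk> \<Longrightarrow> (\<alpha> * b + \<beta>) / (\<gamma> * b + \<delta>) \<in> branch_points l"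
  shows "\<gamma> = 0 \<and> \<alpha> = \<delta> \<and> \<beta> = 0"
proof -
  define g where "g z = (\<alpha> * z + \<beta>) / (\<gamma> * z + \<delta>)" for z
  have ginj: "z = z'" if z: "\<gamma> * z + \<delta> \<noteq> 0" "\<gamma> * z' + \<delta> \<noteq> 0" "g z = g z'" for z z'
  proof -
    have "(\<alpha> * z + \<beta>) * (\<gamma> * z' + \<delta>) = (\<alpha> * z' + \<beta>) * (\<gamma> * z + \<delta>)"
      using z by (simp add: g_def frac_eq_eq)
    then have "(\<alpha> * \<delta> - \<beta> * \<gamma>) * (z - z') = 0" by (simp add: algebra_simps)
    then show ?thesis using det by simp
  qed
  have real_or: "b \<in> \<real> \<or> b = 2 * \<i> \<or> b = - \<i> / 2" if "b \<in> branch_points l" for b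
    using that by (auto simp: branch_points_def)
  \<comment> \<open>Of these six real branch points at most one is sent to infinity and at most two
    to the nonreal branch points, so three have real images. Having the integers up to 5 is where
    \<open>l \<ge> 6\<close> enters.\<close>
  define S :: "complex set" where "S = {0, 2, 3, 4, 5, - 1 / 2}"
  have S: "S \<subseteq> branch_points l" "S \<subseteq> \<real>" "finite S" "card S = 6"
  proof -
    have "of_nat j \<in> branch_points l" if "j \<in> {2, 3, 4, 5}" for j using that l by (auto simp: branch_points_def)
    from this[of 2] this[of 3] this[of 4] this[of 5] have a: "{2, 3, 4, 5} \<subseteq> branch_points l" by simp
    have "- 1 / of_nat 2 \<in> branch_points l" using l unfolding branch_points_def by (intro UnI2 imageI) auto
    then show "S \<subseteq> branch_points l" using a by (auto simp: S_def branch_points_def)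
    have "(- 1 / 2 :: complex) \<in> \<real>" by simp
    then show "S \<subseteq> \<real>" by (auto simp: S_def)
    show "finite S" by (simp add: S_def)
    show "card S = 6" by (simp add: S_def field_simps)
  qed
  define B0 where "B0 = {b \<in> S. \<gamma> * b + \<delta> = 0}"
  define B where "B w = {b \<in> S. \<gamma> * b + \<delta> \<noteq> 0 \<and> g b = w}" for w
  have "card B0 \<le> Suc 0" 
  proof (subst card_le_Suc0_iff_eq)
    show "finite B0" using S(3) by (simp add: B0_def)
    show "\<forall>x\<in>B0. \<forall>y\<in>B0. x = y"
    proof (intro ballI)
      fix x y assume "x \<in> B0" "y \<in> B0"
      then have "\<gamma> * x + \<delta> = 0" "\<gamma> * y + \<delta> = 0" by (auto simp: B0_def)
      moreover from this have "\<gamma> = 1" using cases by auto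
      ultimately show "x = y" by (simp add: add_eq_0_iff)
    qed
  qed
  moreover have "card (B w) \<le> Suc 0" for w
    using S(3) ginj by (subst card_le_Suc0_iff_eq) (auto simp: B_def)
  then have "card (B (2 * \<i>) \<union> B (- \<i> / 2)) \<le> 2"
    using card_Un_le[of "B (2 * \<i>)" "B (- \<i> / 2)"] by (smt (verit) Suc_1 add_le_mono One_nat_def add_Suc_right add_0_right le_trans)
  ultimately have "card (B0 \<union> (B (2 * \<i>) \<union> B (- \<i> / 2))) \<le> 3"
    using card_Un_le[of B0 "B (2 * \<i>) \<union> B (- \<i> / 2)"] by linarith
  then have "3 \<le> card (S - (B0 \<union> (B (2 * \<i>) \<union> B (- \<i> / 2))))"
    using S(4) diff_card_le_card_Diff[of "B0 \<union> (B (2 * \<i>) \<union> B (- \<i> / 2))" S] S(3)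
    by (simp add: B0_def B_def)
  then obtain T where T: "T \<subseteq> S - (B0 \<union> (B (2 * \<i>) \<union> B (- \<i> / 2)))" "card T = 3"
    using obtain_subset_with_card_n by metis
  then obtain x y z where xyz: "T = {x, y, z}" "x \<noteq> y" "y \<noteq> z" "x \<noteq> z"
    by (metis card_3_iff)
  \<comment> \<open>For real \<open>b\<close>, the condition that the image of \<open>b\<close> be
    real is a quadratic equation in \<open>b\<close> with coefficients \<open>A1\<close>,
    \<open>A2\<close>, \<open>A3\<close>. Three solutions make all of them vanish.\<close>
  define A1 where "A1 = \<alpha> * cnj \<gamma> - cnj \<alpha> * \<gamma>"
  define A2 where "A2 = \<alpha> * cnj \<delta> + \<beta> * cnj \<gamma> - cnj \<alpha> * \<delta> - cnj \<beta> * \<gamma>"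
  define A3 where "A3 = \<beta> * cnj \<delta> - cnj \<beta> * \<delta>"
  have q: "A1 * b\<^sup>2 + A2 * b + A3 = 0" if b: "b \<in> T" for b
  proof -
    have bS: "b \<in> S" "\<gamma> * b + \<delta> \<noteq> 0" "g b \<noteq> 2 * \<i>" "g b \<noteq> - \<i> / 2"
      using b T(1) by (auto simp: B0_def B_def)
    have cb: "cnj b = b" using bS(1) S(2) by (simp add: Reals_cnj_iff subset_iff)
    have "g b \<in> \<real>" using real_or[of "g b"] R[of b] bS S(1) by (auto simp: g_def)
    then have "cnj (g b) = g b" by (simp add: Reals_cnj_iff)
    then have "(cnj \<alpha> * b + cnj \<beta>) / (cnj \<gamma> * b + cnj \<delta>) = (\<alpha> * b + \<beta>) / (\<gamma> * b + \<delta>)"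
      by (simp add: g_def cb)
    moreover have "cnj (\<gamma> * b + \<delta>) \<noteq> 0" using bS(2) by (metis complex_cnj_zero_iff)
    then have "cnj \<gamma> * b + cnj \<delta> \<noteq> 0" by (simp add: cb)
    ultimately have "(cnj \<alpha> * b + cnj \<beta>) * (\<gamma> * b + \<delta>) = (\<alpha> * b + \<beta>) * (cnj \<gamma> * b + cnj \<delta>)"
      using bS(2) by (simp add: frac_eq_eq)
    then show ?thesis unfolding A1_def A2_def A3_def by (simp add: algebra_simps power2_eq_square)
  qed
  have A: "A1 = 0" "A2 = 0" "A3 = 0"
    using quadratic_three_roots[OF xyz(2-4) q q q] xyz(1) by auto
  have real: "\<alpha> \<in> \<real> \<and> \<beta> \<in> \<real> \<and> \<gamma> \<in> \<real> \<and> \<delta> \<in> \<real>"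
  proof (cases "\<gamma> = 0")
    case True
    then have "\<delta> = 1" using cases by auto
    then show ?thesis using A True by (simp add: A1_def A2_def A3_def Reals_cnj_iff)
  next
    case False
    then have g1: "\<gamma> = 1" using cases by auto
    have a: "Im \<alpha> = 0" using A(1) g1 by (simp add: A1_def complex_eq_iff)
    have b: "Im \<beta> = Re \<alpha> * Im \<delta>" using A(2) g1 a by (simp add: A2_def complex_eq_iff)
    have c: "Im \<beta> * Re \<delta> = Re \<beta> * Im \<delta>" using A(3) by (simp add: A3_def complex_eq_iff)
    have "Im \<delta> = 0"
    proof (rule ccontr)
      assume "Im \<delta> \<noteq> 0"
      then have "Re \<beta> = Re \<alpha> * Re \<delta>" using b c by simp
      then have "\<alpha> * \<delta> - \<beta> * \<gamma> = 0" using a b g1 by (simp add: complex_eq_iff)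
      then show False using det by simp
    qed
    then show ?thesis using a b g1 by (simp add: complex_is_Real_iff)
  qed
  then obtain a b c d where r: "\<alpha> = of_real a" "\<beta> = of_real b" "\<gamma> = of_real c" "\<delta> = of_real d"
    by (metis Reals_cases)
  have det': "a * d - b * c \<noteq> 0" using det unfolding r by (metis of_real_0 of_real_diff of_real_mult)
  have nz: "\<gamma> * w + \<delta> \<noteq> 0" if "Im w \<noteq> 0" for w
    using cases that unfolding r by (auto simp: complex_eq_iff)
  have gw: "g w = 2 * \<i> \<or> g w = - \<i> / 2" if w: "w \<in> branch_points l" "Im w \<noteq> 0" for w
  proof -
    have "g w \<in> branch_points l" using R[OF w(1) nz[OF w(2)]] by (simp add: g_def)
    moreover have "g w \<notin> \<real>"
    proof
      assume "g w \<in> \<real>"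
      then obtain x where x: "g w = of_real x" by (metis Reals_cases)
      then have "\<alpha> * w + \<beta> = of_real x * (\<gamma> * w + \<delta>)" using nz[OF w(2)] by (simp add: g_def field_simps)
      then have "a * Im w = x * (c * Im w)" "a * Re w + b = x * (c * Re w + d)"
        unfolding r by (simp_all add: complex_eq_iff)
      then have ac: "a = x * c" and "b = x * d" using w(2) by (auto simp: algebra_simps)
      then show False using det' by simp
    qed
    ultimately show ?thesis using real_or by blast
  qed
  have mem: "2 * \<i> \<in> branch_points l" "- \<i> / 2 \<in> branch_points l" by (auto simp: branch_points_def)
  have ne: "g (2 * \<i>) \<noteq> g (- \<i> / 2)" 
  proof
    assume "g (2 * \<i>) = g (- \<i> / 2)"
    moreover have "\<gamma> * (2 * \<i>) + \<delta> \<noteq> 0" "\<gamma> * (- \<i> / 2) + \<delta> \<noteq> 0" by (rule nz; simp)+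
    ultimately have "2 * \<i> = - \<i> / 2" using ginj by blast
    then show False by (simp add: complex_eq_iff)
  qed
  have solve: "\<alpha> * w + \<beta> = v * (\<gamma> * w + \<delta>)" if "g w = v" "Im w \<noteq> 0" for v w
    \<comment> \<open>Points off the real axis are not poles, so the fraction may be cleared;
      evaluated at the two nonreal branch points this gives linear equations for the real
      coefficients.\<close>
    using that nz by (auto simp: g_def)
  have "g (2 * \<i>) = 2 * \<i> \<and> g (- \<i> / 2) = - \<i> / 2 \<or> g (2 * \<i>) = - \<i> / 2 \<and> g (- \<i> / 2) = 2 * \<i>"
    using gw[OF mem(1)] gw[OF mem(2)] ne by auto
  then show ?thesis
  proof
    assume "g (2 * \<i>) = 2 * \<i> \<and> g (- \<i> / 2) = - \<i> / 2"
    then have "\<alpha> * (2 * \<i>) + \<beta> = 2 * \<i> * (\<gamma> * (2 * \<i>) + \<delta>)" "\<alpha> * (- \<i> / 2) + \<beta> = - \<i> / 2 * (\<gamma> * (- \<i> / 2) + \<delta>)"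
      using solve[of "2 * \<i>"] solve[of "- \<i> / 2"] by auto
    then have "b = - 4 * c" "a = d" "b = - c / 4" unfolding r by (auto simp: complex_eq_iff)
    then show ?thesis unfolding r by simp
  next
    assume "g (2 * \<i>) = - \<i> / 2 \<and> g (- \<i> / 2) = 2 * \<i>"
    then have "\<alpha> * (2 * \<i>) + \<beta> = - \<i> / 2 * (\<gamma> * (2 * \<i>) + \<delta>)" "\<alpha> * (- \<i> / 2) + \<beta> = 2 * \<i> * (\<gamma> * (- \<i> / 2) + \<delta>)"
      using solve[of "2 * \<i>"] solve[of "- \<i> / 2"] by auto
    then have bc: "b = c" and ad: "2 * a = - d / 2" "- a / 2 = 2 * d" unfolding r by (auto simp: complex_eq_iff)
    then have ad: "a = 0" "d = 0" by auto
    then have "c \<noteq> 0" using det' bc by auto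
    \<comment> \<open>The map is now 1/z. The image 1/2 of the branch point 2 is positive and less
      than 2, so it is no branch point.\<close>
    then have "(\<alpha> * 2 + \<beta>) / (\<gamma> * 2 + \<delta>) = 1 / 2" "\<gamma> * 2 + \<delta> \<noteq> 0" unfolding r using bc ad by auto
    then have "1 / 2 \<in> branch_points l" using R[of 2] S(1) by (metis S_def insertI1 insertI2 subsetD)
    moreover have "1 / 2 \<noteq> (of_nat j :: complex)" if "j \<ge> 2" for j
    proof
      assume "1 / 2 = (of_nat j :: complex)"
      then have "(1 / 2 :: real) = of_nat j" by (metis Re_complex_of_real of_real_1 of_real_divide of_real_numeral of_real_of_nat_eq)
      then show False using that by simp
    qed
    moreover have "1 / 2 \<noteq> - 1 / (of_nat j :: complex)" for j
    proof
      assume "1 / 2 = - 1 / (of_nat j :: complex)"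
      then have "complex_of_real (1 / 2) = complex_of_real (- 1 / of_nat j)" by simp
      then have "(1 / 2 :: real) = - 1 / of_nat j" unfolding of_real_eq_iff .
      moreover have "- 1 / real j \<le> 0" by simp
      ultimately show False by linarith
    qed
    ultimately show ?thesis by (auto simp: branch_points_def complex_eq_iff)
  qed
qed

section \<open>Action of a conformal automorphism on the ramification points\<close>

context curve_automorphism begin

lemma rotX_p: "\<lbrakk>q \<in> pts; rotX q = p\<rbrakk> \<Longrightarrow> q = p"
proof -
  assume q: "q \<in> pts" "rotX q = p"
  show "q = p"
  proof (cases "q = om")
    case True then show ?thesis using q by (simp add: rotX_def)
  next
    case False
    then have qc: "q \<in> curve" using q pts_cases by blast
    then have "rot q = p" using q(2) rotX_curve by simp
    moreover have "rot q \<in> curve" using qc by simp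
    ultimately show ?thesis using p_unique[OF qc] over_neq_om by (metis rot_fst)
  qed
qed

lemma rotX_pts: "q \<in> pts \<Longrightarrow> rotX q \<in> pts"
  using rotX_cont by (auto simp: continuous_map_def)

text \<open>The Moebius relation involves the point only through \<open>z\<close>, which the
  rotation keeps.\<close>

lemma fst_phi_rotX: "\<lbrakk>q \<in> pts; q \<noteq> p\<rbrakk> \<Longrightarrow> fst (\<phi> (rotX q)) = fst (\<phi> q)"
proof (cases "q = om")
  case False
  assume q: "q \<in> pts" "q \<noteq> p"
  obtain \<alpha> \<beta> where ab: "\<And>q. \<lbrakk>q \<in> curve; q \<noteq> p\<rbrakk> \<Longrightarrow> W (fst q) * fst (\<phi> q) = \<alpha> * fst q + \<beta>"
    using mobius by metis
  have qc: "q \<in> curve" using q False pts_cases by blast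
  have r: "rotX q = rot q" "rot q \<in> curve" "rot q \<noteq> p"
    using rotX_curve[OF qc] rotX_p[OF q(1)] q(2) qc by auto
  have "W (fst q) * fst (\<phi> (rot q)) = W (fst q) * fst (\<phi> q)"
    using ab[OF r(2,3)] ab[OF qc q(2)] by simp
  then show ?thesis using W_nonzero'[OF qc q(2)] r(1) by simp
qed (simp add: rotX_def)

text \<open>The conjugate of the rotation by \<phi> keeps \<open>z\<close>, so it is a deck
  transformation. It is not the identity, since the rotation is not.\<close>

lemma phi_rotX:
  obtains j where "0 < j" "j < m" "\<And>q. \<lbrakk>q \<in> pts; q \<noteq> p\<rbrakk> \<Longrightarrow> \<phi> (rotX q) = (fst (\<phi> q), \<zeta> ^ j * snd (\<phi> q))"
proof -
  obtain \<psi> where \<psi>: "continuous_map X X \<psi>" "\<And>x. x \<in> pts \<Longrightarrow> \<psi> (\<phi> x) = x" "\<And>y. y \<in> pts \<Longrightarrow> \<phi> (\<psi> y) = y"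
    using homeo unfolding homeomorphic_map_maps homeomorphic_maps_def by auto
  define \<theta> where "\<theta> q = \<phi> (rotX (\<psi> q))" for q
  have c: "continuous_map X X \<theta>"
    unfolding \<theta>_def using continuous_map_compose[OF continuous_map_compose[OF \<psi>(1) rotX_cont] cont] by (simp add: o_def)
  have \<theta>: "\<theta> q \<in> curve \<and> fst (\<theta> q) = fst q" if q: "q \<in> curve" for q
  proof -
    have q': "\<psi> q \<in> pts" using \<psi>(1) curve_pts[OF q] by (auto simp: continuous_map_def)
    have "\<psi> q \<noteq> p" using \<psi>(3)[OF curve_pts[OF q]] phi_p over_neq_om[OF q] by metis
    then have "rotX (\<psi> q) \<noteq> p" "fst (\<phi> (rotX (\<psi> q))) = fst (\<phi> (\<psi> q))"
      using rotX_p[OF q'] fst_phi_rotX[OF q'] by auto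
    then show ?thesis unfolding \<theta>_def using phi_curve rotX_pts[OF q'] \<psi>(3)[OF curve_pts[OF q]] by auto
  qed
  obtain j where j: "j < m" "\<And>q. q \<in> curve \<Longrightarrow> \<theta> q = (fst q, \<zeta> ^ j * snd q)"
    using deck_transformation[OF c \<theta>] by metis
  have rel: "\<phi> (rotX q) = (fst (\<phi> q), \<zeta> ^ j * snd (\<phi> q))" if q: "q \<in> pts" "q \<noteq> p" for q
    using j(2)[OF phi_curve[OF q]] \<psi>(2)[OF q(1)] by (simp add: \<theta>_def)
  have "openin X pts" by (metis openin_topspace topspace_X)
  then obtain q where q: "q \<in> over (- R)" "fst q \<notin> E" using generic_point p_pts finE by metis
  have qc: "q \<in> curve" using q(1) by simp
  have "j \<noteq> 0"
  proof
    assume "j = 0"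
    then have "\<phi> (rotX q) = \<phi> q" using rel[OF curve_pts[OF qc] pE[OF qc q(2)]] by simp
    then have "rotX q = q" using phi_inj rotX_pts curve_pts[OF qc] by blast
    then have "rot q = q" using rotX_curve[OF qc] by simp
    then have "\<zeta> * snd q = snd q" by (metis rot_snd)
    then show False using zeta_neq_1 snd_zero_iff[OF qc] q(1) by auto
  qed
  then show ?thesis using that j(1) rel by blast
qed

text \<open>A point fixed by the rotation goes to a point fixed by a nontrivial deck transformation,
  and there the second coordinate vanishes.\<close>

lemma ramified_preserved:
  assumes q: "q \<in> pts" "q \<noteq> p" "rotX q = q"
  shows "fst (\<phi> q) \<in> R"
proof -
  obtain j where j: "0 < j" "j < m" "\<And>q. \<lbrakk>q \<in> pts; q \<noteq> p\<rbrakk> \<Longrightarrow> \<phi> (rotX q) = (fst (\<phi> q), \<zeta> ^ j * snd (\<phi> q))"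
    using phi_rotX by metis
  have "\<zeta> ^ j * snd (\<phi> q) = snd (\<phi> q)" using j(3)[OF q(1,2)] q(3) by (metis snd_conv)
  then have "snd (\<phi> q) = 0" using zeta_pow_neq_1[OF j(1,2)] by auto
  then show ?thesis using snd_zero_iff[OF phi_curve[OF q(1,2)]] by simp
qed

lemma mobius_data:
  obtains \<alpha> \<beta> \<gamma> \<delta> where "\<alpha> * \<delta> - \<beta> * \<gamma> \<noteq> 0" "p = om \<and> \<gamma> = 0 \<and> \<delta> = 1 \<or> p \<noteq> om \<and> \<gamma> = 1"
    "\<And>b. \<lbrakk>b \<in> R; \<gamma> * b + \<delta> \<noteq> 0\<rbrakk> \<Longrightarrow> (\<alpha> * b + \<beta>) / (\<gamma> * b + \<delta>) \<in> R"
    "\<And>q. \<lbrakk>q \<in> curve; q \<noteq> p\<rbrakk> \<Longrightarrow> (\<gamma> * fst q + \<delta>) * fst (\<phi> q) = \<alpha> * fst q + \<beta>"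
proof -
  obtain \<alpha> \<beta> where ab: "\<And>q. \<lbrakk>q \<in> curve; q \<noteq> p\<rbrakk> \<Longrightarrow> W (fst q) * fst (\<phi> q) = \<alpha> * fst q + \<beta>"
    using mobius by metis
  define \<gamma> :: complex where "\<gamma> = (if p = om then 0 else 1)"
  define \<delta> where "\<delta> = (if p = om then 1 else - fst p)"
  have W: "W z = \<gamma> * z + \<delta>" for z using p_ramified by (auto simp: W_def \<gamma>_def \<delta>_def)
  show ?thesis
  proof (rule that[of \<alpha> \<delta> \<beta> \<gamma>])
    show "p = om \<and> \<gamma> = 0 \<and> \<delta> = 1 \<or> p \<noteq> om \<and> \<gamma> = 1" by (auto simp: \<gamma>_def \<delta>_def)
    show eq: "(\<gamma> * fst q + \<delta>) * fst (\<phi> q) = \<alpha> * fst q + \<beta>" if "q \<in> curve" "q \<noteq> p" for q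
      using ab[OF that] W by simp
    show "(\<alpha> * b + \<beta>) / (\<gamma> * b + \<delta>) \<in> R" if b: "b \<in> R" "\<gamma> * b + \<delta> \<noteq> 0" for b
    proof -
      have q: "(b, 0) \<in> curve" using b(1) m_pos by (simp add: Q_eq_0_iff[THEN iffD2] zero_power)
      have "(b, 0) \<noteq> p"
      proof
        assume e: "(b, 0) = p"
        then have "p \<noteq> om" using over_neq_om[OF q] by metis
        moreover have "fst p = b" by (metis e fst_conv)
        ultimately show False using b(2) by (simp add: \<gamma>_def \<delta>_def)
      qed
      moreover have "rotX (b, 0) = (b, 0)" using rotX_curve[OF q] by (simp add: rot_def)
      ultimately have "fst (\<phi> (b, 0)) \<in> R" "(\<gamma> * b + \<delta>) * fst (\<phi> (b, 0)) = \<alpha> * b + \<beta>"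
        using ramified_preserved[OF curve_pts[OF q]] eq[OF q] by auto
      then show ?thesis using b(2) by (metis nonzero_mult_div_cancel_left)
    qed
    show "\<alpha> * \<delta> - \<beta> * \<gamma> \<noteq> 0"
    proof
      \<comment> \<open>A degenerate map would make the first coordinate of \<phi> constant on the
        affine curve off \<open>p\<close>, contradicting surjectivity.\<close>
      assume d: "\<alpha> * \<delta> - \<beta> * \<gamma> = 0"
      obtain k where k: "\<And>q. \<lbrakk>q \<in> curve; q \<noteq> p\<rbrakk> \<Longrightarrow> fst (\<phi> q) = k"
      proof (cases "p = om")
        case True
        then have "\<alpha> = 0" using d by (simp add: \<gamma>_def \<delta>_def)
        then show ?thesis using eq True that by (simp add: \<gamma>_def \<delta>_def)
      next
        case False
        then have "\<beta> = \<alpha> * \<delta>" using d by (simp add: \<gamma>_def)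
        then have Wa: "W (fst q) * fst (\<phi> q) = W (fst q) * \<alpha>" if "q \<in> curve" "q \<noteq> p" for q
          using ab[OF that] False by (simp add: W \<gamma>_def algebra_simps)
        have "fst (\<phi> q) = \<alpha>" if "q \<in> curve" "q \<noteq> p" for q
          using W_nonzero'[OF that] Wa[OF that] mult_left_cancel by blast
        then show ?thesis using that by blast
      qed
      \<comment> \<open>The value at \<open>om\<close> is avoided separately, because
        \<open>k\<close> describes \<phi> only at affine points.\<close>
      have "\<exists>z. z \<notin> {k, fst (\<phi> om)}" by (rule ex_new_if_finite[OF infinite_UNIV_char_0]) simp
      then obtain z where z: "z \<notin> {k, fst (\<phi> om)}" by (rule exE)
      have "\<exists>w. w ^ m = Q z" by (rule over_fiber_nonempty)
      then obtain w where "w ^ m = Q z" by (rule exE)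
      then have w: "(z, w) \<in> curve" by simp
      have "(z, w) \<in> \<phi> ` pts" using bij curve_pts[OF w] by (simp only: bij_betw_def)
      then obtain q where q: "q \<in> pts" "\<phi> q = (z, w)" by (rule imageE) (rule that[OF _ HOL.sym])
      have qp: "q \<noteq> p"
      proof
        assume "q = p"
        from subst[where P = "\<lambda>u. \<phi> u = (z, w)", OF this q(2)] have "\<phi> p = (z, w)" .
        with phi_p have "om = (z, w)" by (rule HOL.trans[OF HOL.sym])
        with over_neq_om[OF w] show False by (rule notE[OF _ HOL.sym])
      qed
      have "q \<noteq> om"
      proof
        assume "q = om"
        from subst[where P = "\<lambda>u. \<phi> u = (z, w)", OF this q(2)] have "\<phi> om = (z, w)" .
        then have "fst (\<phi> om) = z" by (metis fst_conv)
        then show False using z by simp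
      qed
      from k[OF pts_cases[OF q(1) this] qp] show False using q(2) z by simp
    qed
  qed
qed

lemma conformal_rotation:
  assumes "R = branch_points l" "l \<ge> 6"
  obtains j where "j < m" "\<phi> om = om" "\<And>q. q \<in> curve \<Longrightarrow> \<phi> q = (fst q, \<zeta> ^ j * snd q)"
proof -
  obtain \<alpha> \<beta> \<gamma> \<delta> where d: "\<alpha> * \<delta> - \<beta> * \<gamma> \<noteq> 0" "p = om \<and> \<gamma> = 0 \<and> \<delta> = 1 \<or> p \<noteq> om \<and> \<gamma> = 1"
    "\<And>b. \<lbrakk>b \<in> R; \<gamma> * b + \<delta> \<noteq> 0\<rbrakk> \<Longrightarrow> (\<alpha> * b + \<beta>) / (\<gamma> * b + \<delta>) \<in> R"
    "\<And>q. \<lbrakk>q \<in> curve; q \<noteq> p\<rbrakk> \<Longrightarrow> (\<gamma> * fst q + \<delta>) * fst (\<phi> q) = \<alpha> * fst q + \<beta>"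
    using mobius_data by metis
  have "\<gamma> = 0 \<and> \<alpha> = \<delta> \<and> \<beta> = 0"
    by (rule branch_points_rigid[OF assms(2) d(1)]) (use d(2,3) assms(1) in auto)
  then have po: "p = om" and e: "\<gamma> = 0" "\<delta> = 1" "\<alpha> = 1" "\<beta> = 0" using d(2) by auto
  have c: "fst (\<phi> q) = fst q" if q: "q \<in> curve" for q
    using d(4)[OF q] over_neq_om[OF q] po e by simp
  have "\<phi> q \<in> curve \<and> fst (\<phi> q) = fst q" if "q \<in> curve" for q
    using phi_curve[OF curve_pts[OF that]] c[OF that] over_neq_om[OF that] po by simp
  then obtain j where "j < m" "\<And>q. q \<in> curve \<Longrightarrow> \<phi> q = (fst q, \<zeta> ^ j * snd q)"
    using deck_transformation[OF cont] by metis
  then show ?thesis using that phi_p po by metis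
qed

end

section \<open>The dicyclic group\<close>

text \<open>Only the relations are assumed, so collapse is possible. Both the presented group and
  the group of bijections of the surface are instances, and the isomorphism compares their normal
  forms.\<close>

locale dicyclic_relators = group G for G (structure) +
  fixes x y and n :: nat
  assumes x: "x \<in> carrier G" and y: "y \<in> carrier G" and n: "n > 0"
    and x_order: "x [^] (2 * n) = \<one>" and y_square: "y \<otimes> y = x [^] n" and y_x: "y \<otimes> x = inv x \<otimes> y"
begin

definition normal_forms :: "'a set" where
  "normal_forms = range (\<lambda>i::nat. x [^] i) \<union> range (\<lambda>i::nat. x [^] i \<otimes> y)"

lemma inv_x: "inv x = x [^] (2 * n - 1)"
proof -
  have "x [^] (2 * n - 1) \<otimes> x = x [^] Suc (2 * n - 1)" by simp
  also have "Suc (2 * n - 1) = 2 * n" using n by simp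
  finally show ?thesis using inv_equality x x_order by simp
qed

lemma x_pow_mod: "x [^] (i mod (2 * n)) = x [^] i"
proof -
  have "x [^] (2 * n * (i div (2 * n))) = \<one>"
    using nat_pow_pow[OF x, of "2 * n" "i div (2 * n)"] by (simp add: x_order)
  then have "x [^] (2 * n * (i div (2 * n)) + i mod (2 * n)) = x [^] (i mod (2 * n))"
    unfolding nat_pow_mult[OF x, symmetric] using x by simp
  then show ?thesis by (simp only: mult_div_mod_eq)
qed

lemma y_x_pow: "y \<otimes> x [^] i = (inv x) [^] i \<otimes> y" for i :: nat
proof (induction i)
  case 0 then show ?case using y by simp
next
  case (Suc i)
  have "y \<otimes> x [^] Suc i = (y \<otimes> x [^] i) \<otimes> x" using x y by (simp add: m_assoc)
  also have "\<dots> = (inv x) [^] i \<otimes> (y \<otimes> x)" using Suc x y by (simp add: m_assoc)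
  finally show ?case using x y by (simp add: y_x m_assoc)
qed

lemma y_x_pow': "y \<otimes> x [^] i = x [^] ((2 * n - 1) * i) \<otimes> y" for i :: nat
  using y_x_pow[of i] nat_pow_pow[OF x] by (simp add: inv_x)

lemma inv_y: "inv y = x [^] n \<otimes> y"
proof -
  have "x [^] n \<otimes> y \<otimes> y = x [^] (n + n)" using x y by (simp add: m_assoc y_square nat_pow_mult)
  then show ?thesis using x_order x y by (intro inv_equality) (simp_all add: mult_2)
qed

lemma generate_x: "generate G {x} = range (\<lambda>i::nat. x [^] i)"
proof
  show "generate G {x} \<subseteq> range (\<lambda>i::nat. x [^] i)"
  proof
    fix a assume "a \<in> generate G {x}"
    then obtain k :: int where k: "a = x [^] k" unfolding generate_pow[OF x] by blast
    show "a \<in> range (\<lambda>i::nat. x [^] i)"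
    proof (cases k rule: int_cases2)
      case (nonneg i)
      then have "a = x [^] i" using k by (simp add: int_pow_int)
      then show ?thesis by blast
    next
      case (nonpos i)
      then have "a = inv x [^] i" using k x by (simp add: int_pow_neg_int nat_pow_inv)
      then have "a = x [^] ((2 * n - 1) * i)" unfolding inv_x nat_pow_pow[OF x] .
      then show ?thesis by blast
    qed
  qed
  show "range (\<lambda>i::nat. x [^] i) \<subseteq> generate G {x}"
    unfolding generate_pow[OF x] by clarsimp (metis int_pow_int)
qed

text \<open>Moving \<open>y\<close> past a power of \<open>x\<close> inverts that power, so the two
  powers cancel and \<open>y \<otimes> y\<close> is left. This excludes involutions outside the
  cyclic group when \<open>x [^] n\<close> is not the identity.\<close>

lemma square_outside: "(x [^] i \<otimes> y) \<otimes> (x [^] i \<otimes> y) = x [^] n" for i :: nat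
proof -
  have "(x [^] i \<otimes> y) \<otimes> (x [^] i \<otimes> y) = x [^] i \<otimes> (y \<otimes> x [^] i) \<otimes> y" using x y by (simp add: m_assoc)
  also have "\<dots> = (x [^] i \<otimes> inv x [^] i) \<otimes> (y \<otimes> y)" unfolding y_x_pow using x y by (simp add: m_assoc)
  also have "x [^] i \<otimes> inv x [^] i = \<one>" using x nat_pow_inv[of x i] by simp
  finally show ?thesis using x by (simp add: y_square)
qed

lemma normal_forms_x: "s \<in> normal_forms \<Longrightarrow> x [^] k \<otimes> s \<in> normal_forms" for k :: nat
  using x y by (auto simp: normal_forms_def nat_pow_mult simp flip: m_assoc)

lemma normal_forms_y:
  assumes "s \<in> normal_forms" shows "y \<otimes> s \<in> normal_forms"
proof -
  consider i :: nat where "s = x [^] i" | i :: nat where "s = x [^] i \<otimes> y"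
    using assms by (auto simp: normal_forms_def)
  then show ?thesis
  proof cases
    case 1 then show ?thesis using y_x_pow' by (auto simp: normal_forms_def)
  next
    case (2 i)
    have "y \<otimes> s = y \<otimes> x [^] i \<otimes> y" using 2 x y by (simp add: m_assoc)
    also have "\<dots> = x [^] ((2 * n - 1) * i) \<otimes> (y \<otimes> y)" unfolding y_x_pow' using x y by (simp add: m_assoc)
    finally show ?thesis using x by (auto simp: normal_forms_def y_square nat_pow_mult)
  qed
qed

lemma normal_forms_closed:
  "s \<in> normal_forms \<Longrightarrow> a \<in> {x, inv x, y, inv y} \<Longrightarrow> a \<otimes> s \<in> normal_forms"
proof -
  assume s: "s \<in> normal_forms" "a \<in> {x, inv x, y, inv y}"
  have c: "s \<in> carrier G" using s(1) x y by (auto simp: normal_forms_def)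
  show ?thesis
    using s(2) normal_forms_x[OF s(1), of 1] normal_forms_x[OF s(1), of "2 * n - 1"]
      normal_forms_y[OF s(1)] normal_forms_x[OF normal_forms_y[OF s(1)], of n] x y c
    by (auto simp: inv_x inv_y m_assoc)
qed

text \<open>Used to solve for an anticonformal map whose composite with \<open>y\<close> is known to
  be a rotation.\<close>

lemma normal_forms_inverse: "\<lbrakk>s \<in> carrier G; y \<otimes> s = x [^] (i::nat)\<rbrakk> \<Longrightarrow> \<exists>k::nat. s = x [^] k \<otimes> y"
proof -
  assume s: "s \<in> carrier G" "y \<otimes> s = x [^] i"
  have "s = inv y \<otimes> (y \<otimes> s)" using s(1) y by (simp flip: m_assoc)
  also have "\<dots> = x [^] n \<otimes> (y \<otimes> x [^] i)" using s(2) x y by (simp add: inv_y m_assoc)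
  also have "\<dots> = x [^] (n + (2 * n - 1) * i) \<otimes> y"
    unfolding y_x_pow' using x y by (simp add: nat_pow_mult flip: m_assoc)
  finally show ?thesis by blast
qed

end

section \<open>Normal forms in the presented group\<close>

definition dicyclic_y :: "nat \<Rightarrow> dicyclic_gen word set" where
  "dicyclic_y n = word_class (dicyclic_relations n) [(Gen_y, False)]"

context
  fixes n :: nat assumes n: "n > 0"
begin

lemma word_class_mult: "word_class (dicyclic_relations n) u \<otimes>\<^bsub>dicyclic_group n\<^esub> word_class (dicyclic_relations n) v =
    word_class (dicyclic_relations n) (u @ v)"
  by (simp add: dicyclic_group_def presented_group_mult)

lemma word_class_carrier: "word_class (dicyclic_relations n) u \<in> carrier (dicyclic_group n)"
  and carrier_dicyclic: "carrier (dicyclic_group n) = range (word_class (dicyclic_relations n))"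
  and one_dicyclic: "\<one>\<^bsub>dicyclic_group n\<^esub> = word_class (dicyclic_relations n) []"
  by (simp_all add: dicyclic_group_def presented_group_def)

lemma word_class_replicate: "word_class (dicyclic_relations n) [g] [^]\<^bsub>dicyclic_group n\<^esub> (k::nat) =
    word_class (dicyclic_relations n) (replicate k g)"
proof -
  interpret group "dicyclic_group n" by (simp add: dicyclic_group_def group_presented_group)
  show ?thesis
    by (induction k) (auto simp: one_dicyclic word_class_mult simp flip: replicate_append_same)
qed

lemma word_class_relation: "(u, v) \<in> dicyclic_relations n \<Longrightarrow>
    word_class (dicyclic_relations n) u = word_class (dicyclic_relations n) v"
  by (simp add: word_class_eq_iff word_equiv.relation)

lemma word_class_inv: "inv\<^bsub>dicyclic_group n\<^esub> word_class (dicyclic_relations n) [(g, b)] = word_class (dicyclic_relations n) [(g, \<not> b)]"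
proof -
  interpret group "dicyclic_group n" by (simp add: dicyclic_group_def group_presented_group)
  have "word_class (dicyclic_relations n) [(g, \<not> b), (g, b)] = word_class (dicyclic_relations n) []"
    using word_equiv.cancel[of "dicyclic_relations n" g "\<not> b"] by (simp add: word_class_eq_iff)
  then show ?thesis by (intro inv_equality) (simp_all add: word_class_mult one_dicyclic word_class_carrier)
qed

lemma dicyclic_relators_dicyclic_group: "dicyclic_relators (dicyclic_group n) (dicyclic_x n) (dicyclic_y n) n"
proof -
  interpret group "dicyclic_group n" by (simp add: dicyclic_group_def group_presented_group)
  show ?thesis
  proof
    show "dicyclic_x n \<in> carrier (dicyclic_group n)" "dicyclic_y n \<in> carrier (dicyclic_group n)"
      by (simp_all add: dicyclic_x_def dicyclic_y_def word_class_carrier)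
    show "n > 0" by (rule n)
    show "dicyclic_x n [^]\<^bsub>dicyclic_group n\<^esub> (2 * n) = \<one>\<^bsub>dicyclic_group n\<^esub>"
      unfolding dicyclic_x_def word_class_replicate one_dicyclic by (rule word_class_relation) (simp add: dicyclic_relations_def)
    show "dicyclic_y n \<otimes>\<^bsub>dicyclic_group n\<^esub> dicyclic_y n = dicyclic_x n [^]\<^bsub>dicyclic_group n\<^esub> n"
      unfolding dicyclic_x_def dicyclic_y_def word_class_replicate word_class_mult
      by (rule word_class_relation) (simp add: dicyclic_relations_def)
    have "word_class (dicyclic_relations n) [(Gen_y, False), (Gen_x, False), (Gen_y, True)] =
        word_class (dicyclic_relations n) [(Gen_x, True)]"
      by (rule word_class_relation) (simp add: dicyclic_relations_def)
    then have "(word_class (dicyclic_relations n) [(Gen_y, False)]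
        \<otimes>\<^bsub>dicyclic_group n\<^esub> word_class (dicyclic_relations n) [(Gen_x, False)])
        \<otimes>\<^bsub>dicyclic_group n\<^esub> inv\<^bsub>dicyclic_group n\<^esub> (word_class (dicyclic_relations n) [(Gen_y, False)]) =
        inv\<^bsub>dicyclic_group n\<^esub> (word_class (dicyclic_relations n) [(Gen_x, False)])"
      by (simp add: word_class_inv word_class_mult)
    then show "dicyclic_y n \<otimes>\<^bsub>dicyclic_group n\<^esub> dicyclic_x n = inv\<^bsub>dicyclic_group n\<^esub> dicyclic_x n \<otimes>\<^bsub>dicyclic_group n\<^esub> dicyclic_y n"
      unfolding dicyclic_x_def dicyclic_y_def by (metis inv_closed inv_solve_right m_closed word_class_carrier)
  qed
qed

text \<open>Words are built up letter by letter, and left multiplication by a generator or its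
  inverse keeps the normal forms.\<close>

lemma carrier_dicyclic_group: "carrier (dicyclic_group n) = dicyclic_relators.normal_forms (dicyclic_group n) (dicyclic_x n) (dicyclic_y n)"
proof
  interpret D: dicyclic_relators "dicyclic_group n" "dicyclic_x n" "dicyclic_y n" n by (rule dicyclic_relators_dicyclic_group)
  show "D.normal_forms \<subseteq> carrier (dicyclic_group n)" using D.x D.y by (auto simp: D.normal_forms_def)
  have "word_class (dicyclic_relations n) u \<in> D.normal_forms" for u
  proof (induction u)
    case Nil
    have "dicyclic_x n [^]\<^bsub>dicyclic_group n\<^esub> (0::nat) \<in> D.normal_forms" unfolding D.normal_forms_def by blast
    then show ?case by (simp add: one_dicyclic)
  next
    case (Cons a u)
    obtain g b where a: "a = (g, b)" by (cases a)
    have "word_class (dicyclic_relations n) [a] \<in> {dicyclic_x n, inv\<^bsub>dicyclic_group n\<^esub> (dicyclic_x n), dicyclic_y n, inv\<^bsub>dicyclic_group n\<^esub> (dicyclic_y n)}"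
      unfolding a dicyclic_x_def dicyclic_y_def word_class_inv by (cases g; cases b) auto
    then have "word_class (dicyclic_relations n) [a] \<otimes>\<^bsub>dicyclic_group n\<^esub> word_class (dicyclic_relations n) u \<in> D.normal_forms" by (rule D.normal_forms_closed[OF Cons])
    then show ?case by (simp add: word_class_mult)
  qed
  then show "carrier (dicyclic_group n) \<subseteq> D.normal_forms" by (auto simp: carrier_dicyclic)
qed

end

section \<open>Evaluation of words and the isomorphism\<close>

context dicyclic_relators begin

fun gen_value :: "dicyclic_gen \<Rightarrow> 'a" where
  "gen_value Gen_x = x" | "gen_value Gen_y = y"

fun word_value :: "dicyclic_gen word \<Rightarrow> 'a" where
  "word_value [] = \<one>"
| "word_value ((g, b) # u) = (if b then inv (gen_value g) else gen_value g) \<otimes> word_value u"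

lemma gen_value_carrier [simp]: "gen_value g \<in> carrier G" using x y by (cases g) auto

lemma word_value_carrier [simp]: "word_value u \<in> carrier G"
  by (induction u rule: word_value.induct) auto

lemma word_value_append: "word_value (u @ v) = word_value u \<otimes> word_value v"
  by (induction u rule: word_value.induct) (auto simp: m_assoc)

lemma word_value_replicate: "word_value (replicate k (Gen_x, False)) = x [^] k"
  using nat_pow_Suc2[OF x] by (induction k) auto

lemma word_value_relation: "(u, v) \<in> dicyclic_relations n \<Longrightarrow> word_value u = word_value v"
proof -
  have "y \<otimes> (x \<otimes> inv y) = inv x"
    using y_x x y by (metis inv_closed inv_solve_right' m_assoc m_closed)
  then show "(u, v) \<in> dicyclic_relations n \<Longrightarrow> word_value u = word_value v"
    using x y x_order y_square by (auto simp: dicyclic_relations_def word_value_replicate)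
qed

lemma word_value_equiv: "word_equiv (dicyclic_relations n) u v \<Longrightarrow> word_value u = word_value v"
proof (induction rule: word_equiv.induct)
  case (relation u v) then show ?case by (rule word_value_relation)
next
  case (cancel g b) then show ?case by auto
qed (auto simp: word_value_append)

text \<open>The choice of a word is harmless, as equivalent words have equal values.\<close>

definition class_value :: "dicyclic_gen word set \<Rightarrow> 'a" where
  "class_value P = word_value (SOME u. u \<in> P)"

lemma class_value: "class_value (word_class (dicyclic_relations n) u) = word_value u"
proof -
  have "u \<in> word_class (dicyclic_relations n) u" by (simp add: word_class_def word_equiv.refl)
  then have "(SOME v. v \<in> word_class (dicyclic_relations n) u) \<in> word_class (dicyclic_relations n) u"
    by (rule someI)
  then show ?thesis unfolding class_value_def word_class_def using word_value_equiv by fastforce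
qed

text \<open>Evaluation maps the normal forms of the presented group onto those of \<open>G\<close>.
  A normal form of value 1 is either a power of \<open>x\<close>, trivial by the first assumption,
  or it exhibits \<open>y\<close> as a power of \<open>x\<close>, against the second. The
  isomorphism is the inverse of evaluation.\<close>

lemma dicyclic_group_iso:
  assumes inj: "\<And>i. \<lbrakk>0 < i; i < 2 * n\<rbrakk> \<Longrightarrow> x [^] i \<noteq> \<one>" "\<And>i::nat. x [^] i \<noteq> y"
  shows "\<exists>\<Phi> \<in> iso (G\<lparr>carrier := normal_forms\<rparr>) (dicyclic_group n).
    \<Phi> ` range (\<lambda>i::nat. x [^] i) = generate (dicyclic_group n) {dicyclic_x n}"
proof -
  let ?D = "dicyclic_group n"
  let ?N = "G\<lparr>carrier := normal_forms\<rparr>"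
  interpret D: dicyclic_relators ?D "dicyclic_x n" "dicyclic_y n" n
    by (rule dicyclic_relators_dicyclic_group[OF n])
  have hom: "class_value \<in> hom ?D G"
    by (intro homI) (auto simp: carrier_dicyclic[OF n] word_class_mult[OF n] class_value word_value_append)
  interpret H: group_hom ?D G class_value
    by (intro group_hom.intro D.is_group is_group group_hom_axioms.intro hom)
  have vx: "class_value (dicyclic_x n [^]\<^bsub>?D\<^esub> i) = x [^] i" for i :: nat
    using H.hom_nat_pow[OF D.x] x by (simp add: dicyclic_x_def class_value)
  have vy: "class_value (dicyclic_y n) = y" using y by (simp add: dicyclic_y_def class_value)
  have vxy: "class_value (dicyclic_x n [^]\<^bsub>?D\<^esub> i \<otimes>\<^bsub>?D\<^esub> dicyclic_y n) = x [^] i \<otimes> y" for i :: nat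
    using D.x D.y by (simp add: vx vy)
  have carD: "carrier ?D = D.normal_forms" by (rule carrier_dicyclic_group[OF n])
  have img: "class_value ` carrier ?D = normal_forms"
    unfolding carD unfolding D.normal_forms_def normal_forms_def image_Un image_image vx vxy ..
  have "inj_on class_value (carrier ?D)"
    unfolding H.inj_on_one_iff
  proof (intro allI impI)
    fix a assume a: "a \<in> carrier ?D" "class_value a = \<one>"
    then consider i :: nat where "a = dicyclic_x n [^]\<^bsub>?D\<^esub> i" | i :: nat where "a = dicyclic_x n [^]\<^bsub>?D\<^esub> i \<otimes>\<^bsub>?D\<^esub> dicyclic_y n"
      unfolding carD D.normal_forms_def by blast
    then show "a = \<one>\<^bsub>?D\<^esub>"
    proof cases
      case (1 i)
      then have "x [^] (i mod (2 * n)) = \<one>" using a(2) vx x_pow_mod by simp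
      then have "i mod (2 * n) = 0" using inj(1)[of "i mod (2 * n)"] n by fastforce
      then show ?thesis using 1 D.x_pow_mod[of i] by simp
    next
      case (2 i)
      then have "x [^] i \<otimes> y = \<one>" using a(2) vxy by simp
      then have "inv x [^] i = y" 
        using inv_equality[OF inv_comm, of "x [^] i" y] x y by (simp add: nat_pow_inv)
      then show ?thesis using inj(2)[of "(2 * n - 1) * i"] nat_pow_pow[OF x] by (simp add: inv_x)
    qed
  qed
  then have "bij_betw class_value (carrier ?D) (carrier ?N)" using img by (simp add: bij_betw_def)
  then have iso: "class_value \<in> iso ?D ?N" using hom by (auto simp: iso_def hom_def bij_betw_def)
  have "inv_into (carrier ?D) class_value \<in> iso ?N ?D" by (rule D.iso_set_sym[OF iso])
  moreover have "inv_into (carrier ?D) class_value ` range (\<lambda>i::nat. x [^] i) = generate ?D {dicyclic_x n}"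
  proof -
    have fin: "range (\<lambda>i::nat. dicyclic_x n [^]\<^bsub>?D\<^esub> i) = generate ?D {dicyclic_x n}"
      by (rule D.generate_x[symmetric])
    have "range (\<lambda>i::nat. x [^] i) = class_value ` generate ?D {dicyclic_x n}"
      unfolding fin[symmetric] image_image vx ..
    then show ?thesis
      using \<open>inj_on class_value (carrier ?D)\<close> D.generate_incl[of "{dicyclic_x n}"] D.x
      by (simp add: inv_into_image_cancel)
  qed
  ultimately show ?thesis by blast
qed

end

section \<open>The anticonformal automorphisms\<close>

context cyclic_curve begin

lemma anticonformal_chart_holo:
  assumes f: "anticonformal_automorphism X atlas f" and i: "i \<in> I" and j: "j \<in> I"
  shows "(\<lambda>s. cnj (cc j (f (cp i s)))) holomorphic_on {s \<in> cD i. f (cp i s) \<in> cU j}"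
proof -
  have cont: "continuous_map X X f"
    using f homeomorphic_imp_continuous_map unfolding anticonformal_automorphism_def by blast
  have "(cU i, cc i) \<in> atlas" "(cU j, cc j) \<in> atlas" using i j by (auto simp: atlas_def)
  then have "(cnj \<circ> cc j \<circ> f \<circ> inv_into (cU i) (cc i)) holomorphic_on cc i ` {p \<in> cU i. f p \<in> cU j}"
    using f unfolding anticonformal_automorphism_def by blast
  then show ?thesis
    unfolding chart_domain_open(2)[OF cont i j]
    by (rule holomorphic_transform) (simp add: inv_into_cc[OF i])
qed

lemma conformal_automorphismI:
  assumes "f \<in> Bij pts" "homeomorphic_map X X f"
    and "\<And>i j. \<lbrakk>i \<in> I; j \<in> I\<rbrakk> \<Longrightarrow>
      (cc j \<circ> f \<circ> inv_into (cU i) (cc i)) holomorphic_on cc i ` {p \<in> cU i. f p \<in> cU j}"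
  shows "conformal_automorphism X atlas f"
  using assms by (simp add: conformal_automorphism_def atlas_def)

lemma anticonformal_automorphismI:
  assumes "f \<in> Bij pts" "homeomorphic_map X X f"
    and "\<And>i j. \<lbrakk>i \<in> I; j \<in> I\<rbrakk> \<Longrightarrow>
      (cnj \<circ> cc j \<circ> f \<circ> inv_into (cU i) (cc i)) holomorphic_on cc i ` {p \<in> cU i. f p \<in> cU j}"
  shows "anticonformal_automorphism X atlas f"
  using assms by (simp add: anticonformal_automorphism_def atlas_def)

text \<open>An anticonformal map is holomorphic after conjugating the target coordinate. Conjugating
  the holomorphic expression of \<open>g\<close> on both sides makes it composable with that of
  \<open>f\<close>, and the conjugations cancel.\<close>

lemma conformal_comp:
  assumes f: "anticonformal_automorphism X atlas f" and g: "anticonformal_automorphism X atlas g"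
  shows "conformal_automorphism X atlas (compose pts g f)"
proof (rule conformal_automorphismI)
  have B: "f \<in> Bij pts" "g \<in> Bij pts" and h: "homeomorphic_map X X f" "homeomorphic_map X X g"
    using f g by (auto simp: anticonformal_automorphism_def)
  show "compose pts g f \<in> Bij pts" using compose_Bij B by blast
  have fp: "f p \<in> pts" if "p \<in> pts" for p using Bij_imp_funcset[OF B(1)] that by blast
  have "homeomorphic_map X X (g \<circ> f)" using homeomorphic_map_compose h by blast
  then show hc: "homeomorphic_map X X (compose pts g f)"
    by (rule homeomorphic_map_eq) (simp add: compose_def)
  have cont: "continuous_map X X f" "continuous_map X X g" "continuous_map X X (compose pts g f)"
    using h hc homeomorphic_imp_continuous_map by blast+
  fix i k assume i: "i \<in> I" and k: "k \<in> I"
  have cpp: "cp i s \<in> pts" if "s \<in> cD i" for s using cp_in[OF i that] cU_subset[OF i] by blast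
  let ?D = "{s \<in> cD i. compose pts g f (cp i s) \<in> cU k}"
  have "(\<lambda>s. cc k (g (f (cp i s)))) holomorphic_on ?D"
    unfolding holomorphic_on_def
  proof
    fix s0 assume s0: "s0 \<in> ?D"
    show "(\<lambda>s. cc k (g (f (cp i s)))) field_differentiable (at s0 within ?D)"
    proof -
      obtain j where j: "j \<in> I" "f (cp i s0) \<in> cU j" using cU_cover fp cpp s0 by blast
      define T where "T = {s \<in> cD i. f (cp i s) \<in> cU j} \<inter> ?D"
      have T: "open T" unfolding T_def using chart_domain_open(1)[OF cont(1) i j(1)] chart_domain_open(1)[OF cont(3) i k] by blast
      let ?h1 = "\<lambda>s. cnj (cc j (f (cp i s)))"
      let ?h2 = "\<lambda>s. cnj (cc k (g (cp j s)))"
      let ?D2 = "{s \<in> cD j. g (cp j s) \<in> cU k}"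
      have h1: "?h1 holomorphic_on T"
        using anticonformal_chart_holo[OF f i j(1)] by (rule holomorphic_on_subset) (auto simp: T_def)
      have D2: "open ?D2" by (rule chart_domain_open(1)[OF cont(2) j(1) k])
      then have "open (cnj ` ?D2)"
      proof -
        have "cnj ` ?D2 = cnj -` ?D2" by (auto simp: image_iff) (metis complex_cnj_cnj)+
        then show ?thesis using open_vimage[OF D2, of cnj] by (simp add: continuous_on_cnj continuous_on_id)
      qed
      then have "(cnj \<circ> ?h2 \<circ> cnj) holomorphic_on cnj ` ?D2"
        using anticonformal_chart_holo[OF g j(1) k] 
        by (intro holomorphic_on_compose_cnj_cnj) (auto simp: image_image)
      moreover have "?h1 ` T \<subseteq> cnj ` ?D2"
      proof
        fix z assume "z \<in> ?h1 ` T"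
        then obtain s where s: "s \<in> T" "z = ?h1 s" by blast
        have "s \<in> cD i" "f (cp i s) \<in> cU j" "g (f (cp i s)) \<in> cU k"
          using s(1) cpp by (auto simp: T_def compose_def)
        then have "cc j (f (cp i s)) \<in> ?D2" using cc_in[OF j(1)] cp_cc[OF j(1)] by simp
        then show "z \<in> cnj ` ?D2" using s(2) by blast
      qed
      ultimately have "((cnj \<circ> ?h2 \<circ> cnj) \<circ> ?h1) holomorphic_on T"
        using holomorphic_on_compose_gen[OF h1] by blast
      then have "(\<lambda>s. cc k (g (f (cp i s)))) holomorphic_on T"
        by (rule holomorphic_transform) (use cp_cc[OF j(1)] in \<open>auto simp: T_def\<close>)
      moreover have "s0 \<in> T" using s0 j by (auto simp: T_def)
      ultimately have "(\<lambda>s. cc k (g (f (cp i s)))) field_differentiable (at s0)"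
        by (rule holomorphic_on_imp_differentiable_at[OF _ T])
      then show ?thesis by (rule field_differentiable_at_within)
    qed
  qed
  then show "(cc k \<circ> compose pts g f \<circ> inv_into (cU i) (cc i)) holomorphic_on cc i ` {p \<in> cU i. compose pts g f p \<in> cU k}"
    unfolding chart_domain_open(2)[OF cont(3) i k]
    by (rule holomorphic_transform) (use cpp in \<open>simp add: inv_into_cc[OF i] compose_def\<close>)
qed

lemma homeomorphic_X_Bij:
  assumes "f \<in> Bij pts" "continuous_map X X f" shows "homeomorphic_map X X f"
  using assms by (intro continuous_imp_homeomorphic_map compact_X Hausdorff_X) (auto simp: Bij_def bij_betw_def)

lemma neighborhood_om:
  assumes U: "openin X U" "om \<in> U"
  obtains B where "B > 0" "over {z. norm z > B} \<subseteq> U"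
proof -
  have "compact (curve - U)" using U by (simp add: openin_X)
  then have "compact (fst ` (curve - U))" by (intro compact_continuous_image continuous_intros)
  then obtain B where B: "B > 0" "\<And>z. z \<in> fst ` (curve - U) \<Longrightarrow> norm z \<le> B"
    using compact_imp_bounded bounded_pos by metis
  have "over {z. norm z > B} \<subseteq> U"
  proof
    fix p assume p: "p \<in> over {z. norm z > B}"
    show "p \<in> U"
    proof (rule ccontr)
      assume "p \<notin> U"
      then have "norm (fst p) \<le> B" using p by (intro B(2)) auto
      then show False using p by simp
    qed
  qed
  then show ?thesis using that B(1) by blast
qed

text \<open>The fibre over a root is a single point. So the compact part of the curve near
  \<open>a\<close> that misses \<open>U\<close> projects to a closed set avoiding
  \<open>a\<close>.\<close>

lemma neighborhood_ramified:
  assumes U: "openin X U" "(a, 0) \<in> U" and a: "a \<in> R"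
  obtains r where "r > 0" "over (ball a r) \<subseteq> U"
proof -
  let ?C = "over (cball a 1) - U"
  have "openin (top_of_set curve) (U - {om})" using U by (simp add: openin_X)
  then obtain V where V: "open V" "U - {om} = curve \<inter> V" by (auto simp: openin_open)
  have "?C = over (cball a 1) - V" using V(2) over_neq_om by auto
  then have "compact ?C" using compact_over[of "cball a 1"] V(1) compact_diff by simp
  then have c: "closed (fst ` ?C)"
    by (intro compact_imp_closed compact_continuous_image continuous_intros)
  have "a \<notin> fst ` ?C"
  proof
    assume "a \<in> fst ` ?C"
    then obtain w where "(a, w) \<in> over (cball a 1)" "(a, w) \<notin> U" by auto
    moreover from this have "w = 0" using a m_pos by (simp add: Q_eq_0_iff[THEN iffD2])
    ultimately show False using U(2) by simp
  qed
  then obtain r where r: "r > 0" "ball a r \<subseteq> - fst ` ?C"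
    using c by (meson ComplI open_Compl open_contains_ball)
  have "over (ball a (min r 1)) \<subseteq> U"
  proof
    fix p assume p: "p \<in> over (ball a (min r 1))"
    then have "fst p \<notin> fst ` ?C" using r(2) by auto
    moreover have "p \<in> over (cball a 1)" using p by auto
    ultimately show "p \<in> U" by blast
  qed
  then show ?thesis using that[of "min r 1"] r(1) by simp
qed

end

section \<open>The lift of the antipodal map\<close>

locale antipodal_curve = cyclic_curve +
  assumes even_m: "even m" and odd_e: "odd e" and zero_R: "0 \<in> R"
    and antipode_R: "\<And>a. \<lbrakk>a \<in> R; a \<noteq> 0\<rbrakk> \<Longrightarrow> - 1 / cnj a \<in> R"
begin

definition polar :: complex where "polar = (\<Prod>a\<in>R - {0}. a)"

lemma card_nonzero: "Suc (Suc (card (R - {0}))) = m * e"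
  using cardR zero_R finR card_Suc_Diff1[OF finR zero_R] by simp

lemma antipode_bij: "bij_betw (\<lambda>a. - 1 / cnj a) (R - {0}) (R - {0})"
  by (rule bij_betw_byWitness[where f' = "\<lambda>a. - 1 / cnj a"]) (use antipode_R in auto)

lemma polar_nz: "polar \<noteq> 0" using finR by (simp add: polar_def)

text \<open>The antipodal map permutes the nonzero roots and inverts their norms, so the norm of
  their product equals its own inverse.\<close>

lemma norm_polar: "norm polar = 1"
proof -
  have "norm polar = norm (\<Prod>a\<in>R - {0}. - 1 / cnj a)"
    using prod.reindex_bij_betw[OF antipode_bij, of "\<lambda>a. a"] by (simp add: polar_def)
  also have "\<dots> = (\<Prod>a\<in>R - {0}. inverse (norm a))"
    by (simp add: norm_divide norm_inverse divide_inverse flip: prod_norm)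
  also have "\<dots> = inverse (norm polar)" 
    using prod_inversef[of norm "R - {0}"] by (simp add: polar_def o_def flip: prod_norm)
  finally have "norm polar * norm polar = 1" using polar_nz by (simp add: field_simps)
  then show ?thesis by (metis abs_norm_cancel abs_square_eq_1 power2_eq_square)
qed

lemma Q_nonzero_part: "Q z = z * (\<Prod>a\<in>R - {0}. z - a)"
  unfolding Q_def using prod.remove[OF finR zero_R, of "\<lambda>a. z - a"] by simp

text \<open>Replacing each nonzero root by its antipode turns every factor into the conjugate of a
  factor of \<open>Q z\<close>, divided by the conjugates of \<open>z\<close> and of the root. The
  exponent \<open>m * e\<close> is made of the \<open>m * e - 2\<close> nonzero roots, the root 0,
  and the factor \<open>z\<close> of \<open>Q z\<close>.\<close>

lemma Q_antipode:
  assumes z: "z \<noteq> 0"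
  shows "Q (- 1 / cnj z) = - cnj (Q z) / (cnj z ^ (m * e) * cnj polar)"
proof -
  have "(\<Prod>a\<in>R - {0}. - 1 / cnj z - a) = (\<Prod>a\<in>R - {0}. - 1 / cnj z - - 1 / cnj a)"
    using prod.reindex_bij_betw[OF antipode_bij, of "\<lambda>a. - 1 / cnj z - a"] by simp
  also have "\<dots> = (\<Prod>a\<in>R - {0}. cnj (z - a) / (cnj z * cnj a))"
    by (rule prod.cong) (use z in \<open>auto simp: field_simps\<close>)
  also have "\<dots> = cnj (\<Prod>a\<in>R - {0}. z - a) / (cnj z ^ card (R - {0}) * cnj polar)"
    by (simp add: polar_def prod_dividef prod.distrib)
  finally have "Q (- 1 / cnj z) = - cnj (\<Prod>a\<in>R - {0}. z - a) / (cnj z ^ Suc (card (R - {0})) * cnj polar)"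
    unfolding Q_nonzero_part[of "- 1 / cnj z"] by simp
  moreover have "cnj (\<Prod>a\<in>R - {0}. z - a) = cnj (Q z) / cnj z" using z by (simp add: Q_nonzero_part[of z])
  ultimately show ?thesis unfolding card_nonzero[symmetric] by (simp add: mult_ac)
qed

text \<open>The constant that makes \<open>anti\<close> respect the equation of the curve. It has
  norm 1 and therefore drops out when \<open>anti\<close> is squared.\<close>

definition c :: complex where "c = (SOME c. c ^ m = - 1 / cnj polar)"

lemma c_pow: "c ^ m = - 1 / cnj polar" and norm_c: "norm c = 1"
proof -
  have "\<exists>c::complex. c ^ m = - 1 / cnj polar"
  proof
    show "exp (Ln (- 1 / cnj polar) / m) ^ m = - 1 / cnj polar" using polar_nz by (simp add: exp_div_pow)
  qed
  then show c: "c ^ m = - 1 / cnj polar" unfolding c_def by (rule someI_ex)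
  have "norm c ^ m = 1" unfolding norm_power[symmetric] c by (simp add: norm_divide norm_polar)
  then show "norm c = 1" using m_pos power_eq_iff_eq_base[of m "norm c" 1] by simp
qed

lemma c_cnj: "c * cnj c = 1" by (simp add: complex_norm_square[symmetric] norm_c)

definition anti :: "complex \<times> complex \<Rightarrow> complex \<times> complex" where
  "anti p = (if p = om then (0, 0) else if fst p = 0 then om
     else (- 1 / cnj (fst p), c * cnj (snd p) / cnj (fst p) ^ e))"

lemma origin_curve: "(0, 0) \<in> curve"
  using m_pos zero_R by (simp add: Q_eq_0_iff[THEN iffD2])

lemma origin_unique: "\<lbrakk>p \<in> curve; fst p = 0\<rbrakk> \<Longrightarrow> p = (0, 0)"
  using m_pos zero_R by (cases p) (simp add: Q_eq_0_iff[THEN iffD2])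

lemma anti_om: "anti om = (0, 0)" and anti_origin: "anti (0, 0) = om"
  using over_neq_om[OF origin_curve] by (auto simp: anti_def)

lemma anti_generic:
  assumes p: "p \<in> over (- {0})"
  shows "anti p = (- 1 / cnj (fst p), c * cnj (snd p) / cnj (fst p) ^ e)" "anti p \<in> over (- {0})"
proof -
  have z: "fst p \<noteq> 0" and w: "snd p ^ m = Q (fst p)" using p by auto
  show eq: "anti p = (- 1 / cnj (fst p), c * cnj (snd p) / cnj (fst p) ^ e)"
    using over_neq_om[OF p] z by (simp add: anti_def)
  have "(c * cnj (snd p) / cnj (fst p) ^ e) ^ m = c ^ m * cnj (Q (fst p)) / cnj (fst p) ^ (m * e)"
    by (simp add: power_mult_distrib power_divide mult.commute[of m] power_mult flip: w)
  also have "\<dots> = Q (- 1 / cnj (fst p))" unfolding Q_antipode[OF z] c_pow by (simp add: mult_ac)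
  finally show "anti p \<in> over (- {0})" unfolding eq using z by simp
qed

lemma over_pts: "p \<in> over K \<Longrightarrow> p \<in> pts" by (simp add: pts_def)

lemma pts_cases':
  assumes "p \<in> pts" obtains "p = om" | "p = (0, 0)" | "p \<in> over (- {0})"
proof (cases "p = om")
  case False
  then have c: "p \<in> curve" using assms unfolding pts_def by blast
  show ?thesis
  proof (cases "fst p = 0")
    case True then show ?thesis using that(2) origin_unique[OF c] by blast
  next
    case False then show ?thesis using that(3) c by simp
  qed
qed (rule that(1))

text \<open>The two denominators combine to the e-th power of -1, so the oddness of \<open>e\<close>
  produces the sign.\<close>

lemma anti_anti_generic: "p \<in> over (- {0}) \<Longrightarrow> anti (anti p) = (fst p, - snd p)"
proof -
  assume p: "p \<in> over (- {0})"
  have z: "fst p \<noteq> 0" using p by simp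
  have "c * (cnj c * snd p / fst p ^ e) / (- 1 / fst p) ^ e = (c * cnj c) * (- snd p)"
    using z odd_e by (simp add: power_divide field_simps)
  also have "\<dots> = - snd p" by (simp only: c_cnj) simp
  finally have "c * (cnj c * snd p / fst p ^ e) / (- 1 / fst p) ^ e = - snd p" .
  then show ?thesis
    unfolding anti_generic(1)[OF anti_generic(2)[OF p]] unfolding anti_generic(1)[OF p] by simp
qed

lemma anti_pts: "p \<in> pts \<Longrightarrow> anti p \<in> pts"
  by (erule pts_cases') (use anti_om anti_origin origin_curve anti_generic(2) in \<open>auto simp: pts_def\<close>)

lemma openin_generic_part:
  assumes "openin X U" shows "openin (top_of_set curve) {p \<in> over (- {0}). anti p \<in> U}"
proof -
  have "continuous_on (over (- {0})) (\<lambda>p. (- 1 / cnj (fst p), c * cnj (snd p) / cnj (fst p) ^ e))"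
    by (intro continuous_intros) auto
  then have cont: "continuous_on (over (- {0})) anti"
    by (rule continuous_on_eq) (simp add: anti_generic(1))
  have "openin (top_of_set curve) (U - {om})" using assms by (simp add: openin_X)
  then obtain V where V: "open V" "U - {om} = curve \<inter> V" by (auto simp: openin_open)
  have o: "openin (top_of_set curve) (over (- {0}))" by (rule openin_curve) auto
  have "openin (top_of_set (over (- {0}))) (over (- {0}) \<inter> anti -` V)"
    using continuous_openin_preimage_gen[OF cont V(1)] .
  then have "openin (top_of_set curve) (over (- {0}) \<inter> anti -` V)"
    using openin_trans o by blast
  moreover have "over (- {0}) \<inter> anti -` V = {p \<in> over (- {0}). anti p \<in> U}"
  proof -
    have "anti p \<in> V \<longleftrightarrow> anti p \<in> U" if "p \<in> over (- {0})" for p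
    proof -
      have "anti p \<in> curve" using anti_generic(2)[OF that] by simp
      then have "anti p \<in> V \<longleftrightarrow> anti p \<in> U - {om}" unfolding V(2) by (simp del: mem_over)
      then show ?thesis using over_neq_om[OF anti_generic(2)[OF that]] by simp
    qed
    then show ?thesis by blast
  qed
  ultimately show ?thesis by simp
qed

text \<open>Only the exchange of \<open>(0, 0)\<close> and \<open>om\<close> needs an argument:
  norms of \<open>z\<close> are inverted, so discs around 0 and outsides of discs
  correspond.\<close>

lemma anti_cont: "continuous_map X X anti"
  unfolding continuous_map_def topspace_X
proof (intro conjI allI impI)
  show "anti \<in> pts \<rightarrow> pts" using anti_pts by blast
  fix U assume U: "openin X U"
  let ?V = "{p \<in> pts. anti p \<in> U}"
  let ?G = "{p \<in> over (- {0}). anti p \<in> U}"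
  note G = openin_generic_part[OF U]
  have open_V: "openin (top_of_set curve) (?V - {om})"
  proof (cases "om \<in> U")
    case False
    have "(0, 0) \<notin> ?V" using False anti_origin by simp
    have "p \<in> ?V - {om} \<longleftrightarrow> p \<in> ?G" for p
    proof
      assume p: "p \<in> ?V - {om}"
      then have "p \<in> pts" by blast
      then show "p \<in> ?G" by (rule pts_cases') (use p \<open>(0, 0) \<notin> ?V\<close> in blast)+
    next
      assume p: "p \<in> ?G"
      then have "p \<in> over (- {0})" by blast
      then show "p \<in> ?V - {om}" using p over_pts over_neq_om by blast
    qed
    then have "?V - {om} = ?G" by blast
    then show ?thesis using G by simp
  next
    case True
    obtain B where B: "B > 0" "over {z. norm z > B} \<subseteq> U" using neighborhood_om[OF U True] .
    have ball: "p \<in> ?V" if p: "p \<in> over (ball 0 (1 / B))" for p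
    proof (cases "fst p = 0")
      case True
      then have "p = (0, 0)" using origin_unique p by simp
      then show ?thesis using \<open>om \<in> U\<close> anti_origin over_pts[OF p] by simp
    next
      case False
      then have p': "p \<in> over (- {0})" using p by simp
      have "norm (fst (anti p)) > B"
        unfolding anti_generic(1)[OF p'] using p False B(1) by (simp add: norm_divide field_simps)
      then have "anti p \<in> over {z. norm z > B}" using anti_generic(2)[OF p'] by simp
      then show ?thesis using B(2) over_pts[OF p] by blast
    qed
    have o: "(0, 0) \<in> over (ball 0 (1 / B))" using origin_curve B(1) by simp
    have "p \<in> ?V - {om} \<longleftrightarrow> p \<in> ?G \<union> over (ball 0 (1 / B))" for p
    proof
      assume p: "p \<in> ?V - {om}"
      then have "p \<in> pts" by blast
      then show "p \<in> ?G \<union> over (ball 0 (1 / B))" by (rule pts_cases') (use p o in blast)+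
    next
      assume "p \<in> ?G \<union> over (ball 0 (1 / B))"
      then consider "p \<in> over (- {0})" "anti p \<in> U" | "p \<in> over (ball 0 (1 / B))" by blast
      then show "p \<in> ?V - {om}"
      proof cases
        case 1 then show ?thesis using over_pts over_neq_om by blast
      next
        case 2 then show ?thesis using ball over_neq_om by blast
      qed
    qed
    then have "?V - {om} = ?G \<union> over (ball 0 (1 / B))" by blast
    then show ?thesis using G openin_curve[of "ball 0 (1 / B)"] by (simp add: openin_Un)
  qed
  have "compact (curve - ?V)" if "om \<in> ?V"
  proof -
    have "(0, 0) \<in> U" using that anti_om by simp
    then obtain r where r: "r > 0" "over (ball 0 r) \<subseteq> U" using neighborhood_ramified[OF U _ zero_R] by blast
    have sub: "curve - ?V \<subseteq> over (cball 0 (1 / r))"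
    proof
      fix p assume p: "p \<in> curve - ?V"
      show "p \<in> over (cball 0 (1 / r))"
      proof (rule ccontr)
        assume "p \<notin> over (cball 0 (1 / r))"
        moreover have pc: "p \<in> curve" using p by (rule DiffD1)
        ultimately have n: "norm (fst p) > 1 / r" by simp
        moreover have "1 / r > 0" using r(1) by simp
        ultimately have "fst p \<noteq> 0" by fastforce
        then have p': "p \<in> over (- {0})" using pc by simp
        have "norm (fst (anti p)) < r"
          unfolding anti_generic(1)[OF p'] using n r(1) \<open>fst p \<noteq> 0\<close> by (simp add: norm_divide field_simps)
        then have "anti p \<in> over (ball 0 r)" using anti_generic(2)[OF p'] by simp
        with r(2) have "anti p \<in> U" by (rule subsetD)
        then have "p \<in> ?V" using over_pts[OF p'] by (intro CollectI conjI)
        with p show False by (rule DiffD2)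
      qed
    qed
    have "curve - ?V = curve - (?V - {om})" using over_neq_om by blast
    then have "closedin (top_of_set curve) (curve - ?V)" using open_V by (simp add: closedin_diff)
    then have "closed (curve - ?V)" using closed_over[of UNIV] closedin_closed_trans by blast
    then have "compact (over (cball 0 (1 / r)) \<inter> (curve - ?V))" by (intro compact_Int_closed compact_over) auto
    then show ?thesis using sub by (simp add: Int_absorb1)
  qed
  then show "openin X ?V" unfolding openin_X[of ?V] using open_V by blast
qed

end

section \<open>Powers of the rotation\<close>

context cyclic_curve begin

definition deck :: "nat \<Rightarrow> complex \<times> complex \<Rightarrow> complex \<times> complex" where
  "deck j = (\<lambda>p\<in>pts. if p = om then om else (fst p, \<zeta> ^ j * snd p))"

lemma deck_om [simp]: "deck j om = om"
  and deck_curve: "p \<in> over K \<Longrightarrow> deck j p = (fst p, \<zeta> ^ j * snd p)"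
  using over_neq_om by (auto simp: deck_def pts_def)

lemma zeta_pow_mult_pow: "(\<zeta> ^ j * w) ^ m = w ^ m"
  by (simp add: power_mult_distrib power_mult[symmetric] mult.commute[of j]) (simp add: power_mult)

lemma deck_over: "p \<in> over K \<Longrightarrow> deck j p \<in> over K"
  unfolding deck_curve by (simp add: zeta_pow_mult_pow)

lemma deck_pts: "p \<in> pts \<Longrightarrow> deck j p \<in> pts"
  using deck_over[of p UNIV] unfolding pts_def by (metis deck_om insert_iff)

lemma deck_deck: "p \<in> pts \<Longrightarrow> deck i (deck j p) = deck (i + j) p"
proof (cases "p = om")
  case False
  assume "p \<in> pts"
  then have p: "p \<in> curve" using False by (auto simp: pts_def)
  show ?thesis unfolding deck_curve[OF deck_over[OF p]] unfolding deck_curve[OF p]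
    by (simp add: power_add mult.assoc)
qed simp

lemma deck_multiple: "p \<in> pts \<Longrightarrow> deck (m * j) p = p"
  by (simp add: deck_def power_mult)

lemma deck_Bij: "deck j \<in> Bij pts"
proof -
  \<comment> \<open>The inverse is again written with a natural exponent: \<open>(m - 1) * j\<close>
    completes \<open>j\<close> to a multiple of \<open>m\<close>.\<close>
  have "j + (m - 1) * j = m * j" using m_pos by (cases m) simp_all
  then have "deck j (deck ((m - 1) * j) p) = p" "deck ((m - 1) * j) (deck j p) = p" if "p \<in> pts" for p
    using that by (simp_all only: deck_deck deck_multiple add.commute[of "(m - 1) * j"])
  then have "bij_betw (deck j) pts pts"
    by (intro bij_betw_byWitness[where f' = "deck ((m - 1) * j)"])
      (simp_all add: deck_pts image_subset_iff)
  then show ?thesis by (simp add: Bij_def deck_def)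
qed

lemma BijGroup_mult: "\<lbrakk>f \<in> Bij S; g \<in> Bij S\<rbrakk> \<Longrightarrow> f \<otimes>\<^bsub>BijGroup S\<^esub> g = compose S f g"
  by (simp add: BijGroup_def)

lemma deck_mult: "deck i \<otimes>\<^bsub>BijGroup pts\<^esub> deck j = deck (i + j)"
  unfolding BijGroup_mult[OF deck_Bij deck_Bij]
proof (rule extensionalityI[of _ pts])
  show "deck (i + j) \<in> extensional pts" by (simp add: deck_def)
  fix p assume "p \<in> pts"
  then show "compose pts (deck i) (deck j) p = deck (i + j) p" by (simp add: compose_eq deck_deck)
qed simp

lemma deck_one: "deck (m * j) = \<one>\<^bsub>BijGroup pts\<^esub>"
proof (rule extensionalityI[of _ pts])
  show "deck (m * j) \<in> extensional pts" by (simp add: deck_def)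
qed (simp_all add: BijGroup_def deck_multiple)

lemma deck_pow: "deck 1 [^]\<^bsub>BijGroup pts\<^esub> (j::nat) = deck j"
proof (induction j)
  case 0 then show ?case using deck_one[of 0] by simp
next
  case (Suc j) then show ?case using deck_mult[of j 1] by simp
qed

lemma deck_neq_one:
  assumes "0 < j" "j < m" shows "deck j \<noteq> \<one>\<^bsub>BijGroup pts\<^esub>"
proof
  assume eq: "deck j = \<one>\<^bsub>BijGroup pts\<^esub>"
  obtain z where z: "z \<notin> R" using ex_new_if_finite[OF infinite_UNIV_char_0 finR] by blast
  obtain w where w: "w ^ m = Q z" using over_fiber_nonempty by blast
  then have p: "(z, w) \<in> curve" by simp
  have "w \<noteq> 0" using w z m_pos Q_eq_0_iff[of z] by (metis power_eq_0_iff)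
  have "deck j (z, w) = (z, w)" using eq p by (simp add: BijGroup_def pts_def)
  then have "\<zeta> ^ j * w = w" unfolding deck_curve[OF p] by simp
  then have "\<zeta> ^ j = 1" using \<open>w \<noteq> 0\<close> by simp
  then show False using zeta_inj[of j 0] assms by simp
qed

lemma deck_cont: "continuous_map X X (deck j)"
proof (rule continuous_X_extend)
  show "continuous_on curve (\<lambda>p. (fst p, \<zeta> ^ j * snd p))" by (intro continuous_intros)
  show "(\<lambda>p. (fst p, \<zeta> ^ j * snd p)) ` curve \<subseteq> curve" by (auto simp: zeta_pow_mult_pow)
qed (simp_all add: deck_curve del: mem_over)

lemma deck_conformal: "conformal_automorphism X atlas (deck j)"
proof (rule conformal_automorphismI)
  show "homeomorphic_map X X (deck j)" by (rule homeomorphic_X_Bij[OF deck_Bij deck_cont])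
  fix i k assume "i \<in> I" "k \<in> I"
  then have "(id \<circ> cc k \<circ> deck j \<circ> inv_into (cU i) (cc i)) holomorphic_on cc i ` {p \<in> cU i. deck j p \<in> cU k}"
  proof (rule chart_map_holo[OF deck_cont _ _ finite.emptyI])
    show "deck j p \<in> curve" if "p \<in> over (- {})" for p using deck_over[of p "- {}"] that by simp
    fix u v D assume uv: "u holomorphic_on D" "v holomorphic_on D" and mem: "\<And>s. s \<in> D \<Longrightarrow> (u s, v s) \<in> over (- {})"
    have "(\<lambda>s. id (fst (deck j (u s, v s)))) holomorphic_on D"
      using uv(1) by (rule holomorphic_transform) (simp add: deck_curve[OF mem])
    moreover have "(\<lambda>s. \<zeta> ^ j * v s) holomorphic_on D" using uv(2) by (intro holomorphic_intros)
    then have "(\<lambda>s. id (snd (deck j (u s, v s)))) holomorphic_on D"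
      by (rule holomorphic_transform) (simp add: deck_curve[OF mem])
    ultimately show "(\<lambda>s. id (fst (deck j (u s, v s)))) holomorphic_on D \<and> (\<lambda>s. id (snd (deck j (u s, v s)))) holomorphic_on D" ..
  qed simp
  then show "(cc k \<circ> deck j \<circ> inv_into (cU i) (cc i)) holomorphic_on cc i ` {p \<in> cU i. deck j p \<in> cU k}"
    by simp
qed (rule deck_Bij)

lemma conformal_is_deck:
  assumes "R = branch_points l" "l \<ge> 6" and f: "conformal_automorphism X atlas f"
  obtains j where "f = deck j"
proof -
  interpret curve_automorphism R m e f by unfold_locales (rule f)
  obtain j where j: "f om = om" "\<And>p. p \<in> curve \<Longrightarrow> f p = (fst p, \<zeta> ^ j * snd p)"
    using conformal_rotation[OF assms(1,2)] by metis
  have "f = deck j"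
  proof (rule extensionalityI[OF ext])
    show "deck j \<in> extensional pts" by (simp add: deck_def)
    fix p assume "p \<in> pts"
    then consider "p = om" | "p \<in> curve" using pts_cases by blast
    then show "f p = deck j p" by cases (simp_all add: j deck_curve del: mem_over)
  qed
  then show ?thesis by (rule that)
qed

end

section \<open>The full automorphism group\<close>

context antipodal_curve begin

definition antiB :: "complex \<times> complex \<Rightarrow> complex \<times> complex" where "antiB = restrict anti pts"

lemma zeta_half: "\<zeta> ^ (m div 2) = - 1"
proof -
  have "real (m div 2) = real m / 2" using even_m by (simp add: real_of_nat_div)
  then have "2 * pi * real (m div 2) / real m = pi" using m_pos by (simp only:) simp
  then show ?thesis unfolding zeta_pow by (simp only: cis_pi)
qed

lemma anti_anti: "p \<in> pts \<Longrightarrow> anti (anti p) = deck (m div 2) p"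
proof (erule pts_cases')
  assume "p = om" then show ?thesis by (simp add: anti_om anti_origin)
next
  assume "p = (0, 0)" then show ?thesis by (simp add: anti_om anti_origin deck_curve[OF origin_curve])
next
  assume "p \<in> over (- {0})"
  then show ?thesis by (simp only: anti_anti_generic deck_curve zeta_half) simp
qed

lemma antiB_Bij: "antiB \<in> Bij pts"
proof -
  have "anti (anti (anti (anti p))) = p" if "p \<in> pts" for p
    using that even_m deck_multiple[of p 1] by (simp add: anti_anti anti_pts deck_deck deck_pts flip: mult_2)
  then have "bij_betw anti pts pts"
    by (intro bij_betw_byWitness[where f' = "\<lambda>p. anti (anti (anti p))"]) (auto simp: anti_pts)
  then show ?thesis by (auto simp: Bij_def antiB_def intro: bij_betw_cong[THEN iffD1, rotated])
qed

lemma antiB_square: "antiB \<otimes>\<^bsub>BijGroup pts\<^esub> antiB = deck (m div 2)"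
  unfolding BijGroup_mult[OF antiB_Bij antiB_Bij]
proof (rule extensionalityI[of _ pts])
  show "deck (m div 2) \<in> extensional pts" by (simp add: deck_def)
  fix p assume "p \<in> pts"
  then show "compose pts antiB antiB p = deck (m div 2) p"
    by (simp add: compose_eq antiB_def anti_anti anti_pts)
qed simp

lemma cnj_zeta: "cnj \<zeta> = \<zeta> ^ (m - 1)"
proof -
  have "\<zeta> * cnj \<zeta> = 1" by (simp add: complex_norm_square[symmetric])
  moreover have "\<zeta> * \<zeta> ^ (m - 1) = 1" using m_pos zeta_m by (simp flip: power_Suc)
  ultimately show ?thesis by (metis mult_left_cancel zeta_nz)
qed

text \<open>Conjugation turns \<zeta> into its inverse; this is the relation that conjugation by
  \<open>y\<close> inverts \<open>x\<close>.\<close>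

lemma anti_deck: "p \<in> pts \<Longrightarrow> anti (deck 1 p) = deck (m - 1) (anti p)"
proof (erule pts_cases')
  assume "p = om" then show ?thesis by (simp add: anti_om deck_curve[OF origin_curve])
next
  assume "p = (0, 0)" then show ?thesis by (simp add: anti_origin deck_curve[OF origin_curve])
next
  assume p: "p \<in> over (- {0})"
  show ?thesis
    unfolding anti_generic(1)[OF deck_over[OF p]] deck_curve[OF anti_generic(2)[OF p]]
    unfolding anti_generic(1)[OF p] deck_curve[OF p] by (simp add: cnj_zeta)
qed

lemma dicyclic_relators_deck: "dicyclic_relators (BijGroup pts) (deck 1) antiB (m div 2)"
proof -
  interpret group "BijGroup pts" by (rule group_BijGroup)
  show ?thesis
  proof
    show c: "deck 1 \<in> carrier (BijGroup pts)" "antiB \<in> carrier (BijGroup pts)"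
      using deck_Bij antiB_Bij by (simp_all add: BijGroup_def)
    show "0 < m div 2" using m2 by simp
    show "deck 1 [^]\<^bsub>BijGroup pts\<^esub> (2 * (m div 2)) = \<one>\<^bsub>BijGroup pts\<^esub>"
      using even_m deck_one[of 1] by (simp only: deck_pow) simp
    show "antiB \<otimes>\<^bsub>BijGroup pts\<^esub> antiB = deck 1 [^]\<^bsub>BijGroup pts\<^esub> (m div 2)"
      by (simp only: deck_pow antiB_square)
    have "deck (m - 1) \<otimes>\<^bsub>BijGroup pts\<^esub> deck 1 = \<one>\<^bsub>BijGroup pts\<^esub>"
      using deck_one[of 1] m_pos by (simp add: deck_mult)
    moreover have dc: "deck (m - 1) \<in> carrier (BijGroup pts)" using deck_Bij by (simp add: BijGroup_def)
    ultimately have inv: "inv\<^bsub>BijGroup pts\<^esub> deck 1 = deck (m - 1)" using inv_equality c(1) by simp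
    show "antiB \<otimes>\<^bsub>BijGroup pts\<^esub> deck 1 = inv\<^bsub>BijGroup pts\<^esub> deck 1 \<otimes>\<^bsub>BijGroup pts\<^esub> antiB"
      unfolding inv BijGroup_mult[OF antiB_Bij deck_Bij] BijGroup_mult[OF deck_Bij antiB_Bij]
    proof (rule extensionalityI[of _ pts])
      fix p assume "p \<in> pts"
      then show "compose pts antiB (deck 1) p = compose pts (deck (m - 1)) antiB p"
        using anti_deck[of p] by (simp add: compose_eq antiB_def anti_pts deck_pts)
    qed simp_all
  qed
qed

text \<open>The elements outside the cyclic subgroup. In spite of the name none of them is an
  involution: each has square \<open>deck (m div 2)\<close>.\<close>

definition reflection :: "nat \<Rightarrow> complex \<times> complex \<Rightarrow> complex \<times> complex" where
  "reflection j = deck j \<otimes>\<^bsub>BijGroup pts\<^esub> antiB"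

lemma reflection_eq: "reflection j = compose pts (deck j) antiB"
  by (simp add: reflection_def BijGroup_mult deck_Bij antiB_Bij)

lemma reflection_generic:
  "p \<in> over (- {0}) \<Longrightarrow> reflection j p = (- 1 / cnj (fst p), \<zeta> ^ j * (c * cnj (snd p) / cnj (fst p) ^ e))"
  unfolding reflection_eq compose_eq[OF over_pts] antiB_def restrict_apply'[OF over_pts]
    deck_curve[OF anti_generic(2)] by (simp only: anti_generic(1)) simp

lemma reflection_anticonformal: "anticonformal_automorphism X atlas (reflection j)"
proof (rule anticonformal_automorphismI)
  show B: "reflection j \<in> Bij pts" unfolding reflection_eq by (intro compose_Bij deck_Bij antiB_Bij)
  have "continuous_map X X (deck j \<circ> anti)" by (rule continuous_map_compose[OF anti_cont deck_cont])
  then have cont: "continuous_map X X (reflection j)"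
    by (rule continuous_map_eq) (simp add: reflection_eq compose_eq antiB_def)
  show "homeomorphic_map X X (reflection j)" by (rule homeomorphic_X_Bij[OF B cont])
  fix i k assume "i \<in> I" "k \<in> I"
  then show "(cnj \<circ> cc k \<circ> reflection j \<circ> inv_into (cU i) (cc i)) holomorphic_on cc i ` {p \<in> cU i. reflection j p \<in> cU k}"
  proof (rule chart_map_holo[OF cont])
    show "finite {0::complex}" by simp
    fix p assume p: "p \<in> over (- {0})"
    have "reflection j p = deck j (anti p)"
      using over_pts[OF p] by (simp add: reflection_eq compose_eq antiB_def)
    then show "reflection j p \<in> curve" using deck_over[OF anti_generic(2)[OF p]] by simp
  next
    fix u v D assume uv: "u holomorphic_on D" "v holomorphic_on D" and mem: "\<And>s. s \<in> D \<Longrightarrow> (u s, v s) \<in> over (- {0})"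
    have nz: "u s \<noteq> 0" if "s \<in> D" for s using mem[OF that] by simp
    have "(\<lambda>s. - 1 / u s) holomorphic_on D" using uv nz by (intro holomorphic_intros)
    then have "(\<lambda>s. cnj (fst (reflection j (u s, v s)))) holomorphic_on D"
      by (rule holomorphic_transform) (simp add: reflection_generic[OF mem])
    moreover have "(\<lambda>s. cnj (\<zeta> ^ j) * (cnj c * v s / u s ^ e)) holomorphic_on D"
      using uv nz by (intro holomorphic_intros) auto
    then have "(\<lambda>s. cnj (snd (reflection j (u s, v s)))) holomorphic_on D"
      by (rule holomorphic_transform) (simp add: reflection_generic[OF mem])
    ultimately show "(\<lambda>s. cnj (fst (reflection j (u s, v s)))) holomorphic_on D \<and> (\<lambda>s. cnj (snd (reflection j (u s, v s)))) holomorphic_on D" ..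
  qed simp
qed

context
  fixes l assumes R: "R = branch_points l" and l: "l \<ge> 6"
begin

lemma conformal_iff: "conformal_automorphism X atlas f \<longleftrightarrow> f \<in> range deck"
  using deck_conformal conformal_is_deck[OF R l] by blast

text \<open>Composition with \<open>antiB\<close> turns an anticonformal map into a conformal one,
  hence into a power of the rotation; the relations then solve for the map.\<close>

lemma anticonformal_iff: "anticonformal_automorphism X atlas f \<longleftrightarrow> f \<in> range reflection"
proof
  interpret D: dicyclic_relators "BijGroup pts" "deck 1" antiB "m div 2" by (rule dicyclic_relators_deck)
  assume f: "anticonformal_automorphism X atlas f"
  then have fB: "f \<in> Bij pts" by (simp add: anticonformal_automorphism_def)
  have a0: "reflection 0 = antiB"
    unfolding reflection_def using deck_one[of 0] D.y by simp
  have "conformal_automorphism X atlas (compose pts antiB f)"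
    using conformal_comp[OF f reflection_anticonformal[of 0]] a0 by simp
  then obtain j where "compose pts antiB f = deck j" using conformal_is_deck[OF R l] by blast
  then have "antiB \<otimes>\<^bsub>BijGroup pts\<^esub> f = deck 1 [^]\<^bsub>BijGroup pts\<^esub> j"
    by (simp only: BijGroup_mult[OF antiB_Bij fB] deck_pow)
  moreover have "f \<in> carrier (BijGroup pts)" using fB by (simp add: BijGroup_def)
  ultimately obtain k where "f = deck 1 [^]\<^bsub>BijGroup pts\<^esub> (k::nat) \<otimes>\<^bsub>BijGroup pts\<^esub> antiB"
    using D.normal_forms_inverse by blast
  then have "f = reflection k" by (simp only: deck_pow reflection_def)
  then show "f \<in> range reflection" by blast
qed (use reflection_anticonformal in blast)

lemma Aut_X: "Aut X atlas = BijGroup pts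
    \<lparr>carrier := dicyclic_relators.normal_forms (BijGroup pts) (deck 1) antiB\<rparr>"
proof -
  interpret D: dicyclic_relators "BijGroup pts" "deck 1" antiB "m div 2" by (rule dicyclic_relators_deck)
  have "D.normal_forms = range deck \<union> range reflection"
    unfolding D.normal_forms_def deck_pow reflection_def by simp
  then show ?thesis
    unfolding Aut_def conformal_iff anticonformal_iff by (simp add: Un_def)
qed

theorem pseudo_real_X: "pseudo_real X atlas"
  unfolding pseudo_real_def
proof (intro conjI closed_riemann_surface_X)
  show "\<exists>f. anticonformal_automorphism X atlas f" using reflection_anticonformal by blast
  show "\<nexists>f. anticonformal_automorphism X atlas f \<and> f \<otimes>\<^bsub>Aut X atlas\<^esub> f = \<one>\<^bsub>Aut X atlas\<^esub>"
  proof
    interpret D: dicyclic_relators "BijGroup pts" "deck 1" antiB "m div 2" by (rule dicyclic_relators_deck)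
    assume "\<exists>f. anticonformal_automorphism X atlas f \<and> f \<otimes>\<^bsub>Aut X atlas\<^esub> f = \<one>\<^bsub>Aut X atlas\<^esub>"
    then obtain j where j: "reflection j \<otimes>\<^bsub>BijGroup pts\<^esub> reflection j = \<one>\<^bsub>BijGroup pts\<^esub>"
      unfolding anticonformal_iff by (auto simp: Aut_X)
    have "reflection j \<otimes>\<^bsub>BijGroup pts\<^esub> reflection j = deck (m div 2)"
      using D.square_outside[of j] by (simp only: deck_pow reflection_def)
    then show False using deck_neq_one[of "m div 2"] j m2 by simp
  qed
qed

theorem Aut_X_iso:
  "\<exists>\<Phi> \<in> iso (Aut X atlas) (dicyclic_group (m div 2)).
     \<Phi> ` Aut_plus X atlas = generate (dicyclic_group (m div 2)) {dicyclic_x (m div 2)}"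
proof -
  interpret D: dicyclic_relators "BijGroup pts" "deck 1" antiB "m div 2" by (rule dicyclic_relators_deck)
  have "Aut_plus X atlas = range (\<lambda>j::nat. deck 1 [^]\<^bsub>BijGroup pts\<^esub> j)"
    unfolding Aut_plus_def conformal_iff deck_pow by simp
  \<comment> \<open>The point at infinity is fixed by all rotations but moved by
    \<open>antiB\<close>.\<close>
  moreover have "deck j \<noteq> antiB" for j
  proof
    assume "deck j = antiB"
    then have "deck j om = antiB om" by simp
    then have "(0, 0) = om" by (simp add: antiB_def anti_om pts_def)
    then show False using over_neq_om[OF origin_curve] by blast
  qed
  moreover have "deck i \<noteq> \<one>\<^bsub>BijGroup pts\<^esub>" if "0 < i" "i < 2 * (m div 2)" for i
    using deck_neq_one[of i] that even_m by simp
  ultimately show ?thesis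
    using D.dicyclic_group_iso unfolding Aut_X by (simp only: deck_pow) blast
qed

end

end

section \<open>The branch points for the given parameters\<close>

lemma finite_branch_points: "finite (branch_points l)"
  by (simp add: branch_points_def)

lemma card_branch_points:
  assumes "l \<ge> 2" shows "card (branch_points l) = 2 * l - 1"
proof -
  let ?A = "{0, 2 * \<i>, - \<i> / 2} :: complex set"
  let ?B = "of_nat ` {2..<l} :: complex set"
  let ?C = "(\<lambda>j. - 1 / of_nat j) ` {2..<l} :: complex set"
  have A: "card ?A = 3" by (simp add: complex_eq_iff)
  have B: "card ?B = l - 2" by (simp add: card_image inj_on_def)
  have C: "card ?C = l - 2" by (subst card_image) (auto simp: inj_on_def)
  have bre: "Re b \<ge> 2 \<and> Im b = 0" if "b \<in> ?B" for b using that by auto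
  have cre: "Re b < 0 \<and> Im b = 0" if "b \<in> ?C" for b using that by (auto simp: Re_divide_of_nat Im_divide_of_nat)
  have are: "Re b = 0" if "b \<in> ?A" for b using that by auto
  have "False" if "b \<in> ?A" "b \<in> ?B" for b using are[OF that(1)] bre[OF that(2)] by simp
  then have d2: "?A \<inter> ?B = {}" by blast
  have "Re b \<ge> 0" if "b \<in> ?A \<union> ?B" for b using that are bre by fastforce
  then have "False" if "b \<in> ?A \<union> ?B" "b \<in> ?C" for b using cre[OF that(2)] that(1) by fastforce
  then have d1: "(?A \<union> ?B) \<inter> ?C = {}" by blast
  have "card (branch_points l) = 3 + (l - 2) + (l - 2)"
  proof -
    have "card (?A \<union> ?B \<union> ?C) = card (?A \<union> ?B) + card ?C" by (rule card_Un_disjoint[OF _ _ d1]) simp_all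
    moreover have "card (?A \<union> ?B) = card ?A + card ?B" by (rule card_Un_disjoint[OF _ _ d2]) simp_all
    ultimately show ?thesis unfolding branch_points_def using A B C by linarith
  qed
  then show ?thesis using assms by simp
qed

lemma antipode_branch_points:
  assumes "a \<in> branch_points l" "a \<noteq> 0" shows "- 1 / cnj a \<in> branch_points l"
proof -
  consider "a = 2 * \<i>" | "a = - \<i> / 2" | j where "j \<in> {2..<l}" "a = of_nat j" | j where "j \<in> {2..<l}" "a = - 1 / of_nat j"
    using assms by (auto simp: branch_points_def)
  then show ?thesis
  proof cases
    case 1
    then have "- 1 / cnj a = - \<i> / 2" by (simp add: field_simps)
    then show ?thesis by (simp add: branch_points_def)
  next
    case 2
    then have "- 1 / cnj a = 2 * \<i>" by (simp only: 2) (simp add: field_simps)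
    then show ?thesis by (simp add: branch_points_def)
  next
    case (3 j)
    then have "- 1 / cnj a = - 1 / of_nat j" by simp
    then show ?thesis using 3(1) unfolding branch_points_def by blast
  next
    case (4 j)
    then have "- 1 / cnj a = of_nat j" by simp
    then show ?thesis using 4(1) unfolding branch_points_def by blast
  qed
qed

theorem theorem2p9:
  fixes n q l :: nat
  assumes "n \<ge> 2" and "q \<ge> 2" and "l = n * (2 * q - 1)"
  shows "\<exists>(X :: (complex \<times> complex) topology) A.
           pseudo_real X A \<and>
           has_genus X ((l - 1) * (2 * n - 1)) \<and>
           (\<exists>\<Phi> \<in> iso (Aut X A) (dicyclic_group n).
              \<Phi> ` Aut_plus X A = generate (dicyclic_group n) {dicyclic_x n})"
proof -
  have l: "l \<ge> 6" using mult_le_mono[OF assms(1), of 3 "2 * q - 1"] assms(2,3) by simp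
  \<comment> \<open>With these values \<open>m * e\<close> equals \<open>2 * l\<close>, one more
    than the number of finite branch points.\<close>
  interpret antipodal_curve "branch_points l" "2 * n" "2 * q - 1"
  proof
    show "card (branch_points l) + 1 = 2 * n * (2 * q - 1)"
      using l assms(3) by (simp add: card_branch_points)
    show "0 \<in> branch_points l" by (simp add: branch_points_def)
    show "- 1 / cnj a \<in> branch_points l" if "a \<in> branch_points l" "a \<noteq> 0" for a
      using that by (rule antipode_branch_points)
  qed (use assms in \<open>auto simp: finite_branch_points\<close>)
  \<comment> \<open>The first homology has rank \<open>(m * e - 2) * (m - 1)\<close>, and half of
    the first factor is \<open>l - 1\<close>.\<close>
  have "2 * n * (2 * q - 1) - 2 = 2 * (l - 1)" using assms(3) by (simp add: mult.assoc diff_mult_distrib2)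
  then have "2 * ((l - 1) * (2 * n - 1)) = (2 * n * (2 * q - 1) - 2) * (2 * n - 1)"
    by (simp only: mult.assoc)
  then have "has_genus X ((l - 1) * (2 * n - 1))" by (rule has_genus_X)
  then show ?thesis
    using pseudo_real_X[OF HOL.refl l] Aut_X_iso[OF HOL.refl l] by auto
qed

end
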